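(* Assume that the singularities of $Y_0$ are ordinary double points. Then the singularities of the total space $Y$ are of type $A_m$ (with $m\geq 1$ depending on the singular point).
   Context: Setting. $X$ is a smooth complex projective variety of dimension $2n$, $\mathcal L$ is an ample line bundle on $X$, and $k$ is a positive integer such that $\mathcal L^k$ is very ample. $S=|\mathcal L^k|$, $\mathcal X=\coprod_{s\in S}X_s\to S$ is the universal family of hyperplane sections, and $D\subset S$ is its discriminant (the set of $s$ with $X_s$ singular). It is assumed that the vanishing cycle at a general point of $D$ does not vanish. Let $0\in D$. Choose a germ of an irreducible analytic curve on $S$ whose intersection with $D$ consists of $0$, and let $C$ be its normalization, assumed to be a (sufficiently small) open disk; the point of $C$ over $0$ is again denoted $0$. Let $f:Y\to C$ be the base change of $\mathcal X\to S$ by $C\to S$, with $Y_0=X_0$ the fiber over $0$; $Y$ has dimension $2n$. A ($2n$-dimensional) singularity of type $A_m$ is one locally analytically isomorphic to the hypersurface singularity $\sum_{i=1}^{2n}x_i^2=t^{m+1}$ at the origin of $\mathbf C^{2n+1}$. *)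

theory Defs
  imports "HOL-Complex_Analysis.Complex_Analysis" "HOL-Homology.Homology"
begin

section \<open>Complex projective space\<close>

definition proj_rel :: "complex ^ 'm::finite \<Rightarrow> complex ^ 'm \<Rightarrow> bool" where
  "proj_rel v w \<longleftrightarrow> v \<noteq> 0 \<and> w \<noteq> 0 \<and> (\<exists>c. c \<noteq> 0 \<and> v = c *s w)"

lemma proj_rel_refl: "v \<noteq> 0 \<Longrightarrow> proj_rel v v"
proof -
  assume "v \<noteq> 0"
  moreover have "v = 1 *s v" by (rule vector_smult_lid [symmetric])
  ultimately show ?thesis unfolding proj_rel_def by (metis zero_neq_one)
qed

lemma part_equivp_proj_rel: "part_equivp proj_rel"
proof (rule part_equivpI)
  have "axis undefined 1 \<noteq> (0 :: complex ^ 'm::finite)" by (simp add: axis_eq_0_iff)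
  then show "\<exists>v. proj_rel v (v :: complex ^ 'm::finite)" by (blast intro: proj_rel_refl)
  show "symp (proj_rel :: complex ^ 'm::finite \<Rightarrow> _)"
  proof (rule sympI)
    fix v w :: "complex ^ 'm" assume vw: "proj_rel v w"
    then obtain c where c: "c \<noteq> 0" "v = c *s w" unfolding proj_rel_def by blast
    have "w = inverse c *s v" using c by (simp add: vector_smult_assoc)
    moreover have "inverse c \<noteq> 0" using c by simp
    ultimately show "proj_rel w v" using vw unfolding proj_rel_def by blast
  qed
  show "transp (proj_rel :: complex ^ 'm::finite \<Rightarrow> _)"
  proof (rule transpI)
    fix u v w :: "complex ^ 'm" assume uv: "proj_rel u v" and vw: "proj_rel v w"
    obtain c where c: "c \<noteq> 0" "u = c *s v" using uv unfolding proj_rel_def by blast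
    obtain d where d: "d \<noteq> 0" "v = d *s w" using vw unfolding proj_rel_def by blast
    have "u = (c * d) *s w" using c d by (simp add: vector_smult_assoc)
    moreover have "c * d \<noteq> 0" using c d by simp
    ultimately show "proj_rel u w" using uv vw unfolding proj_rel_def by blast
  qed
qed

quotient_type 'm proj = "complex ^ ('m::finite)" / partial: proj_rel
  by (rule part_equivp_proj_rel)

text \<open>\<open>hpt v\<close> is the point with homogeneous coordinates \<open>v\<close> (meaningful for \<open>v \<noteq> 0\<close>);
  \<open>hcoord p\<close> is a choice of homogeneous coordinates of \<open>p\<close>.\<close>

definition hpt :: "complex ^ 'm::finite \<Rightarrow> 'm proj" where "hpt = abs_proj"

definition hcoord :: "'m::finite proj \<Rightarrow> complex ^ 'm" where "hcoord = rep_proj"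

lemma hcoord_nonzero: "hcoord p \<noteq> 0"
proof -
  have "proj_rel (rep_proj p) (rep_proj p)" by (rule Quotient_rep_reflp [OF Quotient_proj])
  then show ?thesis unfolding hcoord_def proj_rel_def by blast
qed

lemma hpt_hcoord: "hpt (hcoord p) = p"
  unfolding hpt_def hcoord_def by (rule Quotient_abs_rep [OF Quotient_proj])

lemma hpt_eq_iff:
  assumes "v \<noteq> 0" "w \<noteq> 0"
  shows "hpt v = hpt w \<longleftrightarrow> (\<exists>c. c \<noteq> 0 \<and> v = c *s w)"
proof -
  have "proj_rel v w \<longleftrightarrow> hpt v = hpt w"
    using Quotient_rel [OF Quotient_proj, of v w] proj_rel_refl [OF assms(1)]
      proj_rel_refl [OF assms(2)] unfolding hpt_def by blast
  then show ?thesis using assms unfolding proj_rel_def by blast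
qed

text \<open>The classical topology is the quotient topology.\<close>

instantiation proj :: (finite) topological_space
begin

definition open_proj :: "'a proj set \<Rightarrow> bool" where
  "open_proj U \<longleftrightarrow> open {v. v \<noteq> 0 \<and> hpt v \<in> U}"

instance
proof
  have "{v. v \<noteq> 0 \<and> hpt v \<in> (UNIV :: 'a proj set)} = - {0}" by auto
  then show "open (UNIV :: 'a proj set)" unfolding open_proj_def by (simp add: open_Compl)
next
  fix S T :: "'a proj set"
  assume "open S" "open T"
  moreover have "{v. v \<noteq> 0 \<and> hpt v \<in> S \<inter> T} = {v. v \<noteq> 0 \<and> hpt v \<in> S} \<inter> {v. v \<noteq> 0 \<and> hpt v \<in> T}"
    by auto
  ultimately show "open (S \<inter> T)" unfolding open_proj_def by (simp only: open_Int)
next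
  fix K :: "'a proj set set"
  assume "\<forall>S\<in>K. open S"
  moreover have "{v. v \<noteq> 0 \<and> hpt v \<in> \<Union>K} = (\<Union>S\<in>K. {v. v \<noteq> 0 \<and> hpt v \<in> S})"
    by auto
  ultimately show "open (\<Union>K)" unfolding open_proj_def by (simp only: open_UN)
qed

end

section \<open>Projective varieties and line bundles\<close>

text \<open>Homogeneous polynomial functions of a given degree; the zero function is
  homogeneous of every degree.\<close>

inductive homog_poly :: "nat \<Rightarrow> (('v \<Rightarrow> complex) \<Rightarrow> complex) \<Rightarrow> bool" where
  const: "homog_poly 0 (\<lambda>z. c)"
| var: "homog_poly 1 (\<lambda>z. z j)"
| add: "homog_poly d P \<Longrightarrow> homog_poly d Q \<Longrightarrow> homog_poly d (\<lambda>z. P z + Q z)"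
| mult: "homog_poly d P \<Longrightarrow> homog_poly e Q \<Longrightarrow> homog_poly (d + e) (\<lambda>z. P z * Q z)"

definition poly_at :: "(('m \<Rightarrow> complex) \<Rightarrow> complex) \<Rightarrow> 'm::finite proj \<Rightarrow> complex" where
  "poly_at P p = P (($) (hcoord p))"

definition zariski_closed :: "'m::finite proj set \<Rightarrow> bool" where
  "zariski_closed Z \<longleftrightarrow>
     (\<exists>E. (\<forall>P\<in>E. \<exists>d. homog_poly d P) \<and> Z = {p. \<forall>P\<in>E. poly_at P p = 0})"

abbreviation zariski_open :: "'m::finite proj set \<Rightarrow> bool" where
  "zariski_open U \<equiv> zariski_closed (- U)"

definition projective_variety :: "'m::finite proj set \<Rightarrow> bool" where
  "projective_variety X \<longleftrightarrow> zariski_closed X \<and> X \<noteq> {} \<and>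
     (\<forall>A B. zariski_closed A \<longrightarrow> zariski_closed B \<longrightarrow> X \<subseteq> A \<union> B \<longrightarrow> X \<subseteq> A \<or> X \<subseteq> B)"

text \<open>Smoothness of dimension \<open>d\<close>: near each point, \<open>X\<close> is cut out by as many equations as its
  codimension, with differentials linearly independent over the complex numbers.  The
  differentials are taken on the affine cone.\<close>

definition smooth_of_dim :: "nat \<Rightarrow> 'm::finite proj set \<Rightarrow> bool" where
  "smooth_of_dim d X \<longleftrightarrow>
     (\<forall>p\<in>X. \<exists>c (f :: nat \<Rightarrow> ('m \<Rightarrow> complex) \<Rightarrow> complex) D U.
        c + d + 1 = CARD('m) \<and>
        (\<forall>i<c. \<exists>e. homog_poly e (f i)) \<and>
        zariski_open U \<and> p \<in> U \<and> X \<inter> U = {q \<in> U. \<forall>i<c. poly_at (f i) q = 0} \<and>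
        (\<forall>i<c. ((\<lambda>v. f i (($) v)) has_derivative D i) (at (hcoord p))) \<and>
        (\<forall>a. (\<forall>v. (\<Sum>i<c. a i * D i v) = 0) \<longrightarrow> (\<forall>i<c. a i = 0)))"

definition smooth_projective_variety :: "nat \<Rightarrow> 'm::finite proj set \<Rightarrow> bool" where
  "smooth_projective_variety d X \<longleftrightarrow> projective_variety X \<and> smooth_of_dim d X"

definition regular_at :: "'m::finite proj set \<Rightarrow> ('m proj \<Rightarrow> complex) \<Rightarrow> 'm proj \<Rightarrow> bool" where
  "regular_at X f p \<longleftrightarrow>
     (\<exists>d P Q U. homog_poly d P \<and> homog_poly d Q \<and> zariski_open U \<and> p \<in> U \<and>
        (\<forall>q\<in>X \<inter> U. poly_at Q q \<noteq> 0 \<and> f q = poly_at P q / poly_at Q q))"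

definition regular_on :: "'m::finite proj set \<Rightarrow> 'm proj set \<Rightarrow> ('m proj \<Rightarrow> complex) \<Rightarrow> bool" where
  "regular_on X U f \<longleftrightarrow> (\<forall>p\<in>X \<inter> U. regular_at X f p)"

text \<open>An algebraic line bundle is given by a trivialising Zariski open cover and a cocycle of
  transition functions; a section is a family of regular functions with
  \<open>s i = lb_trans L i j * s j\<close> on overlaps.\<close>

record ('i, 'm) line_bundle =
  lb_index :: "'i set"
  lb_open :: "'i \<Rightarrow> 'm proj set"
  lb_trans :: "'i \<Rightarrow> 'i \<Rightarrow> 'm proj \<Rightarrow> complex"

type_synonym ('i, 'm) lb_section = "'i \<Rightarrow> 'm proj \<Rightarrow> complex"

definition is_line_bundle ::
  "'m::finite proj set \<Rightarrow> ('i, 'm) line_bundle \<Rightarrow> bool" where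
  "is_line_bundle X L \<longleftrightarrow>
     (\<forall>i\<in>lb_index L. lb_open L i \<subseteq> X \<and> zariski_closed (X - lb_open L i)) \<and>
     (\<Union>i\<in>lb_index L. lb_open L i) = X \<and>
     (\<forall>i\<in>lb_index L. \<forall>j\<in>lb_index L.
        regular_on X (lb_open L i \<inter> lb_open L j) (lb_trans L i j) \<and>
        (\<forall>x\<in>lb_open L i \<inter> lb_open L j. lb_trans L i j x \<noteq> 0)) \<and>
     (\<forall>i\<in>lb_index L. \<forall>x\<in>lb_open L i. lb_trans L i i x = 1) \<and>
     (\<forall>i\<in>lb_index L. \<forall>j\<in>lb_index L. \<forall>l\<in>lb_index L.
        \<forall>x\<in>lb_open L i \<inter> lb_open L j \<inter> lb_open L l.
          lb_trans L i l x = lb_trans L i j x * lb_trans L j l x)"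

definition lb_power :: "('i, 'm::finite) line_bundle \<Rightarrow> nat \<Rightarrow> ('i, 'm) line_bundle" where
  "lb_power L k = L\<lparr>lb_trans := (\<lambda>i j x. lb_trans L i j x ^ k)\<rparr>"

definition sections ::
  "'m::finite proj set \<Rightarrow> ('i, 'm) line_bundle \<Rightarrow> ('i, 'm) lb_section set" where
  "sections X L = {s.
     (\<forall>i\<in>lb_index L. regular_on X (lb_open L i) (s i)) \<and>
     (\<forall>i\<in>lb_index L. \<forall>j\<in>lb_index L. \<forall>x\<in>lb_open L i \<inter> lb_open L j.
        s i x = lb_trans L i j x * s j x)}"

text \<open>\<open>L\<close> is very ample if there are sections \<open>\<tau> 0, \<dots>, \<tau> N\<close> without common zero such that
  \<open>x \<mapsto> [\<tau> 0 x : \<dots> : \<tau> N x]\<close> is a closed immersion into projective \<open>N\<close>-space: an injective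
  map, closed for the Zariski topologies, with surjective homomorphism of sheaves of regular
  functions.  As \<open>N\<close> is quantified, points of the target are given by homogeneous coordinates
  of type \<open>nat \<Rightarrow> complex\<close> vanishing beyond \<open>N\<close>.\<close>

definition section_map ::
  "nat \<Rightarrow> (nat \<Rightarrow> ('i, 'm) lb_section) \<Rightarrow> 'i \<Rightarrow> 'm proj \<Rightarrow> nat \<Rightarrow> complex" where
  "section_map N \<tau> i x = (\<lambda>j. if j \<le> N then \<tau> j i x else 0)"

definition very_ample ::
  "'m::finite proj set \<Rightarrow> ('i, 'm) line_bundle \<Rightarrow> bool" where
  "very_ample X L \<longleftrightarrow>
     (\<exists>N \<tau>.
        (\<forall>j\<le>N. \<tau> j \<in> sections X L) \<and>
        (\<forall>i\<in>lb_index L. \<forall>x\<in>lb_open L i. \<exists>j\<le>N. \<tau> j i x \<noteq> 0) \<and>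
        (\<forall>i\<in>lb_index L. \<forall>i'\<in>lb_index L. \<forall>x\<in>lb_open L i. \<forall>y\<in>lb_open L i'.
           (\<exists>c. \<forall>j. section_map N \<tau> i x j = c * section_map N \<tau> i' y j) \<longrightarrow> x = y) \<and>
        (\<forall>Z. zariski_closed Z \<longrightarrow> Z \<subseteq> X \<longrightarrow>
           (\<exists>E. (\<forall>P\<in>E. \<exists>d. homog_poly d P) \<and>
              (\<forall>v. (\<exists>j. v j \<noteq> 0) \<longrightarrow> (\<forall>j>N. v j = 0) \<longrightarrow>
                 ((\<forall>P\<in>E. P v = 0) \<longleftrightarrow>
                  (\<exists>i\<in>lb_index L. \<exists>x\<in>lb_open L i \<inter> Z. \<exists>c. v = (\<lambda>j. c * section_map N \<tau> i x j)))))) \<and>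
        (\<forall>x\<in>X. \<forall>f. regular_at X f x \<longrightarrow>
           (\<exists>d P Q U. \<exists>i\<in>lb_index L. x \<in> lb_open L i \<and> homog_poly d P \<and> homog_poly d Q \<and>
              zariski_open U \<and> x \<in> U \<and>
              (\<forall>y\<in>lb_open L i \<inter> U. Q (section_map N \<tau> i y) \<noteq> 0 \<and>
                 f y = P (section_map N \<tau> i y) / Q (section_map N \<tau> i y)))))"

definition ample :: "'m::finite proj set \<Rightarrow> ('i, 'm) line_bundle \<Rightarrow> bool" where
  "ample X L \<longleftrightarrow> (\<exists>k>0. very_ample X (lb_power L k))"

text \<open>A basis \<open>\<sigma>\<close> of the space of sections identifies the complete linear system with
  \<open>'r proj\<close>: the point \<open>hpt a\<close> is the divisor of \<open>lin_comb \<sigma> a\<close>.\<close>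

definition lin_comb ::
  "('r \<Rightarrow> ('i, 'm) lb_section) \<Rightarrow> complex ^ 'r::finite \<Rightarrow> ('i, 'm) lb_section" where
  "lin_comb \<sigma> a = (\<lambda>i x. \<Sum>r\<in>UNIV. a $ r * \<sigma> r i x)"

definition section_basis ::
  "'m::finite proj set \<Rightarrow> ('i, 'm) line_bundle \<Rightarrow> ('r::finite \<Rightarrow> ('i, 'm) lb_section) \<Rightarrow> bool" where
  "section_basis X L \<sigma> \<longleftrightarrow>
     (\<forall>r. \<sigma> r \<in> sections X L) \<and>
     (\<forall>s\<in>sections X L.
        \<exists>!a. \<forall>i\<in>lb_index L. \<forall>x\<in>lb_open L i. s i x = lin_comb \<sigma> a i x)"

section \<open>Germs of hypersurfaces\<close>

definition mholo_on :: "(complex ^ 'a::finite \<Rightarrow> complex) \<Rightarrow> (complex ^ 'a) set \<Rightarrow> bool" where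
  "mholo_on f V \<longleftrightarrow>
     (\<forall>z\<in>V. \<exists>D. (f has_derivative D) (at z) \<and> (\<forall>c v. D (c *s v) = c * D v))"

definition holo_map_on ::
  "(complex ^ 'a::finite \<Rightarrow> complex ^ 'b::finite) \<Rightarrow> (complex ^ 'a) set \<Rightarrow> bool" where
  "holo_map_on f V \<longleftrightarrow> (\<forall>i. mholo_on (\<lambda>z. f z $ i) V)"

text \<open>\<open>h\<close> lies in the ideal generated by \<open>F\<close> in the ring of germs of holomorphic functions at \<open>p\<close>.\<close>

definition in_germ_ideal ::
  "(complex ^ 'a::finite \<Rightarrow> complex) \<Rightarrow> complex ^ 'a \<Rightarrow> (complex ^ 'a \<Rightarrow> complex) \<Rightarrow> bool" where
  "in_germ_ideal F p h \<longleftrightarrow>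
     (\<exists>V a. open V \<and> p \<in> V \<and> mholo_on a V \<and> (\<forall>z\<in>V. h z = a z * F z))"

text \<open>Isomorphism of the germs of complex spaces \<open>F = 0\<close> at \<open>p\<close> and \<open>G = 0\<close> at \<open>q\<close>, with structure
  sheaves the quotients by \<open>F\<close> and \<open>G\<close>.  Morphisms of such germs are induced by holomorphic
  maps of the ambient spaces that are compatible with the ideals, taken modulo the ideal of
  the source.\<close>

definition germ_iso ::
  "(complex ^ 'a::finite \<Rightarrow> complex) \<Rightarrow> complex ^ 'a \<Rightarrow>
   (complex ^ 'b::finite \<Rightarrow> complex) \<Rightarrow> complex ^ 'b \<Rightarrow> bool" where
  "germ_iso F p G q \<longleftrightarrow>
     (\<exists>V W \<phi> \<psi>. open V \<and> p \<in> V \<and> open W \<and> q \<in> W \<and>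
        holo_map_on \<phi> V \<and> holo_map_on \<psi> W \<and> \<phi> p = q \<and> \<psi> q = p \<and>
        in_germ_ideal F p (\<lambda>z. G (\<phi> z)) \<and> in_germ_ideal G q (\<lambda>w. F (\<psi> w)) \<and>
        (\<forall>i. in_germ_ideal F p (\<lambda>z. \<psi> (\<phi> z) $ i - z $ i)) \<and>
        (\<forall>j. in_germ_ideal G q (\<lambda>w. \<phi> (\<psi> w) $ j - w $ j)))"

definition singular_germ :: "(complex ^ 'a::finite \<Rightarrow> complex) \<Rightarrow> complex ^ 'a \<Rightarrow> bool" where
  "singular_germ F p \<longleftrightarrow> F p = 0 \<and> (F has_derivative (\<lambda>v. 0)) (at p)"

definition odp_model :: "complex ^ 'd::finite \<Rightarrow> complex" where
  "odp_model z = (\<Sum>i\<in>UNIV. (z $ i)\<^sup>2)"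

text \<open>With \<open>CARD('d) = e\<close>, the type \<open>complex ^ 'd option\<close> is affine space of dimension \<open>e + 1\<close>;
  the coordinate \<open>t\<close> has index \<open>None\<close>.\<close>

definition A_model :: "nat \<Rightarrow> complex ^ 'd::finite option \<Rightarrow> complex" where
  "A_model m z = (\<Sum>i\<in>UNIV. (z $ Some i)\<^sup>2) - (z $ None) ^ (m + 1)"

definition space_part :: "complex ^ 'd::finite option \<Rightarrow> complex ^ 'd" where
  "space_part z = (\<chi> i. z $ Some i)"

section \<open>Holomorphic charts and fibres\<close>

text \<open>\<open>w \<mapsto> hpt (\<phi> w)\<close> is a holomorphic immersion and a homeomorphism of \<open>W\<close> onto an open subset
  of \<open>X\<close>.\<close>

definition chart ::
  "'m::finite proj set \<Rightarrow> (complex ^ 'd::finite) set \<Rightarrow> (complex ^ 'd \<Rightarrow> complex ^ 'm) \<Rightarrow> bool" where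
  "chart X W \<phi> \<longleftrightarrow>
     open W \<and> holo_map_on \<phi> W \<and> (\<forall>w\<in>W. \<phi> w \<noteq> 0) \<and>
     (\<forall>w\<in>W. \<forall>D. (\<phi> has_derivative D) (at w) \<longrightarrow> (\<forall>v c. D v = c *s \<phi> w \<longrightarrow> v = 0)) \<and>
     openin (top_of_set X) ((\<lambda>w. hpt (\<phi> w)) ` W) \<and>
     (\<exists>\<psi>. homeomorphism W ((\<lambda>w. hpt (\<phi> w)) ` W) (\<lambda>w. hpt (\<phi> w)) \<psi>)"

definition hyperplane_section ::
  "'m::finite proj set \<Rightarrow> ('i, 'm) line_bundle \<Rightarrow> ('r::finite \<Rightarrow> ('i, 'm) lb_section) \<Rightarrow>
   'r proj \<Rightarrow> 'm proj set" where
  "hyperplane_section X M \<sigma> s =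
     {x \<in> X. \<forall>i\<in>lb_index M. x \<in> lb_open M i \<longrightarrow> lin_comb \<sigma> (hcoord s) i x = 0}"

text \<open>\<open>F\<close> at \<open>w0\<close> is an equation of the divisor \<open>s\<close> at \<open>x\<close> in some chart of \<open>X\<close> and some
  trivialisation of \<open>M\<close>.\<close>

definition fibre_equation ::
  "'m::finite proj set \<Rightarrow> ('i, 'm) line_bundle \<Rightarrow> ('r::finite \<Rightarrow> ('i, 'm) lb_section) \<Rightarrow>
   'r proj \<Rightarrow> 'm proj \<Rightarrow> (complex ^ 'd::finite \<Rightarrow> complex) \<Rightarrow> complex ^ 'd \<Rightarrow> bool" where
  "fibre_equation X M \<sigma> s x F w0 \<longleftrightarrow>
     (\<exists>W \<phi>. \<exists>i\<in>lb_index M. chart X W \<phi> \<and> w0 \<in> W \<and> hpt (\<phi> w0) = x \<and> x \<in> lb_open M i \<and>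
        F = (\<lambda>w. lin_comb \<sigma> (hcoord s) i (hpt (\<phi> w))))"

text \<open>In what follows the argument \<open>TYPE('d)\<close> provides the coordinate space of the charts;
  \<open>CARD('d)\<close> has to be the dimension of \<open>X\<close>.\<close>

definition fibre_singular_points ::
  "'d::finite itself \<Rightarrow> 'm::finite proj set \<Rightarrow> ('i, 'm) line_bundle \<Rightarrow>
   ('r::finite \<Rightarrow> ('i, 'm) lb_section) \<Rightarrow> 'r proj \<Rightarrow> 'm proj set" where
  "fibre_singular_points _ X M \<sigma> s =
     {x. \<exists>(F :: complex ^ 'd \<Rightarrow> complex) w0. fibre_equation X M \<sigma> s x F w0 \<and> singular_germ F w0}"

definition ordinary_double_point ::
  "'d::finite itself \<Rightarrow> 'm::finite proj set \<Rightarrow> ('i, 'm) line_bundle \<Rightarrow>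
   ('r::finite \<Rightarrow> ('i, 'm) lb_section) \<Rightarrow> 'r proj \<Rightarrow> 'm proj \<Rightarrow> bool" where
  "ordinary_double_point _ X M \<sigma> s x \<longleftrightarrow>
     (\<exists>(F :: complex ^ 'd \<Rightarrow> complex) w0. fibre_equation X M \<sigma> s x F w0 \<and>
        germ_iso F w0 (odp_model :: complex ^ 'd \<Rightarrow> complex) 0)"

definition discriminant ::
  "'d::finite itself \<Rightarrow> 'm::finite proj set \<Rightarrow> ('i, 'm) line_bundle \<Rightarrow>
   ('r::finite \<Rightarrow> ('i, 'm) lb_section) \<Rightarrow> 'r proj set" where
  "discriminant T X M \<sigma> = {s. fibre_singular_points T X M \<sigma> s \<noteq> {}}"

section \<open>Vanishing cycles\<close>

definition holo_lift ::
  "(complex \<Rightarrow> complex ^ 'r::finite) \<Rightarrow> (complex \<Rightarrow> 'r proj) \<Rightarrow> complex set \<Rightarrow> bool" where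
  "holo_lift \<eta> \<gamma> N \<longleftrightarrow>
     (\<forall>r. (\<lambda>t. \<eta> t $ r) holomorphic_on N) \<and> (\<forall>t\<in>N. \<eta> t \<noteq> 0 \<and> hpt (\<eta> t) = \<gamma> t)"

text \<open>\<open>\<delta>\<close> is a vanishing cycle at the point \<open>s\<close> of the discriminant, in the homology of the smooth
  fibre over the nearby point \<open>s'\<close>.  The fibre over \<open>s\<close> has a single singular point, an ordinary
  double point; there is an arc \<open>\<beta>\<close> in \<open>S\<close>, meeting the discriminant only in \<open>s = \<beta> 0\<close>, over which
  the total space is smooth, with equation \<open>\<Sum>w\<^sub>j\<^sup>2 = t\<close> (up to a unit) near the double point.  For
  real \<open>\<tau> > 0\<close>, the real sphere \<open>\<Sum>w\<^sub>j\<^sup>2 = \<tau>\<close> lies in the fibre over \<open>s' = \<beta> \<tau>\<close>, and \<open>\<delta>\<close> is the image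
  of its fundamental class \<open>z\<close>; it contracts to the double point inside \<open>W\<close> as \<open>\<tau>\<close> tends to \<open>0\<close>.  The bijection \<open>e\<close> orders the coordinates.\<close>

definition vanishing_cycle ::
  "'d::finite itself \<Rightarrow> 'm::finite proj set \<Rightarrow> ('i, 'm) line_bundle \<Rightarrow>
   ('r::finite \<Rightarrow> ('i, 'm) lb_section) \<Rightarrow> 'r proj \<Rightarrow> 'r proj \<Rightarrow> 'm proj chain set \<Rightarrow> bool" where
  "vanishing_cycle T X M \<sigma> s s' \<delta> \<longleftrightarrow>
     (\<exists>W \<phi> \<epsilon> \<beta> \<eta> u e \<tau> z. \<exists>i\<in>lb_index M.
        chart X (W :: (complex ^ 'd) set) \<phi> \<and> 0 \<in> W \<and> (\<lambda>w. hpt (\<phi> w)) ` W \<subseteq> lb_open M i \<and>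
        fibre_singular_points T X M \<sigma> s = {hpt (\<phi> 0)} \<and>
        \<epsilon> > 0 \<and> holo_lift \<eta> \<beta> (ball 0 \<epsilon>) \<and> \<beta> 0 = s \<and>
        (\<forall>t\<in>ball 0 \<epsilon>. t \<noteq> 0 \<longrightarrow> \<beta> t \<notin> discriminant T X M \<sigma>) \<and>
        mholo_on u {y. space_part y \<in> W \<and> y $ None \<in> ball 0 \<epsilon>} \<and>
        (\<forall>y. space_part y \<in> W \<and> y $ None \<in> ball 0 \<epsilon> \<longrightarrow>
           u y \<noteq> 0 \<and>
           lin_comb \<sigma> (\<eta> (y $ None)) i (hpt (\<phi> (space_part y))) =
             u y * ((\<Sum>j\<in>UNIV. (y $ Some j)\<^sup>2) - y $ None)) \<and>
        0 < \<tau> \<and> \<tau> < \<epsilon> \<and> s' = \<beta> (of_real \<tau>) \<and>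
        bij_betw e (UNIV :: 'd set) {..<CARD('d)} \<and>
        cball 0 (sqrt \<tau>) \<subseteq> W \<and>
        z \<in> carrier (homology_group (int (CARD('d) - 1)) (nsphere (CARD('d) - 1))) \<and>
        carrier (homology_group (int (CARD('d) - 1)) (nsphere (CARD('d) - 1))) =
          range (\<lambda>k :: int. z [^]\<^bsub>homology_group (int (CARD('d) - 1)) (nsphere (CARD('d) - 1))\<^esub> k) \<and>
        \<delta> = hom_induced (int (CARD('d) - 1)) (nsphere (CARD('d) - 1)) {}
              (top_of_set (hyperplane_section X M \<sigma> s')) {}
              (\<lambda>y. hpt (\<phi> (\<chi> j. of_real (sqrt \<tau> * y (e j))))) z)"

text \<open>A property holds at a general point of \<open>D\<close> if it holds on a Zariski open dense subset.\<close>

definition at_general_point :: "'r::finite proj set \<Rightarrow> ('r proj \<Rightarrow> bool) \<Rightarrow> bool" where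
  "at_general_point D P \<longleftrightarrow>
     (\<exists>Z. zariski_closed Z \<and> (\<forall>Z'. zariski_closed Z' \<longrightarrow> D - Z \<subseteq> Z' \<longrightarrow> D \<subseteq> Z') \<and>
          (\<forall>s\<in>D - Z. P s))"

text \<open>Any two vanishing cycles at \<open>s\<close> correspond up to sign under parallel transport, so it does
  not matter which of them is required to be nonzero.\<close>

definition nonzero_vanishing_cycle ::
  "'d::finite itself \<Rightarrow> 'm::finite proj set \<Rightarrow> ('i, 'm) line_bundle \<Rightarrow>
   ('r::finite \<Rightarrow> ('i, 'm) lb_section) \<Rightarrow> 'r proj \<Rightarrow> bool" where
  "nonzero_vanishing_cycle T X M \<sigma> s \<longleftrightarrow>
     (\<exists>s' \<delta>. vanishing_cycle T X M \<sigma> s s' \<delta> \<and>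
        \<delta> \<noteq> \<one>\<^bsub>homology_group (int (CARD('d) - 1)) (top_of_set (hyperplane_section X M \<sigma> s'))\<^esub>)"

section \<open>Base change to a curve\<close>

definition proj_holo_on :: "('r::finite proj \<Rightarrow> complex) \<Rightarrow> 'r proj set \<Rightarrow> bool" where
  "proj_holo_on h N \<longleftrightarrow> mholo_on (\<lambda>v. h (hpt v)) {v. v \<noteq> 0 \<and> hpt v \<in> N}"

definition analytic_subset :: "'r::finite proj set \<Rightarrow> 'r proj set \<Rightarrow> bool" where
  "analytic_subset V \<Gamma> \<longleftrightarrow> open V \<and> \<Gamma> \<subseteq> V \<and>
     (\<forall>p\<in>V. \<exists>N H. open N \<and> p \<in> N \<and> N \<subseteq> V \<and> finite H \<and> (\<forall>h\<in>H. proj_holo_on h N) \<and>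
        \<Gamma> \<inter> N = {q \<in> N. \<forall>h\<in>H. h q = 0})"

text \<open>\<open>\<Gamma>\<close> is a representative of the germ of an irreducible analytic curve at \<open>s0\<close>, and
  \<open>\<gamma> : ball 0 \<epsilon> \<rightarrow> \<Gamma>\<close> is its normalization: a holomorphic homeomorphism that is an immersion, hence
  biholomorphic onto its image, away from the point \<open>0\<close> over \<open>s0\<close>.  That \<open>\<Gamma>\<close> is one-dimensional
  and irreducible at \<open>s0\<close> is forced by the existence of such a map.\<close>

definition disc_normalization ::
  "'r::finite proj set \<Rightarrow> 'r proj \<Rightarrow> real \<Rightarrow> (complex \<Rightarrow> 'r proj) \<Rightarrow> bool" where
  "disc_normalization \<Gamma> s0 \<epsilon> \<gamma> \<longleftrightarrow>
     (\<exists>V. analytic_subset V \<Gamma>) \<and> \<epsilon> > 0 \<and> \<gamma> 0 = s0 \<and>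
     (\<forall>c\<in>ball 0 \<epsilon>. \<exists>\<rho>>0. \<exists>\<eta>. holo_lift \<eta> \<gamma> (ball c \<rho>) \<and>
        (c \<noteq> 0 \<longrightarrow> \<not> (\<exists>l. \<forall>r. deriv (\<lambda>t. \<eta> t $ r) c = l * \<eta> c $ r))) \<and>
     (\<exists>\<gamma>'. homeomorphism (ball 0 \<epsilon>) \<Gamma> \<gamma> \<gamma>')"

text \<open>The total space of the base change of the universal family is, as a complex space, the
  subspace of \<open>X \<times> ball 0 \<epsilon>\<close> with the following equations at \<open>(x, c)\<close>.\<close>

definition total_equation ::
  "'m::finite proj set \<Rightarrow> ('i, 'm) line_bundle \<Rightarrow> ('r::finite \<Rightarrow> ('i, 'm) lb_section) \<Rightarrow>
   (complex \<Rightarrow> 'r proj) \<Rightarrow> 'm proj \<Rightarrow> complex \<Rightarrow>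
   (complex ^ 'd::finite option \<Rightarrow> complex) \<Rightarrow> complex ^ 'd option \<Rightarrow> bool" where
  "total_equation X M \<sigma> \<gamma> x c F z0 \<longleftrightarrow>
     (\<exists>W \<phi> \<rho> \<eta>. \<exists>i\<in>lb_index M. chart X W \<phi> \<and> space_part z0 \<in> W \<and> z0 $ None = c \<and>
        hpt (\<phi> (space_part z0)) = x \<and> x \<in> lb_open M i \<and>
        \<rho> > 0 \<and> holo_lift \<eta> \<gamma> (ball c \<rho>) \<and>
        F = (\<lambda>z. lin_comb \<sigma> (\<eta> (z $ None)) i (hpt (\<phi> (space_part z)))))"

definition total_singular_points ::
  "'d::finite itself \<Rightarrow> 'm::finite proj set \<Rightarrow> ('i, 'm) line_bundle \<Rightarrow>
   ('r::finite \<Rightarrow> ('i, 'm) lb_section) \<Rightarrow> (complex \<Rightarrow> 'r proj) \<Rightarrow> real \<Rightarrow> ('m proj \<times> complex) set" where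
  "total_singular_points _ X M \<sigma> \<gamma> \<epsilon> =
     {(x, c). c \<in> ball 0 \<epsilon> \<and>
        (\<exists>(F :: complex ^ 'd option \<Rightarrow> complex) z0.
           total_equation X M \<sigma> \<gamma> x c F z0 \<and> singular_germ F z0)}"

definition total_type_A ::
  "'d::finite itself \<Rightarrow> nat \<Rightarrow> 'm::finite proj set \<Rightarrow> ('i, 'm) line_bundle \<Rightarrow>
   ('r::finite \<Rightarrow> ('i, 'm) lb_section) \<Rightarrow> (complex \<Rightarrow> 'r proj) \<Rightarrow> 'm proj \<times> complex \<Rightarrow> bool" where
  "total_type_A _ m X M \<sigma> \<gamma> = (\<lambda>(x, c).
     \<exists>(F :: complex ^ 'd option \<Rightarrow> complex) z0. total_equation X M \<sigma> \<gamma> x c F z0 \<and>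
        germ_iso F z0 (A_model m :: complex ^ 'd option \<Rightarrow> complex) 0)"

end

theory Submission
  imports Defs
begin

text \<open>A singular point of the total space is a singular point of its fibre, because the derivative of the
total equation vanishes in particular along the fibre. The curve meets the discriminant only in
\<open>s0\<close>, so the point lies over the origin of the disc, and by hypothesis the fibre has an ordinary
double point there. In local coordinates the total space is therefore \<open>F(w, t) = 0\<close>, where
\<open>F(\<cdot>, 0)\<close> is, up to a unit and a change of the coordinates \<open>w\<close>, the quadratic form
\<open>\<Sum>w\<^sub>j\<^sup>2\<close> (\<open>odp_normal_form\<close>).

The Morse lemma with a parameter (\<open>Morse_with_parameter\<close>) extends this to small \<open>t\<close>: up to a unit,
\<open>F = \<Sum>v\<^sub>j(w, t)\<^sup>2 + h(t)\<close>, where the \<open>v\<^sub>j\<close> together with \<open>t\<close> are local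
coordinates. If \<open>h\<close> vanished identically, then every nearby fibre would be singular at the point
where all \<open>v\<^sub>j\<close> are zero, and the curve would lie in the discriminant near \<open>s0\<close>. So
\<open>h(t) = - t\<^bsup>m+1\<^esup> s(t)\<^sup>2\<close> with \<open>s(0) \<noteq> 0\<close>, and division by \<open>s\<^sup>2\<close> turns the
equation into \<open>\<Sum>(v\<^sub>j / s)\<^sup>2 = t\<^bsup>m+1\<^esup>\<close>, which is the singularity \<open>A\<^sub>m\<close>. Here
\<open>m \<ge> 1\<close>, because \<open>F\<close> is singular and hence \<open>h'(0) = 0\<close>. This alternative is
\<open>Morse_dichotomy\<close>, carried over to the given equation in \<open>odp_family_dichotomy\<close>.

The Morse lemma is proved by completing one square at a time (\<open>split_square\<close>): the implicit function
theorem gives the value \<open>c\<close> of the coordinate \<open>z\<^sub>i\<close> at which \<open>\<partial>\<^sub>ig\<close> vanishes, as a function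
of the other coordinates, and the difference of \<open>g\<close> and its value at \<open>z\<^sub>i = c\<close> is divisible by
\<open>(z\<^sub>i - c)\<^sup>2\<close>. Only differentiability at each point enters the definition of a holomorphic function of
several variables, so the facts needed for this, continuity and holomorphy of partial derivatives and
of integrals with a parameter, are derived from Cauchy's formula in one variable.\<close>

(* From here on \<open>$\<close> denotes vector components only. *)
no_notation fps_nth (infixl "$" 75)

section \<open>Complex differentiability in several variables\<close>

definition cx_diff :: "(complex ^ 'a::finite \<Rightarrow> complex) \<Rightarrow> complex ^ 'a \<Rightarrow> bool" where
  "cx_diff f z \<longleftrightarrow> (\<exists>D. (f has_derivative D) (at z) \<and> (\<forall>c v. D (c *s v) = c * D v))"

definition with_coord :: "'a::finite \<Rightarrow> complex \<Rightarrow> complex ^ 'a \<Rightarrow> complex ^ 'a" where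
  "with_coord i x z = (\<chi> j. if j = i then x else z $ j)"

text \<open>The partial derivative is taken along the affine line through \<open>z\<close> on which only the coordinate
  \<open>i\<close> varies, so that the theory of one complex variable applies to it directly.\<close>

definition cx_partial :: "'a::finite \<Rightarrow> (complex ^ 'a \<Rightarrow> complex) \<Rightarrow> complex ^ 'a \<Rightarrow> complex" where
  "cx_partial i f z = deriv (\<lambda>x. f (with_coord i x z)) (z $ i)"

lemma mholo_on_iff: "mholo_on f V \<longleftrightarrow> (\<forall>z\<in>V. cx_diff f z)"
  unfolding mholo_on_def cx_diff_def ..

lemma with_coord_nth [simp]: "with_coord i x z $ j = (if j = i then x else z $ j)"
  by (simp add: with_coord_def)

lemma with_coord_same [simp]: "with_coord i (z $ i) z = z"
  by (simp add: vec_eq_iff)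

lemma with_coord_twice [simp]: "with_coord i x (with_coord i y z) = with_coord i x z"
  by (simp add: vec_eq_iff)

lemma with_coord_eq_add: "with_coord i x z = z + axis i (x - z $ i)"
  by (simp add: vec_eq_iff axis_def)

lemma cx_diff_const [simp]: "cx_diff (\<lambda>z. c) z"
  unfolding cx_diff_def by (rule exI [of _ "\<lambda>_. 0"]) simp

lemma has_derivative_vec_nth: "((\<lambda>z. z $ i) has_derivative (\<lambda>v. v $ i)) F"
  by (rule bounded_linear_imp_has_derivative [OF bounded_linear_vec_nth])

lemma cx_diff_nth [simp]: "cx_diff (\<lambda>z. z $ i) z"
  unfolding cx_diff_def by (rule exI [of _ "\<lambda>v. v $ i"]) (simp add: has_derivative_vec_nth)

lemma cx_diff_add:
  assumes "cx_diff f z" "cx_diff g z" shows "cx_diff (\<lambda>z. f z + g z) z"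
proof -
  obtain D E where "(f has_derivative D) (at z)" "\<forall>c v. D (c *s v) = c * D v"
    "(g has_derivative E) (at z)" "\<forall>c v. E (c *s v) = c * E v"
    using assms unfolding cx_diff_def by blast
  then show ?thesis unfolding cx_diff_def
    by (intro exI [of _ "\<lambda>v. D v + E v"]) (auto intro: has_derivative_add simp: algebra_simps)
qed

lemma cx_diff_mult:
  assumes "cx_diff f z" "cx_diff g z" shows "cx_diff (\<lambda>z. f z * g z) z"
proof -
  obtain D E where "(f has_derivative D) (at z)" "\<forall>c v. D (c *s v) = c * D v"
    "(g has_derivative E) (at z)" "\<forall>c v. E (c *s v) = c * E v"
    using assms unfolding cx_diff_def by blast
  then have "((\<lambda>z. f z * g z) has_derivative (\<lambda>v. f z * E v + D v * g z)) (at z)"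
    "\<forall>c v. f z * E (c *s v) + D (c *s v) * g z = c * (f z * E v + D v * g z)"
    by (auto intro!: has_derivative_mult) (simp add: algebra_simps)
  then show ?thesis unfolding cx_diff_def by blast
qed

lemma cx_diff_minus: "cx_diff f z \<Longrightarrow> cx_diff (\<lambda>z. - f z) z"
  using cx_diff_mult [of "\<lambda>_. -1" z f] by simp

lemma cx_diff_diff: "cx_diff f z \<Longrightarrow> cx_diff g z \<Longrightarrow> cx_diff (\<lambda>z. f z - g z) z"
  using cx_diff_add [of f z "\<lambda>z. - g z"] by (simp add: cx_diff_minus)

lemma cx_diff_field_compose:
  assumes "g field_differentiable at (f z)" "cx_diff f z" shows "cx_diff (\<lambda>z. g (f z)) z"
proof -
  obtain D where D: "(f has_derivative D) (at z)" "\<forall>c v. D (c *s v) = c * D v"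
    using assms unfolding cx_diff_def by blast
  obtain l where "(g has_field_derivative l) (at (f z))"
    using assms unfolding field_differentiable_def by blast
  then have "((\<lambda>z. g (f z)) has_derivative (\<lambda>v. l * D v)) (at z)"
    using D(1) by (auto simp: has_field_derivative_def intro: has_derivative_compose)
  then show ?thesis using D(2) unfolding cx_diff_def
    by (intro exI [of _ "\<lambda>v. l * D v"]) auto
qed

lemma cx_diff_inverse:
  assumes "cx_diff f z" "f z \<noteq> 0" shows "cx_diff (\<lambda>z. inverse (f z)) z"
  using cx_diff_field_compose [OF _ assms(1)] DERIV_inverse [OF assms(2)]
  unfolding field_differentiable_def by blast

lemma cx_diff_divide:
  assumes "cx_diff f z" "cx_diff g z" "g z \<noteq> 0" shows "cx_diff (\<lambda>z. f z / g z) z"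
  using cx_diff_mult [OF assms(1) cx_diff_inverse [OF assms(2,3)]] by (simp add: divide_inverse)

lemma cx_diff_continuous: "cx_diff f z \<Longrightarrow> continuous (at z) f"
  unfolding cx_diff_def using has_derivative_continuous by blast

lemma has_derivative_cong_nhds:
  assumes "(f has_derivative D) (at p)" "\<forall>\<^sub>F z in nhds p. f z = g z"
  shows "(g has_derivative D) (at p)"
proof -
  have "\<forall>\<^sub>F z in at p. f z = g z" "f p = g p"
    using assms(2) unfolding eventually_nhds_conv_at by auto
  then show ?thesis using has_derivative_transform_eventually [OF assms(1), of g] by simp
qed

lemma cx_diff_cong:
  assumes "cx_diff f z" "\<forall>\<^sub>F w in nhds z. g w = f w" shows "cx_diff g z"
proof -
  obtain D where D: "(f has_derivative D) (at z)" "\<forall>c v. D (c *s v) = c * D v"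
    using assms unfolding cx_diff_def by blast
  have "\<forall>\<^sub>F w in nhds z. f w = g w" using assms(2) by (rule eventually_mono) (rule sym)
  with D(1) have "(g has_derivative D) (at z)" by (rule has_derivative_cong_nhds)
  then show ?thesis using D(2) unfolding cx_diff_def by blast
qed

lemma has_derivative_vec:
  fixes f :: "'b::real_normed_vector \<Rightarrow> complex ^ 'a::finite"
  assumes "\<And>i. ((\<lambda>z. f z $ i) has_derivative (\<lambda>v. D v $ i)) (at z)"
  shows "(f has_derivative D) (at z)"
  unfolding has_derivative_componentwise_within [of f D z UNIV]
  by (auto simp: Basis_vec_def inner_axis intro!: has_derivative_inner_left assms)

lemma cx_diff_vec:
  fixes \<Phi> :: "complex ^ 'a::finite \<Rightarrow> complex ^ 'b::finite"
  assumes "\<And>i. cx_diff (\<lambda>z. \<Phi> z $ i) z"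
  obtains D where "(\<Phi> has_derivative D) (at z)" "\<And>c v. D (c *s v) = c *s D v"
proof -
  obtain E where E: "\<And>i. ((\<lambda>z. \<Phi> z $ i) has_derivative E i) (at z)"
     "\<And>i c v. E i (c *s v) = c * E i v"
    using assms unfolding cx_diff_def by metis
  show ?thesis
  proof
    show "(\<Phi> has_derivative (\<lambda>v. \<chi> i. E i v)) (at z)" by (rule has_derivative_vec) (simp add: E)
    show "(\<chi> i. E i (c *s v)) = c *s (\<chi> i. E i v)" for c v by (simp add: vec_eq_iff E)
  qed
qed

lemma cx_diff_compose:
  fixes \<Phi> :: "complex ^ 'a::finite \<Rightarrow> complex ^ 'b::finite"
  assumes "cx_diff h (\<Phi> z)" "\<And>i. cx_diff (\<lambda>z. \<Phi> z $ i) z"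
  shows "cx_diff (\<lambda>z. h (\<Phi> z)) z"
proof -
  obtain D where D: "(\<Phi> has_derivative D) (at z)" "\<And>c v. D (c *s v) = c *s D v"
    using cx_diff_vec assms(2) by blast
  obtain E where E: "(h has_derivative E) (at (\<Phi> z))" "\<And>c v. E (c *s v) = c * E v"
    using assms(1) unfolding cx_diff_def by blast
  show ?thesis unfolding cx_diff_def
    by (rule exI [of _ "\<lambda>v. E (D v)"]) (simp add: D(2) E(2) has_derivative_compose [OF D(1) E(1)])
qed

lemma cx_diff_vec_continuous:
  fixes \<Phi> :: "complex ^ 'a::finite \<Rightarrow> complex ^ 'b::finite"
  assumes "\<And>i. cx_diff (\<lambda>z. \<Phi> z $ i) z" shows "continuous (at z) \<Phi>"
  by (rule cx_diff_vec [OF assms]) (rule has_derivative_continuous)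

lemma vec_eq_sum_axis: "v = (\<Sum>i\<in>UNIV. v $ i *s axis i 1)" for v :: "complex ^ 'a::finite"
  by (simp add: vec_eq_iff axis_def if_distrib cong: if_cong)

lemma has_derivative_with_coord:
  "((\<lambda>x. with_coord i x z) has_derivative axis i) (at x)"
proof (rule has_derivative_vec)
  fix j show "((\<lambda>x. with_coord i x z $ j) has_derivative (\<lambda>v. axis i v $ j)) (at x)"
    by (cases "j = i") (auto simp: axis_def)
qed

lemma has_field_derivative_with_coord:
  assumes "(f has_derivative D) (at (with_coord i x z))" "\<forall>c v. D (c *s v) = c * D v"
  shows "((\<lambda>x. f (with_coord i x z)) has_field_derivative D (axis i 1)) (at x)"
proof -
  have "((\<lambda>x. f (with_coord i x z)) has_derivative (\<lambda>v. D (axis i v))) (at x)"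
    by (rule has_derivative_compose [OF has_derivative_with_coord assms(1)])
  moreover have "axis i v = v *s axis i 1" for v :: complex
    by (simp add: vec_eq_iff axis_def)
  ultimately show ?thesis using assms(2)
    unfolding has_field_derivative_def by (metis (no_types, lifting) ext mult.commute)
qed

lemma cx_partial_eq:
  assumes "(f has_derivative D) (at z)" "\<forall>c v. D (c *s v) = c * D v"
  shows "cx_partial i f z = D (axis i 1)"
  unfolding cx_partial_def
  by (rule DERIV_imp_deriv) (use assms has_field_derivative_with_coord [of f D i "z $ i" z] in auto)

text \<open>A complex linear map is determined by its values on the coordinate vectors, so the differential is
  expressed by the partial derivatives; this is how statements in one variable come to control it.\<close>

lemma has_derivative_cx_partial:
  assumes "cx_diff f z"
  shows "(f has_derivative (\<lambda>v. \<Sum>i\<in>UNIV. v $ i * cx_partial i f z)) (at z)"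
proof -
  obtain D where D: "(f has_derivative D) (at z)" "\<forall>c v. D (c *s v) = c * D v"
    using assms unfolding cx_diff_def by blast
  have "D v = (\<Sum>i\<in>UNIV. v $ i * cx_partial i f z)" for v
  proof -
    have "linear D" using D(1) by (rule has_derivative_linear)
    have "D v = D (\<Sum>i\<in>UNIV. v $ i *s axis i 1)" by (metis vec_eq_sum_axis)
    also have "\<dots> = (\<Sum>i\<in>UNIV. D (v $ i *s axis i 1))" by (rule linear_sum [OF \<open>linear D\<close>])
    also have "\<dots> = (\<Sum>i\<in>UNIV. v $ i * cx_partial i f z)"
      by (intro sum.cong refl) (metis D(2) cx_partial_eq [OF D])
    finally show ?thesis .
  qed
  then have "D = (\<lambda>v. \<Sum>i\<in>UNIV. v $ i * cx_partial i f z)" by (rule ext)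
  then show ?thesis using D(1) by metis
qed

lemma field_differentiable_with_coord:
  assumes "cx_diff f (with_coord i x z)"
  shows "(\<lambda>x. f (with_coord i x z)) field_differentiable at x"
  using assms has_field_derivative_with_coord unfolding cx_diff_def field_differentiable_def by blast

lemma has_field_derivative_cx_partial:
  assumes "cx_diff f (with_coord i x z)"
  shows "((\<lambda>x. f (with_coord i x z)) has_field_derivative cx_partial i f (with_coord i x z)) (at x)"
  using field_differentiable_with_coord [OF assms]
  by (simp add: cx_partial_def DERIV_deriv_iff_field_differentiable)

lemma norm_axis_complex [simp]: "norm (axis i x :: complex ^ 'a::finite) = norm x"
proof -
  have "(\<Sum>j\<in>UNIV. (norm (axis i x $ j))\<^sup>2) = (\<Sum>j\<in>UNIV. if j = i then (norm x)\<^sup>2 else 0)"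
    by (intro sum.cong) (auto simp: axis_def)
  then show ?thesis by (simp add: norm_vec_def L2_set_def)
qed

section \<open>Cauchy integrals and continuity of the differential\<close>

text \<open>Cauchy's formula \<open>f'(z) = (1 / 2\<pi>\<i>) \<integral> f(z + \<zeta>) / \<zeta>\<^sup>2 d\<zeta>\<close> on the circle
  \<open>\<zeta> = r exp(2\<pi>\<i>s)\<close>, along which \<open>d\<zeta> = 2\<pi>\<i> \<zeta> ds\<close>. Writing it as an integral over a real
  interval makes the theorems on integrals with a parameter applicable.\<close>

lemma cx_partial_Cauchy:
  fixes f :: "complex ^ 'a::finite \<Rightarrow> complex"
  assumes "\<And>w. w \<in> cball z r \<Longrightarrow> cx_diff f w" "r > 0"
  shows "cx_partial i f z = integral {0..1::real}
     (\<lambda>s. f (z + axis i (of_real r * exp (2 * of_real pi * \<i> * of_real s))) /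
          (of_real r * exp (2 * of_real pi * \<i> * of_real s)))"
proof -
  define g where "g x = f (z + axis i x)" for x
  have g: "g = (\<lambda>x. f (with_coord i (z $ i + x) z))"
    by (auto simp: g_def fun_eq_iff with_coord_eq_add)
  have dg: "g field_differentiable at x" if "x \<in> cball 0 r" for x
  proof -
    have "(\<lambda>x. f (with_coord i x z)) field_differentiable at (z $ i + x)"
      by (rule field_differentiable_with_coord, rule assms(1))
        (use that in \<open>simp add: with_coord_eq_add dist_norm\<close>)
    then have "(\<lambda>x. f (with_coord i x z)) \<circ> (\<lambda>x. z $ i + x) field_differentiable at x"
      by (rule field_differentiable_compose [rotated]) (rule derivative_intros field_differentiable_ident field_differentiable_const)+
    then show ?thesis by (simp add: g comp_def)
  qed
  have contg: "continuous_on (cball 0 r) g"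
    by (rule continuous_at_imp_continuous_on) (blast intro: field_differentiable_imp_continuous_at dg)
  have holg: "g holomorphic_on ball 0 r"
    unfolding holomorphic_on_def
    by (metis ball_subset_cball dg field_differentiable_at_within subsetD)
  have 0: "0 \<in> ball (0::complex) r" using \<open>r > 0\<close> by simp
  let ?p = "circlepath 0 r"
  let ?e = "\<lambda>s::real. of_real r * exp (2 * of_real pi * \<i> * of_real s)"
  have "(g has_field_derivative (1 / (2 * of_real pi * \<i>) * contour_integral ?p (\<lambda>u. g u / (u-0)^2))) (at 0)"
    by (rule Cauchy_derivative_integral_circlepath(2) [OF contg holg 0])
  moreover have "(g has_field_derivative cx_partial i f z) (at 0)"
  proof -
    have "((\<lambda>x. f (with_coord i x z)) has_field_derivative cx_partial i f z) (at (0 + z $ i))"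
      using has_field_derivative_cx_partial [of f i "z $ i" z] assms by auto
    then show ?thesis unfolding g DERIV_shift by (simp add: add.commute)
  qed
  ultimately have "cx_partial i f z = 1 / (2 * of_real pi * \<i>) * contour_integral ?p (\<lambda>u. g u / u^2)"
    using DERIV_unique by fastforce
  also have "contour_integral ?p (\<lambda>u. g u / u^2) =
      integral {0..1} (\<lambda>s. g (?p s) / (?p s)\<^sup>2 * vector_derivative ?p (at s))"
    by (rule contour_integral_integral)
  also have "(\<lambda>s. g (?p s) / (?p s)\<^sup>2 * vector_derivative ?p (at s))
      = (\<lambda>s. (2 * of_real pi * \<i>) * (g (?e s) / ?e s))"
  proof
    fix s :: real
    show "g (?p s) / (?p s)\<^sup>2 * vector_derivative ?p (at s) = (2 * of_real pi * \<i>) * (g (?e s) / ?e s)"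
    proof -
      have p: "?p s = ?e s" by (simp add: circlepath mult_ac)
      have "vector_derivative ?p (at s) = (2 * of_real pi * \<i>) * ?e s"
        unfolding vector_derivative_circlepath by (simp add: mult_ac)
      moreover have "?e s \<noteq> 0" using \<open>r > 0\<close> by simp
      ultimately show ?thesis unfolding p by (simp add: power2_eq_square)
    qed
  qed
  also have "integral {0..1} \<dots> = (2 * of_real pi * \<i>) * integral {0..1} (\<lambda>s. g (?e s) / ?e s)"
    by (rule integral_mult_right)
  finally show ?thesis unfolding g_def by simp
qed

lemma continuous_on_axis: "continuous_on S (\<lambda>s. axis i (g s) :: complex ^ 'a::finite)" if "continuous_on S g"
proof -
  have "continuous_on S (\<lambda>s. \<chi> j. (axis i (g s) :: complex ^ 'a) $ j)"
  proof (rule continuous_on_vec_lambda)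
    fix j :: 'a show "continuous_on S (\<lambda>s. (axis i (g s) :: complex ^ 'a) $ j)"
      using that by (cases "j = i") (auto simp: axis_def)
  qed
  then show ?thesis by simp
qed

text \<open>The partial derivative is a Cauchy integral over a circle of fixed radius, whose integrand depends
  continuously on all variables.\<close>

lemma cx_partial_continuous_param:
  fixes \<Psi> :: "complex ^ 'a::finite \<Rightarrow> 't::metric_space \<Rightarrow> complex"
  assumes "r > 0"
    and cont: "continuous_on (ball z0 (2 * r) \<times> T) (\<lambda>(z, t). \<Psi> z t)"
    and hol: "\<And>z t. z \<in> ball z0 (2 * r) \<Longrightarrow> t \<in> T \<Longrightarrow> cx_diff (\<lambda>z. \<Psi> z t) z"
  shows "continuous_on (ball z0 r \<times> T) (\<lambda>(z, t). cx_partial i (\<lambda>z. \<Psi> z t) z)"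
proof -
  define e where "e s = of_real (r/2) * exp (2 * of_real pi * \<i> * of_real s)" for s :: real
  have e: "norm (e s) = r / 2" "e s \<noteq> 0" for s
    using \<open>r > 0\<close> by (auto simp: e_def norm_mult)
  have conte: "continuous_on S e" for S
    unfolding e_def by (intro continuous_intros)
  \<comment> \<open>Radius \<open>r / 2\<close> keeps the closed disc around each point of the smaller ball in the larger one.\<close>
  have inball: "z + axis i (e s) \<in> ball z0 (2 * r)" if "z \<in> ball z0 r" for z s
  proof -
    have "dist z0 (z + axis i (e s)) \<le> dist z0 z + dist z (z + axis i (e s))" by (rule dist_triangle)
    also have "dist z (z + axis i (e s)) = r / 2" by (simp add: dist_norm e)
    finally show ?thesis using that \<open>r > 0\<close> by simp
  qed
  have eq: "cx_partial i (\<lambda>z. \<Psi> z t) z = integral {0..1} (\<lambda>s. \<Psi> (z + axis i (e s)) t / e s)"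
    if "z \<in> ball z0 r" "t \<in> T" for z t
  proof -
    have "w \<in> ball z0 (2 * r)" if w: "w \<in> cball z (r/2)" for w
      using dist_triangle [of z0 w z] w \<open>z \<in> ball z0 r\<close> \<open>r > 0\<close> by simp
    then show ?thesis
      using cx_partial_Cauchy [of z "r/2" "\<lambda>z. \<Psi> z t" i] hol \<open>t \<in> T\<close> \<open>r > 0\<close> by (simp add: e_def)
  qed
  have "continuous_on (ball z0 r \<times> T) (\<lambda>x. integral (cbox 0 1) (\<lambda>s. \<Psi> (fst x + axis i (e s)) (snd x) / e s))"
  proof (rule integral_continuous_on_param)
    let ?S = "(ball z0 r \<times> T) \<times> cbox (0::real) 1"
    have "continuous_on ?S (\<lambda>y. (\<lambda>(z, t). \<Psi> z t) (fst (fst y) + axis i (e (snd y)), snd (fst y)))"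
      by (rule continuous_on_compose2 [OF cont])
        (use inball in \<open>auto intro!: continuous_intros continuous_on_axis continuous_on_compose2 [OF conte]\<close>)
    then have "continuous_on ?S (\<lambda>y. \<Psi> (fst (fst y) + axis i (e (snd y))) (snd (fst y)) / e (snd y))"
      by (intro continuous_on_divide) (auto simp: e intro!: continuous_intros continuous_on_compose2 [OF conte])
    then show "continuous_on ?S (\<lambda>(x, s). \<Psi> (fst x + axis i (e s)) (snd x) / e s)"
      by (simp add: split_def)
  qed
  then show ?thesis
    by (rule continuous_on_eq) (auto simp: eq)
qed

text \<open>The differential as an element of the normed space of bounded linear maps, where its continuous
  dependence on the point can be stated.\<close>

definition cx_differential :: "(complex ^ 'a::finite \<Rightarrow> complex) \<Rightarrow> complex ^ 'a \<Rightarrow> (complex ^ 'a) \<Rightarrow>\<^sub>L complex" where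
  "cx_differential f z = (\<Sum>i\<in>UNIV. blinfun_mult_left (cx_partial i f z) o\<^sub>L Blinfun (\<lambda>v :: complex ^ 'a. v $ i))"

lemma cx_differential_apply: "blinfun_apply (cx_differential f z) v = (\<Sum>i\<in>UNIV. v $ i * cx_partial i f z)"
  unfolding cx_differential_def
  by (simp add: blinfun.sum_left bounded_linear_Blinfun_apply bounded_linear_vec_nth)

lemma has_derivative_cx_differential:
  "cx_diff f z \<Longrightarrow> (f has_derivative blinfun_apply (cx_differential f z)) (at z)"
  using has_derivative_cx_partial [of f z] by (simp add: ext [OF cx_differential_apply])

lemma cx_differential_continuous_param:
  fixes \<Psi> :: "complex ^ 'a::finite \<Rightarrow> 't::metric_space \<Rightarrow> complex"
  assumes "r > 0"
    and cont: "continuous_on (ball z0 (2 * r) \<times> T) (\<lambda>(z, t). \<Psi> z t)"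
    and hol: "\<And>z t. z \<in> ball z0 (2 * r) \<Longrightarrow> t \<in> T \<Longrightarrow> cx_diff (\<lambda>z. \<Psi> z t) z"
  shows "continuous_on (ball z0 r \<times> T) (\<lambda>(z, t). cx_differential (\<lambda>z. \<Psi> z t) z)"
  unfolding cx_differential_def split_def
proof (intro continuous_on_sum bounded_bilinear.continuous_on [OF bounded_bilinear_blinfun_compose]
    bounded_linear.continuous_on [OF bounded_linear_blinfun_mult_left] continuous_on_const)
  fix i show "continuous_on (ball z0 r \<times> T) (\<lambda>x. cx_partial i (\<lambda>z. \<Psi> z (snd x)) (fst x))"
    using cx_partial_continuous_param [OF assms, of i] by (simp add: split_def)
qed

text \<open>Differentiation under the integral sign. The differential of the integrand is jointly continuous by
  \<open>cx_differential_continuous_param\<close>, as the Leibniz rule requires.\<close>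

lemma cx_diff_integral:
  fixes \<Psi> :: "complex ^ 'a::finite \<Rightarrow> real \<Rightarrow> complex"
  assumes "r > 0"
    and cont: "continuous_on (ball z0 r \<times> {0..1}) (\<lambda>(z, t). \<Psi> z t)"
    and hol: "\<And>z t. z \<in> ball z0 r \<Longrightarrow> t \<in> {0..1} \<Longrightarrow> cx_diff (\<lambda>z. \<Psi> z t) z"
    and z: "z \<in> ball z0 r"
  shows "cx_diff (\<lambda>z. integral {0..1} (\<Psi> z)) z"
proof -
  obtain \<rho> where \<rho>: "\<rho> > 0" "ball z (2 * \<rho>) \<subseteq> ball z0 r"
  proof -
    obtain e where "e > 0" "ball z e \<subseteq> ball z0 r" by (rule openE [OF open_ball z])
    then show thesis by (intro that [of "e/2"]) auto
  qed
  define L where "L w t = cx_differential (\<lambda>z. \<Psi> z t) w" for w t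
  have sub: "ball z \<rho> \<subseteq> ball z0 r" using subset_ball [of \<rho> "2 * \<rho>" z] \<rho> by auto
  have cont2: "continuous_on (ball z (2 * \<rho>) \<times> {0..1}) (\<lambda>(z, t). \<Psi> z t)"
    by (rule continuous_on_subset [OF cont]) (use \<rho>(2) in auto)
  have contL: "continuous_on (ball z \<rho> \<times> cbox 0 1) (\<lambda>(w, t). L w t)"
    unfolding L_def cbox_interval
    by (rule cx_differential_continuous_param [OF \<rho>(1) cont2]) (use hol \<rho>(2) in blast)
  have zz: "z \<in> ball z \<rho>" using \<rho>(1) by simp
  have "((\<lambda>x. integral (cbox 0 1) (\<Psi> x)) has_derivative integral (cbox 0 1) (L z)) (at z within ball z \<rho>)"
  proof (rule leibniz_rule [OF _ _ contL zz convex_ball])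
    fix x t assume "x \<in> ball z \<rho>" "t \<in> cbox (0::real) 1"
    then have "cx_diff (\<lambda>z. \<Psi> z t) x"
      by (intro hol subsetD [OF sub]) (auto simp: cbox_interval)
    then show "((\<lambda>x. \<Psi> x t) has_derivative blinfun_apply (L x t)) (at x within ball z \<rho>)"
      unfolding L_def by (rule has_derivative_at_withinI [OF has_derivative_cx_differential])
  next
    fix x assume x: "x \<in> ball z \<rho>"
    have x': "x \<in> ball z0 r" by (rule subsetD [OF sub x])
    have "continuous_on (cbox 0 1) (\<lambda>t. (\<lambda>(z, t). \<Psi> z t) (x, t))"
      by (rule continuous_on_compose2 [OF cont]) (use x' in \<open>auto intro!: continuous_intros\<close>)
    then show "\<Psi> x integrable_on cbox 0 1" by (intro integrable_continuous) simp
  qed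
  then have 1: "((\<lambda>x. integral {0..1} (\<Psi> x)) has_derivative integral {0..1} (L z)) (at z)"
    using at_within_open [OF zz open_ball] by simp
  have "continuous_on (cbox 0 1) (\<lambda>t. (\<lambda>(w, t). L w t) (z, t))"
    by (rule continuous_on_compose2 [OF contL]) (use zz in \<open>auto intro!: continuous_intros\<close>)
  then have intL: "L z integrable_on {0..1}" using integrable_continuous [of 0 1 "L z"] by simp
  have "integral {0..1} (L z) (c *s v) = c * integral {0..1} (L z) v" for c v
  proof -
    have "L z t (c *s v) = c * L z t v" for t
      by (simp add: L_def cx_differential_apply sum_distrib_left mult_ac)
    then show ?thesis unfolding blinfun_apply_integral [OF intL] by simp
  qed
  then show ?thesis using 1 unfolding cx_diff_def by blast
qed

section \<open>Germs of holomorphic functions\<close>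

text \<open>Germs are handled by means of the filter of neighbourhoods, which avoids keeping track of the domains on
  which compositions and inverses are defined.\<close>

definition holo_germ :: "(complex ^ 'a::finite \<Rightarrow> complex) \<Rightarrow> complex ^ 'a \<Rightarrow> bool" where
  "holo_germ f p \<longleftrightarrow> (\<forall>\<^sub>F z in nhds p. cx_diff f z)"

definition holo_map_germ ::
  "(complex ^ 'a::finite \<Rightarrow> complex ^ 'b::finite) \<Rightarrow> complex ^ 'a \<Rightarrow> bool" where
  "holo_map_germ \<Phi> p \<longleftrightarrow> (\<forall>i. holo_germ (\<lambda>z. \<Phi> z $ i) p)"

lemma holo_germ_iff_mholo_on: "holo_germ f p \<longleftrightarrow> (\<exists>V. open V \<and> p \<in> V \<and> mholo_on f V)"
  unfolding holo_germ_def mholo_on_iff eventually_nhds by blast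

lemma holo_germ_cx_diff: "holo_germ f p \<Longrightarrow> cx_diff f p"
  unfolding holo_germ_def by (rule eventually_nhds_x_imp_x)

lemma holo_germ_const [simp]: "holo_germ (\<lambda>z. c) p"
  and holo_germ_nth [simp]: "holo_germ (\<lambda>z. z $ i) p"
  by (simp_all add: holo_germ_def)

lemma holo_germ_add:
  assumes "holo_germ f p" "holo_germ g p" shows "holo_germ (\<lambda>z. f z + g z) p"
  using assms unfolding holo_germ_def by eventually_elim (rule cx_diff_add)

lemma holo_germ_mult:
  assumes "holo_germ f p" "holo_germ g p" shows "holo_germ (\<lambda>z. f z * g z) p"
  using assms unfolding holo_germ_def by eventually_elim (rule cx_diff_mult)

lemma holo_germ_diff:
  assumes "holo_germ f p" "holo_germ g p" shows "holo_germ (\<lambda>z. f z - g z) p"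
  using assms unfolding holo_germ_def by eventually_elim (rule cx_diff_diff)

lemma holo_germ_sum:
  "finite A \<Longrightarrow> (\<And>i. i \<in> A \<Longrightarrow> holo_germ (f i) p) \<Longrightarrow> holo_germ (\<lambda>z. \<Sum>i\<in>A. f i z) p"
  by (induction A rule: finite_induct) (auto intro: holo_germ_add)

lemma filterlim_nhds_of_isCont: "isCont f p \<Longrightarrow> filterlim f (nhds (f p)) (nhds p)"
  unfolding isCont_def by (simp add: tendsto_at_iff_tendsto_nhds)

lemma eventually_nhds_isCont:
  "isCont f p \<Longrightarrow> eventually P (nhds (f p)) \<Longrightarrow> \<forall>\<^sub>F z in nhds p. P (f z)"
  using filterlim_nhds_of_isCont unfolding filterlim_iff by blast

lemma holo_germ_isCont: "holo_germ f p \<Longrightarrow> isCont f p"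
  by (rule cx_diff_continuous [OF holo_germ_cx_diff])

lemma holo_map_germ_isCont: "holo_map_germ \<Phi> p \<Longrightarrow> isCont \<Phi> p"
  unfolding holo_map_germ_def by (rule cx_diff_vec_continuous) (rule holo_germ_cx_diff, simp)

lemma holo_germ_nonzero: "holo_germ f p \<Longrightarrow> f p \<noteq> 0 \<Longrightarrow> \<forall>\<^sub>F z in nhds p. f z \<noteq> 0"
  by (rule eventually_nhds_isCont [OF holo_germ_isCont, of f p "\<lambda>x. x \<noteq> 0"])
    (auto intro: t1_space_nhds)

lemma holo_germ_divide:
  assumes "holo_germ f p" "holo_germ g p" "g p \<noteq> 0" shows "holo_germ (\<lambda>z. f z / g z) p"
  using assms(1,2) holo_germ_nonzero [OF assms(2,3)] unfolding holo_germ_def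
  by eventually_elim (rule cx_diff_divide)

lemma holo_germ_cong:
  assumes "holo_germ f p" "\<forall>\<^sub>F z in nhds p. g z = f z" shows "holo_germ g p"
proof -
  have "\<forall>\<^sub>F z in nhds p. \<forall>\<^sub>F w in nhds z. g w = f w"
    using assms(2) by (simp add: eventually_eventually)
  with assms(1) show ?thesis unfolding holo_germ_def by eventually_elim (rule cx_diff_cong)
qed

lemma holo_germ_compose:
  assumes "holo_germ h (\<Phi> p)" "holo_map_germ \<Phi> p" shows "holo_germ (\<lambda>z. h (\<Phi> z)) p"
proof -
  have "\<forall>\<^sub>F z in nhds p. cx_diff h (\<Phi> z)"
    using eventually_nhds_isCont [OF holo_map_germ_isCont [OF assms(2)]] assms(1)
    unfolding holo_germ_def by blast
  moreover have "\<forall>\<^sub>F z in nhds p. \<forall>i. cx_diff (\<lambda>z. \<Phi> z $ i) z"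
    by (rule eventually_all_finite) (use assms(2) in \<open>simp add: holo_map_germ_def holo_germ_def\<close>)
  ultimately show ?thesis unfolding holo_germ_def
    by eventually_elim (rule cx_diff_compose, auto)
qed

lemma holo_map_germ_compose:
  assumes "holo_map_germ \<Psi> (\<Phi> p)" "holo_map_germ \<Phi> p" shows "holo_map_germ (\<lambda>z. \<Psi> (\<Phi> z)) p"
  using assms holo_germ_compose unfolding holo_map_germ_def by blast

lemma holo_germ_holomorphic_compose:
  assumes "g holomorphic_on S" "open S" "f p \<in> S" "holo_germ f p"
  shows "holo_germ (\<lambda>z. g (f z)) p"
proof -
  have "\<forall>\<^sub>F z in nhds p. f z \<in> S"
    using eventually_nhds_isCont [OF holo_germ_isCont [OF assms(4)]] eventually_nhds_in_open assms
    by blast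
  then show ?thesis using assms(4) unfolding holo_germ_def
    by eventually_elim
      (rule cx_diff_field_compose, use assms holomorphic_on_imp_differentiable_at in auto)
qed

lemma holo_map_germ_with_coord:
  "holo_germ c p \<Longrightarrow> holo_map_germ (\<lambda>z. with_coord i (c z) z) p"
  unfolding holo_map_germ_def
proof
  fix j assume "holo_germ c p" then show "holo_germ (\<lambda>z. with_coord i (c z) z $ j) p"
    by (cases "j = i") auto
qed

text \<open>Near \<open>p\<close> the partial derivative is the Cauchy integral of the translates of \<open>f\<close> along a circle,
  and each translate is holomorphic.\<close>

lemma holo_germ_partial:
  assumes "holo_germ f p" shows "holo_germ (cx_partial i f) p"
proof -
  obtain R where R: "R > 0" "\<And>z. z \<in> ball p R \<Longrightarrow> cx_diff f z"
    using assms unfolding holo_germ_def eventually_nhds_metric by (auto simp: dist_commute)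
  define e where "e s = of_real (R/4) * exp (2 * of_real pi * \<i> * of_real s)" for s :: real
  have e: "norm (e s) = R / 4" "e s \<noteq> 0" for s
    using \<open>R > 0\<close> by (auto simp: e_def norm_mult)
  have conte: "continuous_on S e" for S
    unfolding e_def by (intro continuous_intros)
  have inball: "z + axis i (e s) \<in> ball p R" if "z \<in> ball p (R/2)" for z s
  proof -
    have "dist p (z + axis i (e s)) \<le> dist p z + dist z (z + axis i (e s))" by (rule dist_triangle)
    also have "dist z (z + axis i (e s)) = R / 4" by (simp add: dist_norm e)
    finally show ?thesis using that \<open>R > 0\<close> by simp
  qed
  have eq: "cx_partial i f z = integral {0..1} (\<lambda>s. f (z + axis i (e s)) / e s)"
    if "z \<in> ball p (R/2)" for z
  proof -
    have "w \<in> ball p R" if w: "w \<in> cball z (R/4)" for w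
      using dist_triangle [of p w z] w \<open>z \<in> ball p (R/2)\<close> \<open>R > 0\<close> by simp
    then show ?thesis
      using cx_partial_Cauchy [of z "R/4" f i] R by (simp add: e_def)
  qed
  have contf: "continuous_on (ball p R) f"
    by (rule continuous_at_imp_continuous_on) (blast intro: cx_diff_continuous R(2))
  have "cx_diff (\<lambda>z. integral {0..1} (\<lambda>s. f (z + axis i (e s)) / e s)) z" if z: "z \<in> ball p (R/2)" for z
  proof (rule cx_diff_integral [OF _ _ _ z])
    show "R / 2 > 0" using \<open>R > 0\<close> by simp
    have "continuous_on (ball p (R/2) \<times> {0..1}) (\<lambda>x. f (fst x + axis i (e (snd x))) / e (snd x))"
      by (intro continuous_on_divide continuous_on_compose2 [OF contf] continuous_on_add continuous_on_axis
         continuous_on_compose2 [OF conte] continuous_on_fst continuous_on_snd continuous_on_id)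
        (use inball e in auto)
    then show "continuous_on (ball p (R/2) \<times> {0..1}) (\<lambda>(z, s). f (z + axis i (e s)) / e s)"
      by (simp add: split_def)
    fix w :: "complex ^ 'a" and s :: real assume w: "w \<in> ball p (R/2)"
    have "cx_diff (\<lambda>z. f (z + axis i (e s))) w"
      by (rule cx_diff_compose [where \<Phi> = "\<lambda>z. z + axis i (e s)"])
        (simp_all add: cx_diff_add R(2) [OF inball [OF w]])
    then show "cx_diff (\<lambda>z. f (z + axis i (e s)) / e s) w"
      by (rule cx_diff_divide) (simp_all add: e)
  qed
  moreover have "\<forall>\<^sub>F z in nhds p. z \<in> ball p (R/2)"
    using R(1) by (intro eventually_nhds_in_open) auto
  ultimately have "holo_germ (\<lambda>z. integral {0..1} (\<lambda>s. f (z + axis i (e s)) / e s)) p"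
    unfolding holo_germ_def by (auto elim: eventually_mono)
  then show ?thesis
    by (rule holo_germ_cong) (use \<open>\<forall>\<^sub>F z in nhds p. z \<in> ball p (R/2)\<close> eq in \<open>auto elim: eventually_mono\<close>)
qed

section \<open>Division by a coordinate\<close>

text \<open>The quotient is \<open>q(z) = \<integral> \<partial>\<^sub>if(z\<^sub>1, \<dots>, sz\<^sub>i, \<dots>, z\<^sub>n) ds\<close> over \<open>0 \<le> s \<le> 1\<close>:
  multiplied by \<open>z\<^sub>i\<close>, the integrand is the derivative of \<open>f\<close> along the segment from
  \<open>with_coord i 0 z\<close> to \<open>z\<close>. On the hyperplane \<open>z\<^sub>i = 0\<close> the integrand is constant in \<open>s\<close>.\<close>

lemma Hadamard_division:
  fixes f :: "complex ^ 'a::finite \<Rightarrow> complex"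
  assumes "holo_germ f 0"
  obtains q where "holo_germ q 0"
    "\<forall>\<^sub>F z in nhds 0. f z = f (with_coord i 0 z) + z $ i * q z"
    "\<And>z. q (with_coord i 0 z) = cx_partial i f (with_coord i 0 z)"
proof -
  have "\<forall>\<^sub>F z in nhds 0. cx_diff f z \<and> cx_diff (cx_partial i f) z"
    using assms holo_germ_partial [OF assms, of i] unfolding holo_germ_def by (rule eventually_conj)
  then obtain R where R: "R > 0" "\<And>z. z \<in> ball 0 R \<Longrightarrow> cx_diff f z"
      "\<And>z. z \<in> ball 0 R \<Longrightarrow> cx_diff (cx_partial i f) z"
    unfolding eventually_nhds_metric by auto
  let ?w = "\<lambda>z s. with_coord i (of_real s * z $ i) z"
  define q where "q z = integral {0..1} (\<lambda>s. cx_partial i f (?w z s))" for z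
  have inball: "?w z s \<in> ball 0 R" if "z \<in> ball 0 R" "s \<in> {0..1}" for z and s :: real
  proof -
    have "norm (?w z s) \<le> norm z"
      by (rule norm_le_componentwise_cart) (use that in \<open>auto simp: norm_mult mult_left_le_one_le\<close>)
    then show ?thesis using that by simp
  qed
  have contp: "continuous_on (ball 0 R) (cx_partial i f)"
    by (rule continuous_at_imp_continuous_on) (blast intro: cx_diff_continuous R(3))
  have contw: "continuous_on S (\<lambda>x. ?w (fst x) (snd x))" for S :: "((complex ^ 'a) \<times> real) set"
    unfolding with_coord_eq_add
    by (intro continuous_on_add continuous_on_axis continuous_intros)
  have contpw: "continuous_on (ball 0 R \<times> {0..1}) (\<lambda>x. cx_partial i f (?w (fst x) (snd x)))"
    by (rule continuous_on_compose2 [OF contp contw]) (use inball in auto)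
  have "cx_diff q z" if z: "z \<in> ball 0 R" for z
    unfolding q_def
  proof (rule cx_diff_integral [OF R(1) _ _ z])
    show "continuous_on (ball 0 R \<times> {0..1}) (\<lambda>(z, s). cx_partial i f (?w z s))"
      using contpw by (simp add: split_def)
    fix z :: "complex ^ 'a" and s :: real assume zs: "z \<in> ball 0 R" "s \<in> {0..1}"
    show "cx_diff (\<lambda>z. cx_partial i f (?w z s)) z"
    proof (rule cx_diff_compose [where \<Phi> = "\<lambda>z. ?w z s"])
      show "cx_diff (cx_partial i f) (?w z s)" by (rule R(3) [OF inball [OF zs]])
      fix j show "cx_diff (\<lambda>z. ?w z s $ j) z" by (cases "j = i") (auto intro!: cx_diff_mult)
    qed
  qed
  moreover have ev: "\<forall>\<^sub>F z in nhds 0. z \<in> ball (0 :: complex ^ 'a) R"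
    using R(1) by (intro eventually_nhds_in_open) auto
  ultimately have 1: "holo_germ q 0"
    unfolding holo_germ_def by (auto elim: eventually_mono)
  have "f z = f (with_coord i 0 z) + z $ i * q z" if z: "z \<in> ball 0 R" for z
  proof -
    have "((\<lambda>s. z $ i * cx_partial i f (?w z s)) has_integral f (?w z 1) - f (?w z 0)) {0..1}"
    proof (rule fundamental_theorem_of_calculus)
      fix s :: real assume s: "s \<in> {0..1}"
      have "((\<lambda>x. f (with_coord i x z)) has_field_derivative cx_partial i f (?w z s)) (at (of_real s * z $ i))"
        by (rule has_field_derivative_cx_partial [OF R(2) [OF inball [OF z s]]])
      then have "((\<lambda>x. f (with_coord i (x * z $ i) z)) has_field_derivative cx_partial i f (?w z s) * z $ i) (at (of_real s))"
        by (rule DERIV_chain2) (auto intro!: derivative_eq_intros)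
      then have "((\<lambda>s. f (?w z s)) has_vector_derivative cx_partial i f (?w z s) * z $ i) (at s within {0..1})"
        by (rule has_vector_derivative_real_field [unfolded comp_def])
      then show "((\<lambda>s. f (?w z s)) has_vector_derivative z $ i * cx_partial i f (?w z s)) (at s within {0..1})"
        by (simp add: mult.commute)
    qed simp
    from integral_unique [OF this] show ?thesis by (simp add: q_def)
  qed
  then have 2: "\<forall>\<^sub>F z in nhds 0. f z = f (with_coord i 0 z) + z $ i * q z"
    using ev by (auto elim: eventually_mono)
  have "q (with_coord i 0 z) = cx_partial i f (with_coord i 0 z)" for z
    by (simp add: q_def)
  then show thesis using that 1 2 by blast
qed

text \<open>The first quotient equals the partial derivative on the hyperplane \<open>z\<^sub>i = 0\<close>. It vanishes there, so
  it can be divided once more.\<close>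

lemma Hadamard_division_square:
  fixes f :: "complex ^ 'a::finite \<Rightarrow> complex"
  assumes "holo_germ f 0" "\<forall>\<^sub>F z in nhds 0. cx_partial i f (with_coord i 0 z) = 0"
  obtains q where "holo_germ q 0"
    "\<forall>\<^sub>F z in nhds 0. f z = f (with_coord i 0 z) + (z $ i)\<^sup>2 * q z"
proof -
  obtain q1 where q1: "holo_germ q1 0"
    "\<forall>\<^sub>F z in nhds 0. f z = f (with_coord i 0 z) + z $ i * q1 z"
    "\<And>z. q1 (with_coord i 0 z) = cx_partial i f (with_coord i 0 z)"
    using Hadamard_division [OF assms(1), of i] by blast
  obtain q2 where q2: "holo_germ q2 0"
    "\<forall>\<^sub>F z in nhds 0. q1 z = q1 (with_coord i 0 z) + z $ i * q2 z"
    using Hadamard_division [OF q1(1), of i] by blast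
  have "\<forall>\<^sub>F z in nhds 0. f z = f (with_coord i 0 z) + (z $ i)\<^sup>2 * q2 z"
    using q1(2) q2(2) assms(2)
    by eventually_elim (simp add: q1(3) power2_eq_square)
  then show thesis using that q2(1) by blast
qed

section \<open>Biholomorphic germs and the inverse function theorem\<close>

text \<open>The inverse germ is an argument, because \<open>germ_iso\<close> asks for both directions.\<close>

definition biholo_germ ::
  "(complex ^ 'a::finite \<Rightarrow> complex ^ 'b::finite) \<Rightarrow> (complex ^ 'b \<Rightarrow> complex ^ 'a) \<Rightarrow>
   complex ^ 'a \<Rightarrow> complex ^ 'b \<Rightarrow> bool" where
  "biholo_germ \<Phi> \<Psi> p q \<longleftrightarrow>
     holo_map_germ \<Phi> p \<and> holo_map_germ \<Psi> q \<and> \<Phi> p = q \<and> \<Psi> q = p \<and>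
     (\<forall>\<^sub>F z in nhds p. \<Psi> (\<Phi> z) = z) \<and> (\<forall>\<^sub>F w in nhds q. \<Phi> (\<Psi> w) = w)"

lemma eventually_nhds_holo_map_germ:
  assumes "holo_map_germ \<Phi> p" "\<Phi> p = q" "eventually P (nhds q)"
  shows "\<forall>\<^sub>F z in nhds p. P (\<Phi> z)"
  using eventually_nhds_isCont [OF holo_map_germ_isCont [OF assms(1)]] assms by blast

lemma biholo_germ_compose:
  assumes "biholo_germ \<Phi>1 \<Psi>1 p q" "biholo_germ \<Phi>2 \<Psi>2 q r"
  shows "biholo_germ (\<lambda>z. \<Phi>2 (\<Phi>1 z)) (\<lambda>w. \<Psi>1 (\<Psi>2 w)) p r"
proof -
  note a = assms [unfolded biholo_germ_def]
  have "\<forall>\<^sub>F z in nhds p. \<Psi>2 (\<Phi>2 (\<Phi>1 z)) = \<Phi>1 z" "\<forall>\<^sub>F w in nhds r. \<Phi>1 (\<Psi>1 (\<Psi>2 w)) = \<Psi>2 w"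
    using a eventually_nhds_holo_map_germ by blast+
  then have "\<forall>\<^sub>F z in nhds p. \<Psi>1 (\<Psi>2 (\<Phi>2 (\<Phi>1 z))) = z" "\<forall>\<^sub>F w in nhds r. \<Phi>2 (\<Phi>1 (\<Psi>1 (\<Psi>2 w))) = w"
    using a by (auto elim: eventually_elim2)
  then show ?thesis unfolding biholo_germ_def
    using a by (auto intro: holo_map_germ_compose)
qed

lemma in_germ_idealI:
  assumes "holo_germ a p" "\<forall>\<^sub>F z in nhds p. h z = a z * F z" shows "in_germ_ideal F p h"
proof -
  have "\<forall>\<^sub>F z in nhds p. cx_diff a z \<and> h z = a z * F z"
    using assms unfolding holo_germ_def by (rule eventually_conj)
  then show ?thesis unfolding in_germ_ideal_def eventually_nhds mholo_on_iff by blast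
qed

lemma in_germ_idealE:
  assumes "in_germ_ideal F p h"
  obtains a where "holo_germ a p" "\<forall>\<^sub>F z in nhds p. h z = a z * F z"
proof -
  obtain V a where "open V" "p \<in> V" "mholo_on a V" "\<forall>z\<in>V. h z = a z * F z"
    using assms unfolding in_germ_ideal_def by blast
  then show thesis by (intro that [of a]) (auto simp: holo_germ_iff_mholo_on eventually_nhds)
qed

lemma holo_map_germ_iff: "holo_map_germ \<Phi> p \<longleftrightarrow> (\<exists>V. open V \<and> p \<in> V \<and> holo_map_on \<Phi> V)"
proof
  assume "holo_map_germ \<Phi> p"
  then have "\<forall>\<^sub>F z in nhds p. \<forall>i. cx_diff (\<lambda>z. \<Phi> z $ i) z"
    by (intro eventually_all_finite) (simp add: holo_map_germ_def holo_germ_def)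
  then show "\<exists>V. open V \<and> p \<in> V \<and> holo_map_on \<Phi> V"
    unfolding eventually_nhds holo_map_on_def mholo_on_iff by blast
qed (auto simp: holo_map_germ_def holo_germ_iff_mholo_on holo_map_on_def)

text \<open>A change of coordinates that transforms one equation into a unit multiple of the other induces an
  isomorphism of germs; the two compositions are the identity even before passing to the quotient.\<close>

lemma germ_isoI:
  assumes "biholo_germ \<Phi> \<Psi> p q" "holo_germ u p" "u p \<noteq> 0"
    and F: "\<forall>\<^sub>F z in nhds p. F z = u z * G (\<Phi> z)"
  shows "germ_iso F p G q"
proof -
  note b = assms(1) [unfolded biholo_germ_def]
  obtain V W where V: "open V" "p \<in> V" "holo_map_on \<Phi> V" and W: "open W" "q \<in> W" "holo_map_on \<Psi> W"
    using b unfolding holo_map_germ_iff by blast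
  have "\<forall>\<^sub>F z in nhds p. G (\<Phi> z) = 1 / u z * F z"
    using F holo_germ_nonzero [OF assms(2,3)] by eventually_elim simp
  then have 1: "in_germ_ideal F p (\<lambda>z. G (\<Phi> z))"
    by (intro in_germ_idealI [of "\<lambda>z. 1 / u z"] holo_germ_divide assms) auto
  have "\<forall>\<^sub>F w in nhds q. F (\<Psi> w) = u (\<Psi> w) * G (\<Phi> (\<Psi> w))"
    using eventually_nhds_holo_map_germ [of \<Psi> q p] b F by blast
  moreover have "\<forall>\<^sub>F w in nhds q. \<Phi> (\<Psi> w) = w" using b by blast
  ultimately have "\<forall>\<^sub>F w in nhds q. F (\<Psi> w) = u (\<Psi> w) * G w" by eventually_elim simp
  moreover have "holo_germ (\<lambda>w. u (\<Psi> w)) q"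
    using holo_germ_compose [of u \<Psi> q] b assms(2) by simp
  ultimately have 2: "in_germ_ideal G q (\<lambda>w. F (\<Psi> w))" by (rule in_germ_idealI [rotated])
  have "\<forall>\<^sub>F z in nhds p. \<Psi> (\<Phi> z) $ i - z $ i = 0 * F z" for i
    using eventually_mono [of "\<lambda>z. \<Psi> (\<Phi> z) = z" "nhds p"] b by simp
  then have 3: "in_germ_ideal F p (\<lambda>z. \<Psi> (\<Phi> z) $ i - z $ i)" for i
    by (rule in_germ_idealI [OF holo_germ_const])
  have "\<forall>\<^sub>F w in nhds q. \<Phi> (\<Psi> w) $ j - w $ j = 0 * G w" for j
    using eventually_mono [of "\<lambda>w. \<Phi> (\<Psi> w) = w" "nhds q"] b by simp
  then have 4: "in_germ_ideal G q (\<lambda>w. \<Phi> (\<Psi> w) $ j - w $ j)" for j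
    by (rule in_germ_idealI [OF holo_germ_const])
  show ?thesis unfolding germ_iso_def
    by (rule exI [of _ V], rule exI [of _ W], rule exI [of _ \<Phi>], rule exI [of _ \<Psi>])
      (intro conjI allI V W 1 2 3 4; use b in simp)
qed

lemma bounded_linear_axis: "bounded_linear (axis i :: complex \<Rightarrow> complex ^ 'a::finite)"
  using has_derivative_bounded_linear [OF has_derivative_with_coord] .

text \<open>Holomorphic functions are continuously differentiable by Cauchy's formula, so the real inverse function
  theorem applies. The derivative of the inverse is the inverse of a complex linear map and hence
  complex linear.\<close>

lemma holo_inverse_function:
  fixes \<Phi> :: "complex ^ 'a::finite \<Rightarrow> complex ^ 'a"
  assumes hol: "holo_map_germ \<Phi> p"
    and D: "(\<Phi> has_derivative D) (at p)" "\<And>v. D v = 0 \<Longrightarrow> v = 0"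
  obtains \<Psi> where "biholo_germ \<Phi> \<Psi> p (\<Phi> p)"
proof -
  have "\<forall>\<^sub>F z in nhds p. \<forall>i. cx_diff (\<lambda>z. \<Phi> z $ i) z"
    by (intro eventually_all_finite) (use hol in \<open>simp add: holo_map_germ_def holo_germ_def\<close>)
  then obtain R where R: "R > 0" "\<And>z i. z \<in> ball p R \<Longrightarrow> cx_diff (\<lambda>z. \<Phi> z $ i) z"
    unfolding eventually_nhds_metric by (auto simp: dist_commute)
  define U where "U = ball p (R/2)"
  have U: "open U" "p \<in> U" "U \<subseteq> ball p R" using R(1) by (auto simp: U_def)
  define L where "L z = (\<Sum>i\<in>UNIV. Blinfun (axis i) o\<^sub>L cx_differential (\<lambda>z. \<Phi> z $ i) z)" for z
  have L_nth: "blinfun_apply (L z) v $ i = cx_differential (\<lambda>z. \<Phi> z $ i) z v" for z v i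
    by (simp add: L_def blinfun.sum_left bounded_linear_Blinfun_apply bounded_linear_axis axis_def
        if_distrib cong: if_cong)
  have derL: "(\<Phi> has_derivative blinfun_apply (L z)) (at z)" if "z \<in> U" for z
    by (rule has_derivative_vec) (use R(2) U(3) that in \<open>auto simp: L_nth intro!: has_derivative_cx_differential\<close>)
  have L_smult: "L z (c *s v) = c *s L z v" for z c v
    by (simp add: vec_eq_iff L_nth cx_differential_apply sum_distrib_left mult_ac)
  have "continuous_on U (cx_differential (\<lambda>z. \<Phi> z $ i))" for i
  proof -
    have "continuous_on (ball p (R/2) \<times> {0::real}) (\<lambda>(z, t). cx_differential (\<lambda>z. \<Phi> z $ i) z)"
    proof (rule cx_differential_continuous_param)
      have "continuous_on (ball p R) (\<lambda>z. \<Phi> z $ i)"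
        by (rule continuous_at_imp_continuous_on) (blast intro: cx_diff_continuous R(2))
      then have "continuous_on (ball p R \<times> {0::real}) (\<lambda>x. \<Phi> (fst x) $ i)"
        by (rule continuous_on_compose2) (auto intro!: continuous_intros)
      then show "continuous_on (ball p (2 * (R/2)) \<times> {0::real}) (\<lambda>(z, t). \<Phi> z $ i)"
        by (simp add: split_def)
    qed (use R in auto)
    then have "continuous_on U (\<lambda>z. (\<lambda>(z, t). cx_differential (\<lambda>z. \<Phi> z $ i) z) (z, 0::real))"
      by (rule continuous_on_compose2) (auto simp: U_def intro!: continuous_intros)
    then show ?thesis by simp
  qed
  then have contL: "continuous_on U L"
    unfolding L_def
    by (intro continuous_on_sum bounded_bilinear.continuous_on [OF bounded_bilinear_blinfun_compose]
      continuous_on_const)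
  have LD: "blinfun_apply (L p) = D"
    using has_derivative_unique [OF derL [OF U(2)] D(1)] .
  have "linear D" using D(1) by (rule has_derivative_linear)
  then have "inj D" using D(2) by (simp add: linear_injective_0)
  then obtain G where G: "linear G" "G \<circ> D = id"
    using linear_injective_left_inverse [OF \<open>linear D\<close>] by blast
  have "Blinfun G o\<^sub>L L p = id_blinfun"
    by (rule blinfun_eqI)
      (use G(2) in \<open>simp add: LD bounded_linear_Blinfun_apply linear_conv_bounded_linear [symmetric] G(1) pointfree_idE\<close>)
  then obtain U' V g g' where inv: "open U'" "U' \<subseteq> U" "p \<in> U'" "open V" "\<Phi> p \<in> V"
    "homeomorphism U' V \<Phi> g" "\<And>y. y \<in> V \<Longrightarrow> (g has_derivative (g' y)) (at y)"
    "\<And>y. y \<in> V \<Longrightarrow> g' y = Hilbert_Choice.inv (blinfun_apply (L (g y)))"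
    "\<And>y. y \<in> V \<Longrightarrow> bij (blinfun_apply (L (g y)))"
    using inverse_function_theorem [OF U(1) derL contL U(2)] by metis
  have "cx_diff (\<lambda>y. g y $ i) y" if y: "y \<in> V" for y i
  proof -
    have "g' y (c *s v) = c *s g' y v" for c v
    proof -
      have "L (g y) (c *s g' y v) = c *s v"
        using inv(8,9) [OF y] by (simp add: L_smult bij_is_surj surj_f_inv_f)
      then show ?thesis using inv(8,9) [OF y] by (metis bij_is_inj inv_f_f)
    qed
    moreover have "((\<lambda>y. g y $ i) has_derivative (\<lambda>v. g' y v $ i)) (at y)"
      by (rule bounded_linear.has_derivative [OF bounded_linear_vec_nth inv(7) [OF y]])
    ultimately show ?thesis unfolding cx_diff_def by (intro exI [of _ "\<lambda>v. g' y v $ i"]) simp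
  qed
  then have "holo_map_germ g (\<Phi> p)"
    unfolding holo_map_germ_def holo_germ_iff_mholo_on mholo_on_iff using inv(4,5) by blast
  moreover have "\<forall>\<^sub>F z in nhds p. g (\<Phi> z) = z"
    unfolding eventually_nhds using inv(1,3,6) by (auto simp: homeomorphism_def)
  moreover have "\<forall>\<^sub>F w in nhds (\<Phi> p). \<Phi> (g w) = w"
    unfolding eventually_nhds using inv(4,5,6) by (auto simp: homeomorphism_def)
  moreover have "g (\<Phi> p) = p" using inv(3,6) by (auto simp: homeomorphism_def)
  ultimately show thesis using that hol unfolding biholo_germ_def by blast
qed



section \<open>Ordinary double points\<close>

lemma has_derivative_line: "((\<lambda>x. p + x *s v) has_derivative (\<lambda>x. x *s v)) (at (y :: complex))"
  by (rule has_derivative_vec) (auto intro!: derivative_eq_intros)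

lemma isCont_line: "isCont (\<lambda>x :: complex. p + x *s v) y"
  by (rule has_derivative_continuous [OF has_derivative_line])

lemma has_field_derivative_line:
  fixes g :: "complex ^ 'a::finite \<Rightarrow> complex"
  assumes "(g has_derivative D) (at p)" "\<And>c v. D (c *s v) = c * D v"
  shows "((\<lambda>x. g (p + x *s v)) has_field_derivative D v) (at 0)"
proof -
  have "((\<lambda>x. g (p + x *s v)) has_derivative (\<lambda>x. D (x *s v))) (at 0)"
    by (rule has_derivative_compose [OF has_derivative_line]) (use assms(1) in simp)
  moreover have "(\<lambda>x. D (x *s v)) = (*) (D v)" by (simp add: fun_eq_iff assms(2))
  ultimately show ?thesis unfolding has_field_derivative_def by simp
qed

lemma has_derivative_odp_model:
  "(odp_model has_derivative (\<lambda>v. \<Sum>i\<in>UNIV. 2 * z $ i * v $ i)) (at z)"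
  unfolding odp_model_def
  by (rule has_derivative_sum) (auto intro!: derivative_eq_intros has_derivative_vec_nth simp: fun_eq_iff)

lemma odp_model_0 [simp]: "odp_model 0 = 0"
  by (simp add: odp_model_def)

text \<open>Every element of the ideal of the double point vanishes to second order, so congruences modulo this ideal
  determine first derivatives.\<close>

lemma has_derivative_mult_odp_model:
  assumes "cx_diff a 0" shows "((\<lambda>z. a z * odp_model z) has_derivative (\<lambda>v. 0)) (at 0)"
proof -
  obtain A where "(a has_derivative A) (at 0)" using assms unfolding cx_diff_def by blast
  from has_derivative_mult [OF this has_derivative_odp_model] show ?thesis by simp
qed

text \<open>Let \<open>A\<close> and \<open>B\<close> be the derivatives of the two maps of an isomorphism of germs. Their composition is
  the identity modulo an ideal of functions that vanish to second order, so \<open>A\<close> and \<open>B\<close> are inverse to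
  each other. The isomorphism is thus a change of coordinates, and it remains to see that the factor
  \<open>a\<close> is a unit: otherwise \<open>a f\<close> would vanish to third order, while the quadratic form in the new
  coordinates does not.\<close>

lemma odp_normal_form:
  fixes f :: "complex ^ 'd::finite \<Rightarrow> complex"
  assumes iso: "germ_iso f p odp_model (0 :: complex ^ 'd)" and f: "holo_germ f p"
  obtains \<xi> :: "complex ^ 'd \<Rightarrow> complex ^ 'd" and D a where "holo_map_germ \<xi> p" "\<xi> p = 0" "(\<xi> has_derivative D) (at p)"
    "\<And>v. D v = 0 \<Longrightarrow> v = 0" "holo_germ a p" "a p \<noteq> 0"
    "\<forall>\<^sub>F z in nhds p. odp_model (\<xi> z) = a z * f z" "f p = 0" "(f has_derivative (\<lambda>v. 0)) (at p)"
proof -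
  obtain \<phi> \<psi> :: "complex ^ 'd \<Rightarrow> complex ^ 'd" where hol: "holo_map_germ \<phi> p" "holo_map_germ \<psi> 0" and pt: "\<phi> p = 0" "\<psi> 0 = p"
    and id1: "in_germ_ideal f p (\<lambda>z. odp_model (\<phi> z))" and id2: "in_germ_ideal odp_model 0 (\<lambda>w. f (\<psi> w))"
    and id3: "\<And>j. in_germ_ideal odp_model 0 (\<lambda>w. \<phi> (\<psi> w) $ j - w $ j)"
  proof -
    obtain V W \<phi> \<psi> where H: "open V \<and> p \<in> V \<and> open W \<and> 0 \<in> W \<and> holo_map_on \<phi> V \<and>
        holo_map_on \<psi> W \<and> \<phi> p = 0 \<and> \<psi> 0 = p \<and>
        in_germ_ideal f p (\<lambda>z. odp_model (\<phi> z)) \<and> in_germ_ideal odp_model 0 (\<lambda>w. f (\<psi> w)) \<and>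
        (\<forall>i. in_germ_ideal f p (\<lambda>z. \<psi> (\<phi> z) $ i - z $ i)) \<and>
        (\<forall>j. in_germ_ideal (odp_model :: complex ^ 'd \<Rightarrow> complex) 0 (\<lambda>w. \<phi> (\<psi> w) $ j - w $ j))"
      using iso unfolding germ_iso_def by (elim exE) (rule that)
    show thesis
    proof (rule that [of \<phi> \<psi>])
      show "holo_map_germ \<phi> p" "holo_map_germ \<psi> 0" using H unfolding holo_map_germ_iff by blast+
    qed (use H in simp_all)
  qed
  obtain A where A: "(\<phi> has_derivative A) (at p)" "\<And>c v. A (c *s v) = c *s A v"
    using cx_diff_vec [of \<phi> p] hol(1) holo_germ_cx_diff unfolding holo_map_germ_def by metis
  obtain B where B: "(\<psi> has_derivative B) (at 0)" "\<And>c v. B (c *s v) = c *s B v"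
    using cx_diff_vec [of \<psi> 0] hol(2) holo_germ_cx_diff unfolding holo_map_germ_def by metis
  obtain a where a: "holo_germ a p" "\<forall>\<^sub>F z in nhds p. odp_model (\<phi> z) = a z * f z"
    using id1 by (rule in_germ_idealE)
  obtain b where b: "holo_germ b 0" "\<forall>\<^sub>F w in nhds 0. f (\<psi> w) = b w * odp_model w"
    using id2 by (rule in_germ_idealE)
  have fp: "f p = 0" using eventually_nhds_x_imp_x [OF b(2)] pt by simp
  have AB: "A (B v) = v" for v
  proof -
    have "A (B v) $ j - v $ j = 0" for j
    proof -
      obtain c where c: "holo_germ c 0" "\<forall>\<^sub>F w in nhds 0. \<phi> (\<psi> w) $ j - w $ j = c w * odp_model w"
        using id3 by (rule in_germ_idealE)
      have "((\<lambda>w. \<phi> (\<psi> w)) has_derivative (\<lambda>v. A (B v))) (at 0)"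
        by (rule has_derivative_compose [OF B(1)]) (simp add: A(1) pt)
      then have "((\<lambda>w. \<phi> (\<psi> w) $ j - w $ j) has_derivative (\<lambda>v. A (B v) $ j - v $ j)) (at 0)"
        by (intro has_derivative_diff has_derivative_vec_nth bounded_linear.has_derivative [OF bounded_linear_vec_nth])
      moreover have "((\<lambda>w. \<phi> (\<psi> w) $ j - w $ j) has_derivative (\<lambda>v. 0)) (at 0)"
        by (rule has_derivative_cong_nhds [OF has_derivative_mult_odp_model [OF holo_germ_cx_diff [OF c(1)]]])
          (use c(2) in \<open>simp add: eq_commute\<close>)
      ultimately have "(\<lambda>v. A (B v) $ j - v $ j) = (\<lambda>v. 0)" by (rule has_derivative_unique)
      then show ?thesis by (rule fun_cong)
    qed
    then show ?thesis by (simp add: vec_eq_iff)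
  qed
  have lin: "linear A" "linear B" using A(1) B(1) has_derivative_linear by blast+
  have BA: "B (A v) = v" for v
    using linear_inverse_left [OF lin] AB by (metis comp_apply eq_id_iff ext id_apply)
  obtain F where F: "(f has_derivative F) (at p)" "\<And>c v. F (c *s v) = c * F v"
    using holo_germ_cx_diff [OF f] unfolding cx_diff_def by blast
  have "((\<lambda>w. f (\<psi> w)) has_derivative (\<lambda>v. F (B v))) (at 0)"
    by (rule has_derivative_compose [OF B(1)]) (simp add: F(1) pt)
  moreover have "((\<lambda>w. f (\<psi> w)) has_derivative (\<lambda>v. 0)) (at 0)"
    by (rule has_derivative_cong_nhds [OF has_derivative_mult_odp_model [OF holo_germ_cx_diff [OF b(1)]]])
      (use b(2) in \<open>simp add: eq_commute\<close>)
  ultimately have FB: "(\<lambda>v. F (B v)) = (\<lambda>v. 0)" by (rule has_derivative_unique)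
  have F0: "F v = 0" for v using fun_cong [OF FB, of "A v"] BA by simp
  have "a p \<noteq> 0"
  proof
    assume ap: "a p = 0"
    obtain i :: 'd where True by blast
    \<comment> \<open>Divide \<open>odp_model (\<phi> z) = a z * f z\<close> by \<open>x\<^sup>2\<close> along the line \<open>z = p + x v\<close> and let \<open>x\<close> tend to
      \<open>0\<close>. The left hand side tends to the quadratic form of \<open>A v\<close>, a unit vector, hence to \<open>1\<close>.\<close>
    define v where "v = B (axis i 1)"
    obtain A' where A': "(a has_derivative A') (at p)" "\<And>c v. A' (c *s v) = c * A' v"
      using holo_germ_cx_diff [OF a(1)] unfolding cx_diff_def by blast
    have 1: "((\<lambda>x. a (p + x *s v) / x) \<longlongrightarrow> A' v) (at 0)"
      using has_field_derivative_line [OF A', of v] by (simp add: DERIV_def ap)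
    have 2: "((\<lambda>x. f (p + x *s v) / x) \<longlongrightarrow> 0) (at 0)"
      using has_field_derivative_line [OF F, of v] by (simp add: DERIV_def fp F0)
    have "((\<lambda>x. \<phi> (p + x *s v) $ j / x) \<longlongrightarrow> A v $ j) (at 0)" for j
    proof -
      have "((\<lambda>z. \<phi> z $ j) has_derivative (\<lambda>v. A v $ j)) (at p)"
        by (rule bounded_linear.has_derivative [OF bounded_linear_vec_nth A(1)])
      from has_field_derivative_line [OF this, of v] show ?thesis by (simp add: DERIV_def pt A(2))
    qed
    then have "((\<lambda>x. \<Sum>j\<in>UNIV. (\<phi> (p + x *s v) $ j / x)\<^sup>2) \<longlongrightarrow> (\<Sum>j\<in>UNIV. (A v $ j)\<^sup>2)) (at 0)"
      by (intro tendsto_sum tendsto_power)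
    moreover have "(\<Sum>j\<in>UNIV. (A v $ j)\<^sup>2) = 1"
      by (simp add: v_def AB axis_def if_distrib if_distribR cong: if_cong)
    moreover have "\<forall>\<^sub>F x in at 0. a (p + x *s v) / x * (f (p + x *s v) / x) =
        (\<Sum>j\<in>UNIV. (\<phi> (p + x *s v) $ j / x)\<^sup>2)"
    proof -
      have "\<forall>\<^sub>F x in nhds 0. odp_model (\<phi> (p + x *s v)) = a (p + x *s v) * f (p + x *s v)"
        using eventually_nhds_isCont [OF isCont_line [where p = p and v = v and y = 0]] a(2) by simp
      then have "\<forall>\<^sub>F x in at 0. odp_model (\<phi> (p + x *s v)) = a (p + x *s v) * f (p + x *s v)"
        by (simp add: eventually_nhds_conv_at)
      then show ?thesis
        by eventually_elim (simp add: odp_model_def power_divide sum_divide_distrib [symmetric] power2_eq_square)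
    qed
    ultimately have "((\<lambda>x. a (p + x *s v) / x * (f (p + x *s v) / x)) \<longlongrightarrow> 1) (at 0)"
      by (simp add: tendsto_cong)
    moreover have "((\<lambda>x. a (p + x *s v) / x * (f (p + x *s v) / x)) \<longlongrightarrow> A' v * 0) (at 0)"
      by (rule tendsto_mult [OF 1 2])
    ultimately have "1 = A' v * 0"
      by (rule tendsto_unique [OF trivial_limit_at])
    then show False by simp
  qed
  moreover have "v = 0" if "A v = 0" for v
    using BA [of v] that linear_0 [OF lin(2)] by simp
  moreover have "(f has_derivative (\<lambda>v. 0)) (at p)" using F(1) F0 by (simp add: ext [of F "\<lambda>_. 0"])
  ultimately show thesis using that [of \<phi> A a] hol(1) pt(1) A(1) a fp by blast
qed



section \<open>The Morse lemma with a parameter\<close>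

text \<open>A function \<open>g\<close> with \<open>g (zero_coords S z) = g z\<close> for all \<open>z\<close> is one that does not depend on the
  coordinates in \<open>S\<close>.\<close>

definition zero_coords :: "'a::finite set \<Rightarrow> complex ^ 'a \<Rightarrow> complex ^ 'a" where
  "zero_coords S z = (\<chi> j. if j \<in> S then 0 else z $ j)"

lemma zero_coords_nth [simp]: "zero_coords S z $ j = (if j \<in> S then 0 else z $ j)"
  by (simp add: zero_coords_def)

lemma holo_map_germ_zero_coords: "holo_map_germ (zero_coords S) p"
  unfolding holo_map_germ_def
proof
  fix j show "holo_germ (\<lambda>z. zero_coords S z $ j) p" by (cases "j \<in> S") simp_all
qed

lemma zero_coords_0 [simp]: "zero_coords S 0 = 0"
  by (simp add: vec_eq_iff)

lemma with_coord_0_0 [simp]: "with_coord i 0 0 = 0"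
  by (simp add: vec_eq_iff)

lemma eventually_nhds_0_map:
  assumes "holo_map_germ \<Phi> 0" "\<Phi> 0 = 0" "\<forall>\<^sub>F z in nhds 0. P z"
  shows "\<forall>\<^sub>F z in nhds 0. P (\<Phi> z)"
  using eventually_nhds_holo_map_germ assms by blast

text \<open>On the hyperplane \<open>z\<^sub>k = 0\<close> the map is multiplication by \<open>c\<close>, and it preserves the coordinate
  \<open>z\<^sub>k\<close>, so its derivative is injective. All coordinate changes of the Morse lemma have this form: they
  are known explicitly at parameter \<open>z\<^sub>k = 0\<close> and leave the parameter alone.\<close>

lemma holo_slice_inverse:
  fixes \<Theta> :: "complex ^ 'a::finite \<Rightarrow> complex ^ 'a"
  assumes hol: "holo_map_germ \<Theta> 0"
    and slice: "\<forall>\<^sub>F z in nhds 0. z $ k = 0 \<longrightarrow> \<Theta> z = c *s z"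
    and keep: "\<forall>\<^sub>F z in nhds 0. \<Theta> z $ k = z $ k" and "c \<noteq> 0"
  obtains \<Psi> where "biholo_germ \<Theta> \<Psi> 0 0"
proof -
  obtain D where D: "(\<Theta> has_derivative D) (at 0)" "\<And>c v. D (c *s v) = c *s D v"
    using cx_diff_vec [of \<Theta> 0] hol holo_germ_cx_diff unfolding holo_map_germ_def by metis
  have Dj: "((\<lambda>z. \<Theta> z $ j) has_derivative (\<lambda>v. D v $ j)) (at 0)" for j
    by (rule bounded_linear.has_derivative [OF bounded_linear_vec_nth D(1)])
  have Dk: "D v $ k = v $ k" for v
  proof -
    have "((\<lambda>z. z $ k) has_derivative (\<lambda>v. D v $ k)) (at 0)"
      by (rule has_derivative_cong_nhds [OF Dj keep])
    from has_derivative_unique [OF this has_derivative_vec_nth] show ?thesis by (rule fun_cong)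
  qed
  have "v = 0" if "D v = 0" for v
  proof -
    have vk: "v $ k = 0" using Dk [of v] that by simp
    have "c * v $ j = 0" for j
    proof -
      have der: "((\<lambda>x. \<Theta> (0 + x *s v) $ j) has_field_derivative D v $ j) (at 0)"
        by (rule has_field_derivative_line [OF Dj]) (simp add: D(2))
      have ev: "\<forall>\<^sub>F x in nhds 0. \<Theta> (0 + x *s v) $ j = c * v $ j * x"
      proof -
        have "\<forall>\<^sub>F x in nhds 0. (0 + x *s v) $ k = 0 \<longrightarrow> \<Theta> (0 + x *s v) = c *s (0 + x *s v)"
          by (rule eventually_nhds_isCont [OF isCont_line, where P = "\<lambda>w. w $ k = 0 \<longrightarrow> \<Theta> w = c *s w"])
            (use slice in simp)
        then show ?thesis by (rule eventually_mono) (simp add: vk)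
      qed
      have "((\<lambda>x. c * v $ j * x) has_field_derivative D v $ j) (at 0)"
        by (rule iffD1 [OF DERIV_cong_ev [OF refl ev refl] der])
      moreover have "((\<lambda>x. c * v $ j * x) has_field_derivative c * v $ j) (at 0)"
        by (auto intro!: derivative_eq_intros)
      ultimately show ?thesis using DERIV_unique that by fastforce
    qed
    then show "v = 0" using \<open>c \<noteq> 0\<close> by (simp add: vec_eq_iff)
  qed
  then obtain \<Psi> where "biholo_germ \<Theta> \<Psi> 0 (\<Theta> 0)"
    using holo_inverse_function [OF hol D(1)] by blast
  moreover have "\<Theta> 0 = 0" using eventually_nhds_x_imp_x [OF slice] by simp
  ultimately show thesis using that by simp
qed

lemma zero_coords_with_coord:
  "i \<notin> S \<Longrightarrow> zero_coords S (with_coord i x z) = with_coord i x (zero_coords S z)"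
  by (auto simp: vec_eq_iff)

lemma cx_partial_zero_coords:
  assumes "i \<notin> S" "\<And>z. g (zero_coords S z) = g z"
  shows "cx_partial i g (zero_coords S z) = cx_partial i g z"
proof -
  have "g (with_coord i x (zero_coords S z)) = g (with_coord i x z)" for x
    using assms(2) [of "with_coord i x z"] by (simp add: zero_coords_with_coord [OF assms(1)])
  then show ?thesis using assms(1) by (simp add: cx_partial_def)
qed

lemma isCont_with_coord: "isCont (\<lambda>x. with_coord i x z) y"
  by (rule has_derivative_continuous [OF has_derivative_with_coord])

lemma cx_partial_slice:
  fixes g :: "complex ^ 'a::finite \<Rightarrow> complex"
  assumes "\<forall>\<^sub>F z in nhds 0. z $ k = 0 \<longrightarrow> g z = (\<Sum>j\<in>A. (z $ j)\<^sup>2)" "i \<in> A" "i \<noteq> k"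
  shows "\<forall>\<^sub>F z in nhds 0. z $ k = 0 \<longrightarrow> cx_partial i g z = 2 * z $ i"
proof -
  have "\<forall>\<^sub>F z in nhds 0. \<forall>\<^sub>F w in nhds z. w $ k = 0 \<longrightarrow> g w = (\<Sum>j\<in>A. (w $ j)\<^sup>2)"
    using assms(1) by (simp add: eventually_eventually)
  then show ?thesis
  proof (rule eventually_mono, intro impI)
    fix z :: "complex ^ 'a"
    assume ev: "\<forall>\<^sub>F w in nhds z. w $ k = 0 \<longrightarrow> g w = (\<Sum>j\<in>A. (w $ j)\<^sup>2)" and zk: "z $ k = 0"
    have "\<forall>\<^sub>F x in nhds (z $ i). with_coord i x z $ k = 0 \<longrightarrow>
        g (with_coord i x z) = (\<Sum>j\<in>A. (with_coord i x z $ j)\<^sup>2)"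
      by (rule eventually_nhds_isCont [OF isCont_with_coord,
            where P = "\<lambda>w. w $ k = 0 \<longrightarrow> g w = (\<Sum>j\<in>A. (w $ j)\<^sup>2)"])
        (use ev in simp)
    then have "\<forall>\<^sub>F x in nhds (z $ i). g (with_coord i x z) = x\<^sup>2 + (\<Sum>j\<in>A - {i}. (z $ j)\<^sup>2)"
    proof (rule eventually_mono)
      fix x assume *: "with_coord i x z $ k = 0 \<longrightarrow>
        g (with_coord i x z) = (\<Sum>j\<in>A. (with_coord i x z $ j)\<^sup>2)"
      then have "g (with_coord i x z) = (\<Sum>j\<in>A. (with_coord i x z $ j)\<^sup>2)"
        using zk \<open>i \<noteq> k\<close> by simp
      also have "\<dots> = x\<^sup>2 + (\<Sum>j\<in>A - {i}. (with_coord i x z $ j)\<^sup>2)"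
        using \<open>i \<in> A\<close> by (subst sum.remove [of A i]) auto
      also have "(\<Sum>j\<in>A - {i}. (with_coord i x z $ j)\<^sup>2) = (\<Sum>j\<in>A - {i}. (z $ j)\<^sup>2)"
        by (rule sum.cong) auto
      finally show "g (with_coord i x z) = x\<^sup>2 + (\<Sum>j\<in>A - {i}. (z $ j)\<^sup>2)" .
    qed
    then have "cx_partial i g z = deriv (\<lambda>x. x\<^sup>2 + (\<Sum>j\<in>A - {i}. (z $ j)\<^sup>2)) (z $ i)"
      unfolding cx_partial_def by (rule deriv_cong_ev) simp
    also have "\<dots> = 2 * z $ i"
      by (rule DERIV_imp_deriv) (auto intro!: derivative_eq_intros)
    finally show "cx_partial i g z = 2 * z $ i" .
  qed
qed

text \<open>The implicit function theorem for the equation \<open>\<partial>\<^sub>ig = 0\<close>, with the coordinate \<open>z\<^sub>i\<close> as the unknown.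
  The solution depends neither on \<open>z\<^sub>i\<close> nor on the coordinates in \<open>S\<close>, on which \<open>g\<close> does not depend,
  and it is zero where the parameter \<open>z\<^sub>k\<close> is zero, because \<open>g\<close> is a sum of squares there.\<close>

lemma critical_coordinate:
  fixes g :: "complex ^ 'a::finite \<Rightarrow> complex"
  assumes "i \<noteq> k" "i \<notin> S" "k \<notin> S" and hol: "holo_germ g 0"
    and indep: "\<And>z. g (zero_coords S z) = g z"
    and slice: "\<forall>\<^sub>F z in nhds 0. z $ k = 0 \<longrightarrow> g z = (\<Sum>j\<in>A. (z $ j)\<^sup>2)" and "i \<in> A"
  obtains c :: "complex ^ 'a \<Rightarrow> complex" where "holo_germ c 0" "\<And>z. c (zero_coords (insert i S) z) = c z"
    "\<forall>\<^sub>F z in nhds 0. cx_partial i g (with_coord i (c z) z) = 0"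
    "\<forall>\<^sub>F z in nhds 0. z $ k = 0 \<longrightarrow> c z = 0"
proof -
  define p where "p = cx_partial i g"
  \<comment> \<open>\<open>K\<close> replaces the coordinate \<open>z\<^sub>i\<close> by the function whose zeros are sought. On \<open>z\<^sub>k = 0\<close> the partial
    derivative is \<open>2 z\<^sub>i\<close>, and the factor \<open>1 / 2\<close> makes \<open>K\<close> the identity there.\<close>
  define K where "K z = with_coord i (p z / 2) z" for z
  define Z where "Z = zero_coords (insert i S)"
  have Z0: "Z 0 = 0" "holo_map_germ Z p" for p by (simp_all add: Z_def holo_map_germ_zero_coords)
  have pS: "p (zero_coords S z) = p z" for z
    unfolding p_def by (rule cx_partial_zero_coords) (use assms(2) indep in simp_all)
  have pslice: "\<forall>\<^sub>F z in nhds 0. z $ k = 0 \<longrightarrow> p z = 2 * z $ i"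
    unfolding p_def by (rule cx_partial_slice [OF slice \<open>i \<in> A\<close> \<open>i \<noteq> k\<close>])
  have holp: "holo_germ p 0" unfolding p_def by (rule holo_germ_partial [OF hol])
  have holK: "holo_map_germ K 0"
    unfolding K_def by (rule holo_map_germ_with_coord) (rule holo_germ_divide, simp_all add: holp)
  have Kslice: "\<forall>\<^sub>F z in nhds 0. z $ k = 0 \<longrightarrow> K z = 1 *s z"
    using pslice by (rule eventually_mono) (simp add: K_def)
  have "\<forall>\<^sub>F z in nhds 0. K z $ k = z $ k" using \<open>i \<noteq> k\<close> by (simp add: K_def)
  from holo_slice_inverse [OF holK Kslice this] obtain \<Psi> where "biholo_germ K \<Psi> 0 0" by auto
  then have \<Psi>: "holo_map_germ \<Psi> 0" "\<Psi> 0 = 0"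
    "\<forall>\<^sub>F z in nhds 0. \<Psi> (K z) = z" "\<forall>\<^sub>F z in nhds 0. K (\<Psi> z) = z"
    unfolding biholo_germ_def by blast+
  define c where "c z = \<Psi> (Z z) $ i" for z
  have "holo_map_germ (\<lambda>z. \<Psi> (Z z)) 0"
    using holo_map_germ_compose [of \<Psi> Z 0] by (simp add: Z0 \<Psi>)
  then have 1: "holo_germ c 0" unfolding c_def holo_map_germ_def by blast
  have 2: "c (zero_coords (insert i S) z) = c z" for z
  proof -
    have "Z (Z z) = Z z" by (simp add: Z_def vec_eq_iff)
    then show ?thesis by (simp add: c_def Z_def)
  qed
  have "\<forall>\<^sub>F z in nhds 0. K (\<Psi> (Z z)) = Z z"
    using eventually_nhds_0_map [OF Z0(2) Z0(1) \<Psi>(4)] .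
  then have 3: "\<forall>\<^sub>F z in nhds 0. p (with_coord i (c z) z) = 0"
  proof (rule eventually_mono)
    fix z assume K: "K (\<Psi> (Z z)) = Z z"
    have Kj: "(if j = i then p (\<Psi> (Z z)) / 2 else \<Psi> (Z z) $ j) = Z z $ j" for j
      using arg_cong [OF K, of "\<lambda>u. u $ j"] by (simp add: K_def)
    have "\<Psi> (Z z) = zero_coords S (with_coord i (c z) z)"
      unfolding vec_eq_iff
    proof
      fix j show "\<Psi> (Z z) $ j = zero_coords S (with_coord i (c z) z) $ j"
        using Kj [of j] \<open>i \<notin> S\<close> by (auto simp: c_def Z_def split: if_splits)
    qed
    then have "p (with_coord i (c z) z) = p (\<Psi> (Z z))" by (simp add: pS)
    also have "\<dots> = 0" using Kj [of i] by (simp add: Z_def)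
    finally show "p (with_coord i (c z) z) = 0" .
  qed
  have "\<forall>\<^sub>F z in nhds 0. \<Psi> (K (Z z)) = Z z" "\<forall>\<^sub>F z in nhds 0. Z z $ k = 0 \<longrightarrow> K (Z z) = 1 *s Z z"
    using eventually_nhds_0_map [OF Z0(2) Z0(1) \<Psi>(3)] eventually_nhds_0_map [OF Z0(2) Z0(1) Kslice] .
  then have 4: "\<forall>\<^sub>F z in nhds 0. z $ k = 0 \<longrightarrow> c z = 0"
  proof eventually_elim
    case (elim z)
    show ?case
    proof
      assume "z $ k = 0"
      then have "Z z $ k = 0" by (simp add: Z_def)
      then have "\<Psi> (Z z) = Z z" using elim by simp
      then show "c z = 0" by (simp add: c_def Z_def)
    qed
  qed
  show thesis using that 1 2 3 [unfolded p_def] 4 by blast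
qed


text \<open>Translate \<open>z\<^sub>i\<close> by the critical coordinate \<open>c\<close>, so that \<open>\<partial>\<^sub>ig\<close> vanishes on the hyperplane
  \<open>z\<^sub>i = 0\<close>. Then \<open>g\<close> equals its restriction to that hyperplane plus \<open>z\<^sub>i\<^sup>2 q\<close>. At parameter \<open>0\<close>
  the factor \<open>q\<close> is \<open>1\<close>, so it has a holomorphic square root, which is absorbed in the new coordinate
  \<open>v\<close>. The remaining term does not depend on \<open>z\<^sub>i\<close> any more and is again a sum of squares at
  parameter \<open>0\<close>, so the step can be repeated.\<close>

lemma split_square:
  fixes g :: "complex ^ 'a::finite \<Rightarrow> complex"
  assumes "i \<noteq> k" "i \<notin> S" "k \<notin> S" and hol: "holo_germ g 0"
    and indep: "\<And>z. g (zero_coords S z) = g z"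
    and slice: "\<forall>\<^sub>F z in nhds 0. z $ k = 0 \<longrightarrow> g z = (\<Sum>j\<in>A. (z $ j)\<^sup>2)" and "i \<in> A"
  obtains v g' :: "complex ^ 'a \<Rightarrow> complex" where "holo_germ v 0" "holo_germ g' 0"
    "\<forall>\<^sub>F z in nhds 0. g z = (v z)\<^sup>2 + g' z"
    "\<And>z. g' (zero_coords (insert i S) z) = g' z"
    "\<forall>\<^sub>F z in nhds 0. z $ k = 0 \<longrightarrow> v z = z $ i"
    "\<forall>\<^sub>F z in nhds 0. z $ k = 0 \<longrightarrow> g' z = (\<Sum>j\<in>A - {i}. (z $ j)\<^sup>2)"
proof -
  obtain c where c: "holo_germ c 0" "\<And>z. c (zero_coords (insert i S) z) = c z"
    "\<forall>\<^sub>F z in nhds 0. cx_partial i g (with_coord i (c z) z) = 0"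
    "\<forall>\<^sub>F z in nhds 0. z $ k = 0 \<longrightarrow> c z = 0"
    using critical_coordinate [where g = g, OF assms] by blast
  have c_with: "c (with_coord i x z) = c z" for x z
  proof -
    have "zero_coords (insert i S) (with_coord i x z) = zero_coords (insert i S) z"
      by (auto simp: vec_eq_iff)
    then show ?thesis using c(2) by metis
  qed
  have c0: "c 0 = 0" using eventually_nhds_x_imp_x [OF c(4)] by simp
  define T where "T z = with_coord i (z $ i + c z) z" for z
  define T' where "T' z = with_coord i (z $ i - c z) z" for z
  have T0: "T 0 = 0" "T' 0 = 0" by (simp_all add: T_def T'_def c0)
  have TT': "T (T' z) = z" for z by (simp add: T_def T'_def c_with)
  have holT: "holo_map_germ T 0" "holo_map_germ T' 0"
    unfolding T_def T'_def
    by (intro holo_map_germ_with_coord holo_germ_add holo_germ_diff holo_germ_nth c(1))+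
  define h where "h z = g (T z)" for z
  have holh: "holo_germ h 0"
    unfolding h_def by (rule holo_germ_compose [OF _ holT(1)]) (simp add: hol T0)
  have hol_c: "holo_map_germ (\<lambda>z. with_coord i (c z) z) 0" by (rule holo_map_germ_with_coord [OF c(1)])
  have hol_0: "holo_map_germ (with_coord i 0) 0"
    using holo_map_germ_with_coord [of "\<lambda>_. 0" 0 i] by simp
  have g_diff: "\<forall>\<^sub>F z in nhds 0. cx_diff g (with_coord i (c z) z)"
    by (rule eventually_nhds_0_map [OF hol_c]) (use hol in \<open>simp_all add: c0 holo_germ_def\<close>)
  have h_with: "h (with_coord i x z) = g (with_coord i (x + c z) z)" for x z
    by (simp add: h_def T_def c_with)
  have "\<forall>\<^sub>F z in nhds 0. cx_partial i h (with_coord i 0 z) = 0"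
    using g_diff c(3)
  proof eventually_elim
    case (elim z)
    have "((\<lambda>x. g (with_coord i x z)) has_field_derivative 0) (at (0 + c z))"
      using has_field_derivative_cx_partial [OF elim(1)] elim(2) by simp
    then have "((\<lambda>x. h (with_coord i x z)) has_field_derivative 0) (at 0)"
      unfolding h_with DERIV_shift .
    then show ?case unfolding cx_partial_def by (simp add: DERIV_imp_deriv)
  qed
  from Hadamard_division_square [OF holh this] obtain q where q: "holo_germ q 0"
    "\<forall>\<^sub>F z in nhds 0. h z = h (with_coord i 0 z) + (z $ i)\<^sup>2 * q z" by blast
  have "\<forall>\<^sub>F z in nhds 0. T z $ k = 0 \<longrightarrow> g (T z) = (\<Sum>j\<in>A. (T z $ j)\<^sup>2)"
    by (rule eventually_nhds_0_map [OF holT(1) T0(1) slice])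
  then have h_slice: "\<forall>\<^sub>F z in nhds 0. z $ k = 0 \<longrightarrow> h z = (\<Sum>j\<in>A. (z $ j)\<^sup>2)"
    using c(4) by eventually_elim (use \<open>i \<noteq> k\<close> in \<open>auto simp: h_def T_def\<close>)
  have drop: "(\<Sum>j\<in>A. (with_coord i 0 z $ j)\<^sup>2) = (\<Sum>j\<in>A - {i}. (z $ j)\<^sup>2)" for z :: "complex ^ 'a"
    using \<open>i \<in> A\<close> by (subst sum.remove [of A i]) (auto intro: sum.cong)
  have h_slice0: "\<forall>\<^sub>F z in nhds 0. with_coord i 0 z $ k = 0 \<longrightarrow>
      h (with_coord i 0 z) = (\<Sum>j\<in>A. (with_coord i 0 z $ j)\<^sup>2)"
    by (rule eventually_nhds_0_map [OF hol_0 _ h_slice]) simp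
  have q_slice: "\<forall>\<^sub>F z in nhds 0. z $ k = 0 \<longrightarrow> z $ i \<noteq> 0 \<longrightarrow> q z = 1"
    using q(2) h_slice h_slice0
  proof eventually_elim
    case (elim z)
    show ?case
    proof (intro impI)
      assume z: "z $ k = 0" "z $ i \<noteq> 0"
      have "(\<Sum>j\<in>A. (z $ j)\<^sup>2) = (\<Sum>j\<in>A - {i}. (z $ j)\<^sup>2) + (z $ i)\<^sup>2 * q z"
        using elim z \<open>i \<noteq> k\<close> drop [of z] by simp
      then have "(z $ i)\<^sup>2 * q z = (z $ i)\<^sup>2"
        using \<open>i \<in> A\<close> by (subst (asm) sum.remove [of A i]) auto
      then show "q z = 1" using z by simp
    qed
  qed
  \<comment> \<open>The equation determines \<open>q\<close> only where \<open>z\<^sub>i \<noteq> 0\<close>; the origin is reached by continuity along the \<open>i\<close>-th axis.\<close>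
  have "q 0 = 1"
  proof -
    have "isCont (\<lambda>x. with_coord i x 0) 0" by (rule isCont_with_coord)
    then have "isCont (\<lambda>x. q (with_coord i x 0)) 0"
      by (rule isCont_o2) (simp add: holo_germ_isCont [OF q(1)])
    then have "((\<lambda>x. q (with_coord i x 0)) \<longlongrightarrow> q 0) (at 0)" by (simp add: isCont_def)
    moreover have "\<forall>\<^sub>F x in nhds 0. with_coord i x 0 $ k = 0 \<longrightarrow> with_coord i x 0 $ i \<noteq> 0 \<longrightarrow> q (with_coord i x 0) = 1"
      by (rule eventually_nhds_isCont [OF isCont_with_coord, where P = "\<lambda>z. z $ k = 0 \<longrightarrow> z $ i \<noteq> 0 \<longrightarrow> q z = 1"])
        (use q_slice in simp)
    then have "\<forall>\<^sub>F x in at 0. q (with_coord i x 0) = 1"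
      unfolding eventually_at_filter by (rule eventually_mono) (use \<open>i \<noteq> k\<close> in simp)
    then have "((\<lambda>x. q (with_coord i x 0)) \<longlongrightarrow> 1) (at 0)" by (rule tendsto_eventually)
    ultimately show ?thesis by (rule tendsto_unique [OF trivial_limit_at])
  qed
  define v where "v z = (z $ i - c z) * csqrt (q (T' z))" for z
  define g' where "g' z = g (with_coord i (c z) z)" for z
  have hol_qT': "holo_germ (\<lambda>z. q (T' z)) 0"
    by (rule holo_germ_compose [OF _ holT(2)]) (simp add: q(1) T0)
  have "holo_germ (\<lambda>z. csqrt (q (T' z))) 0"
    by (rule holo_germ_holomorphic_compose [OF holomorphic_on_csqrt _ _ hol_qT'])
      (simp_all add: T0 \<open>q 0 = 1\<close> open_Compl)
  then have 1: "holo_germ v 0"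
    unfolding v_def by (intro holo_germ_mult holo_germ_diff holo_germ_nth c(1))
  have 2: "holo_germ g' 0"
    unfolding g'_def by (rule holo_germ_compose [OF _ hol_c]) (simp add: hol c0)
  have "\<forall>\<^sub>F z in nhds 0. h (T' z) = h (with_coord i 0 (T' z)) + (T' z $ i)\<^sup>2 * q (T' z)"
    by (rule eventually_nhds_0_map [OF holT(2) T0(2) q(2)])
  then have 3: "\<forall>\<^sub>F z in nhds 0. g z = (v z)\<^sup>2 + g' z"
  proof (rule eventually_mono)
    fix z assume *: "h (T' z) = h (with_coord i 0 (T' z)) + (T' z $ i)\<^sup>2 * q (T' z)"
    have "h (T' z) = g z" by (simp add: h_def TT')
    moreover have "h (with_coord i 0 (T' z)) = g' z" by (simp add: T'_def h_with g'_def)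
    moreover have "(T' z $ i)\<^sup>2 * q (T' z) = (v z)\<^sup>2" by (simp add: v_def power_mult_distrib T'_def)
    ultimately show "g z = (v z)\<^sup>2 + g' z" using * by (simp add: add.commute)
  qed
  have 4: "g' (zero_coords (insert i S) z) = g' z" for z
  proof -
    have "with_coord i (c z) (zero_coords (insert i S) z) = zero_coords S (with_coord i (c z) z)"
      using \<open>i \<notin> S\<close> by (auto simp: vec_eq_iff)
    then show ?thesis by (simp add: g'_def c(2) indep)
  qed
  have 5: "\<forall>\<^sub>F z in nhds 0. z $ k = 0 \<longrightarrow> v z = z $ i"
    using c(4) q_slice by eventually_elim (auto simp: v_def T'_def)
  have "\<forall>\<^sub>F z in nhds 0. with_coord i 0 z $ k = 0 \<longrightarrow>
      g (with_coord i 0 z) = (\<Sum>j\<in>A. (with_coord i 0 z $ j)\<^sup>2)"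
    by (rule eventually_nhds_0_map [OF hol_0 _ slice]) simp
  then have 6: "\<forall>\<^sub>F z in nhds 0. z $ k = 0 \<longrightarrow> g' z = (\<Sum>j\<in>A - {i}. (z $ j)\<^sup>2)"
    using c(4)
  proof eventually_elim
    case (elim z)
    then show ?case using \<open>i \<noteq> k\<close> drop [of z] by (auto simp: g'_def)
  qed
  show thesis by (rule that [OF 1 2 3 4 5 6])
qed

text \<open>The set \<open>S\<close> collects the coordinates whose squares have been split off already.\<close>

lemma split_squares:
  fixes G :: "complex ^ 'a::finite \<Rightarrow> complex"
  assumes hol: "holo_germ G 0" and slice: "\<forall>\<^sub>F z in nhds 0. z $ k = 0 \<longrightarrow> G z = (\<Sum>j\<in>-{k}. (z $ j)\<^sup>2)"
    and "k \<notin> S"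
  shows "\<exists>v g. (\<forall>j\<in>S. holo_germ (v j) 0 \<and> (\<forall>\<^sub>F z in nhds 0. z $ k = 0 \<longrightarrow> v j z = z $ j)) \<and>
    holo_germ g 0 \<and> (\<forall>\<^sub>F z in nhds 0. G z = (\<Sum>j\<in>S. (v j z)\<^sup>2) + g z) \<and>
    (\<forall>z. g (zero_coords S z) = g z) \<and>
    (\<forall>\<^sub>F z in nhds 0. z $ k = 0 \<longrightarrow> g z = (\<Sum>j\<in>- {k} - S. (z $ j)\<^sup>2))"
proof -
  have "finite S" by simp
  then show ?thesis using \<open>k \<notin> S\<close>
  proof (induction S rule: finite_induct)
    case empty
    have "zero_coords {} z = z" for z :: "complex ^ 'a" by (simp add: vec_eq_iff)
    then show ?case using hol slice by (intro exI [of _ "\<lambda>_ _. 0"] exI [of _ G]) simp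
  next
    case (insert i S)
    then obtain v g where v: "\<And>j. j \<in> S \<Longrightarrow> holo_germ (v j) 0"
        "\<And>j. j \<in> S \<Longrightarrow> \<forall>\<^sub>F z in nhds 0. z $ k = 0 \<longrightarrow> v j z = z $ j"
      and g: "holo_germ g 0" "\<forall>\<^sub>F z in nhds 0. G z = (\<Sum>j\<in>S. (v j z)\<^sup>2) + g z"
        "\<And>z. g (zero_coords S z) = g z"
        "\<forall>\<^sub>F z in nhds 0. z $ k = 0 \<longrightarrow> g z = (\<Sum>j\<in>- {k} - S. (z $ j)\<^sup>2)"
      by auto
    have i: "i \<noteq> k" "k \<notin> S" "i \<in> - {k} - S" using insert by auto
    obtain w g' where w: "holo_germ w 0" "holo_germ g' 0"
      "\<forall>\<^sub>F z in nhds 0. g z = (w z)\<^sup>2 + g' z"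
      "\<And>z. g' (zero_coords (insert i S) z) = g' z"
      "\<forall>\<^sub>F z in nhds 0. z $ k = 0 \<longrightarrow> w z = z $ i"
      "\<forall>\<^sub>F z in nhds 0. z $ k = 0 \<longrightarrow> g' z = (\<Sum>j\<in>- {k} - S - {i}. (z $ j)\<^sup>2)"
      using split_square [where g = g, OF i(1) \<open>i \<notin> S\<close> i(2) g(1) g(3) g(4) i(3)] by blast
    have sum: "(\<Sum>j\<in>insert i S. (((v(i := w)) j) z)\<^sup>2) = (w z)\<^sup>2 + (\<Sum>j\<in>S. (v j z)\<^sup>2)" for z
      using insert.hyps by (auto intro!: sum.cong)
    have "\<forall>\<^sub>F z in nhds 0. G z = (\<Sum>j\<in>insert i S. (((v(i := w)) j) z)\<^sup>2) + g' z"
      using g(2) w(3) unfolding sum by eventually_elim simp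
    moreover have "- {k} - S - {i} = - {k} - insert i S" by blast
    ultimately show ?case using v w
      by (intro exI [of _ "v(i := w)"] exI [of _ g']) auto
  qed
qed

text \<open>Once all squares are split off, the remaining term depends on the parameter \<open>z\<^sub>k\<close> only.\<close>

lemma Morse_with_parameter:
  fixes G :: "complex ^ 'a::finite \<Rightarrow> complex"
  assumes hol: "holo_germ G 0" and slice: "\<forall>\<^sub>F z in nhds 0. z $ k = 0 \<longrightarrow> G z = (\<Sum>j\<in>-{k}. (z $ j)\<^sup>2)"
  obtains v h r where "\<forall>j. j \<noteq> k \<longrightarrow> holo_germ (v j) 0 \<and>
      (\<forall>\<^sub>F z in nhds 0. z $ k = 0 \<longrightarrow> v j z = z $ j)"
    "r > 0" "h holomorphic_on ball 0 r"
    "\<forall>\<^sub>F z in nhds 0. G z = (\<Sum>j\<in>-{k}. (v j z)\<^sup>2) + h (z $ k)"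
proof -
  have "k \<notin> - {k}" by simp
  from split_squares [OF assms this] obtain v g where
    vg: "\<forall>j\<in>- {k}. holo_germ (v j) 0 \<and> (\<forall>\<^sub>F z in nhds 0. z $ k = 0 \<longrightarrow> v j z = z $ j)"
    and g: "holo_germ g 0" "\<forall>\<^sub>F z in nhds 0. G z = (\<Sum>j\<in>-{k}. (v j z)\<^sup>2) + g z"
      "\<forall>z. g (zero_coords (- {k}) z) = g z"
    by (elim exE conjE) (rule that)
  define h where "h x = g (with_coord k x 0)" for x
  have gh: "g z = h (z $ k)" for z
  proof -
    have "zero_coords (- {k}) z = with_coord k (z $ k) 0" by (simp add: vec_eq_iff)
    then show ?thesis using spec [OF g(3), of z] by (simp add: h_def)
  qed
  have "\<forall>\<^sub>F x in nhds 0. cx_diff g (with_coord k x 0)"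
    by (rule eventually_nhds_isCont [OF isCont_with_coord, where P = "cx_diff g"])
      (use g(1) in \<open>simp add: holo_germ_def\<close>)
  then obtain r where r: "r > 0" "\<And>x. x \<in> ball 0 r \<Longrightarrow> cx_diff g (with_coord k x 0)"
    unfolding eventually_nhds_metric by (auto simp: dist_commute)
  have "h holomorphic_on ball 0 r"
    unfolding holomorphic_on_def h_def
    by (rule ballI, rule field_differentiable_at_within [OF field_differentiable_with_coord [OF r(2)]])
  moreover have "\<forall>\<^sub>F z in nhds 0. G z = (\<Sum>j\<in>-{k}. (v j z)\<^sup>2) + h (z $ k)"
    using g(2) by (simp add: gh)
  ultimately show thesis using that [where v = v and r = r and h = h] vg r(1) by simp
qed


section \<open>Degenerating families\<close>

definition join :: "complex ^ 'd::finite \<Rightarrow> complex \<Rightarrow> complex ^ 'd option" where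
  "join w t = (\<chi> i. case i of None \<Rightarrow> t | Some j \<Rightarrow> w $ j)"

lemma join_nth [simp]: "join w t $ None = t" "join w t $ Some j = w $ j"
  by (simp_all add: join_def)

lemma space_part_nth [simp]: "space_part z $ j = z $ Some j"
  by (simp add: space_part_def)

lemma space_part_join [simp]: "space_part (join w t) = w"
  by (simp add: vec_eq_iff)

lemma vec_option_eq_iff:
  "z = w \<longleftrightarrow> z $ None = w $ None \<and> (\<forall>j. z $ Some j = w $ Some j)"
  for z w :: "complex ^ 'd::finite option"
  by (metis not_None_eq vec_eq_iff)

lemma join_space_part [simp]: "join (space_part z) (z $ None) = z"
  by (simp add: vec_option_eq_iff)

lemma sum_option: "(\<Sum>j\<in>- {None}. f j) = (\<Sum>j\<in>UNIV. f (Some j))" for f :: "'d::finite option \<Rightarrow> 'c::comm_monoid_add"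
proof -
  have "- {None :: 'd option} = range Some" by (metis UNIV_option_conv Diff_insert_absorb Compl_eq_Diff_UNIV None_notin_image_Some insert_def)
  then show ?thesis by (simp add: sum.reindex)
qed

lemma holo_map_germ_join:
  assumes "holo_map_germ X p" "holo_germ f p" shows "holo_map_germ (\<lambda>z. join (X z) (f z)) p"
  unfolding holo_map_germ_def
proof
  fix i show "holo_germ (\<lambda>z. join (X z) (f z) $ i) p"
    using assms unfolding holo_map_germ_def by (cases i) simp_all
qed

lemma holo_map_germ_space_part: "holo_map_germ space_part p"
  unfolding holo_map_germ_def by simp

lemma has_derivative_zero_mult:
  fixes f g :: "'b::real_normed_vector \<Rightarrow> complex"
  assumes "(f has_derivative D) (at p)" "(g has_derivative (\<lambda>v. 0)) (at p)" "g p = 0"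
  shows "((\<lambda>z. f z * g z) has_derivative (\<lambda>v. 0)) (at p)"
  using has_derivative_mult [OF assms(1,2)] assms(3) by simp

lemma has_derivative_sum_squares:
  fixes v :: "'j \<Rightarrow> complex ^ 'a::finite \<Rightarrow> complex"
  assumes "finite J" "\<And>j. j \<in> J \<Longrightarrow> cx_diff (v j) p" "\<And>j. j \<in> J \<Longrightarrow> v j p = 0"
  shows "((\<lambda>z. \<Sum>j\<in>J. (v j z)\<^sup>2) has_derivative (\<lambda>_. 0)) (at p)"
proof -
  have "((\<lambda>z. (v j z)\<^sup>2) has_derivative (\<lambda>_. 0)) (at p)" if j: "j \<in> J" for j
  proof -
    obtain D where D: "(v j has_derivative D) (at p)" using assms(2) [OF j] unfolding cx_diff_def by blast
    show ?thesis using has_derivative_mult [OF D D] assms(3) [OF j] by (simp add: power2_eq_square)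
  qed
  then have "((\<lambda>z. \<Sum>j\<in>J. (v j z)\<^sup>2) has_derivative (\<lambda>_. \<Sum>j\<in>J. 0)) (at p)"
    by (rule has_derivative_sum)
  then show ?thesis by simp
qed

lemma holo_germ_coordinate_compose:
  "h holomorphic_on ball 0 r \<Longrightarrow> r > 0 \<Longrightarrow> z $ k = 0 \<Longrightarrow> holo_germ (\<lambda>u. h (u $ k)) z"
  by (rule holo_germ_holomorphic_compose [of h "ball 0 r"]) simp_all

lemma eventually_nth_in_ball:
  assumes "r > 0" shows "\<forall>\<^sub>F z :: complex ^ 'a::finite in nhds 0. z $ k \<in> ball 0 r"
proof -
  have "\<forall>\<^sub>F t in nhds ((0 :: complex ^ 'a) $ k). t \<in> ball 0 r"
    by (rule eventually_nhds_in_open) (simp_all add: assms)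
  then show ?thesis by (rule eventually_nhds_isCont [OF holo_germ_isCont [OF holo_germ_nth]])
qed

text \<open>The quotient \<open>g / g 0\<close> is close to \<open>1\<close>, where the principal branch of the square root is
  holomorphic.\<close>

lemma square_root_germ:
  assumes "g holomorphic_on ball 0 r" "r > 0" "g 0 \<noteq> 0"
  obtains s \<rho> where "\<rho> > 0" "ball (0::complex) \<rho> \<subseteq> ball 0 r" "s holomorphic_on ball 0 \<rho>" "\<forall>t\<in>ball 0 \<rho>. (s t)\<^sup>2 = g t" "s 0 \<noteq> 0"
proof -
  have cont: "continuous_on (ball 0 r) (\<lambda>t. g t / g 0)"
    using holomorphic_on_imp_continuous_on [OF assms(1)] assms(3) by (auto intro!: continuous_intros)
  have op: "open (- \<real>\<^sub>\<le>\<^sub>0 :: complex set)" by (simp add: open_Compl)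
  have "open (ball 0 r \<inter> (\<lambda>t. g t / g 0) -` (- \<real>\<^sub>\<le>\<^sub>0))"
    by (rule continuous_open_preimage [OF cont open_ball op])
  moreover have "0 \<in> ball 0 r \<inter> (\<lambda>t. g t / g 0) -` (- \<real>\<^sub>\<le>\<^sub>0)" using assms by simp
  ultimately obtain \<rho> where \<rho>: "\<rho> > 0" "ball 0 \<rho> \<subseteq> ball 0 r \<inter> (\<lambda>t. g t / g 0) -` (- \<real>\<^sub>\<le>\<^sub>0)"
    by (rule openE)
  define s where "s t = csqrt (g 0) * csqrt (g t / g 0)" for t
  have "s holomorphic_on ball 0 \<rho>" unfolding s_def
    using \<rho>(2) assms
    by (intro holomorphic_intros holomorphic_on_subset [OF assms(1)]) auto
  moreover have "(s t)\<^sup>2 = g t" for t using assms(3) by (simp add: s_def power_mult_distrib)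
  moreover have "s 0 \<noteq> 0" using assms(3) by (simp add: s_def)
  moreover have "ball (0::complex) \<rho> \<subseteq> ball 0 r" using \<rho>(2) by blast
  ultimately show thesis using that \<rho>(1) by blast
qed

text \<open>With \<open>G = \<Sum>v\<^sub>j\<^sup>2 + h(t)\<close>, the first alternative holds if \<open>h\<close> is not identically zero, and the
  second if it is: then \<open>G\<close> is singular along the curve \<open>\<kappa>\<close> on which all \<open>v\<^sub>j\<close> vanish.\<close>

lemma Morse_dichotomy:
  fixes G :: "complex ^ 'd::finite option \<Rightarrow> complex"
  assumes hol: "holo_germ G 0"
    and slice: "\<forall>\<^sub>F z in nhds 0. z $ None = 0 \<longrightarrow> G z = odp_model (space_part z)"
    and sing: "(G has_derivative (\<lambda>v. 0)) (at 0)"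
  shows "(\<exists>m\<ge>1. \<exists>\<Theta> \<Psi> u. biholo_germ \<Theta> \<Psi> 0 0 \<and> holo_germ u 0 \<and> u 0 \<noteq> 0 \<and>
            (\<forall>\<^sub>F z in nhds 0. G z = u z * A_model m (\<Theta> z :: complex ^ 'd option))) \<or>
         (\<exists>\<kappa>. isCont \<kappa> 0 \<and> \<kappa> 0 = 0 \<and>
            (\<forall>\<^sub>F t in nhds 0. \<kappa> t $ None = t \<and> G (\<kappa> t) = 0 \<and> (G has_derivative (\<lambda>v. 0)) (at (\<kappa> t))))"
proof -
  have slice': "\<forall>\<^sub>F z in nhds 0. z $ None = 0 \<longrightarrow> G z = (\<Sum>j\<in>- {None}. (z $ j)\<^sup>2)"
    using slice by (simp add: sum_option odp_model_def)
  obtain v h r where v': "\<forall>j. j \<noteq> None \<longrightarrow> holo_germ (v j) 0 \<and>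
      (\<forall>\<^sub>F z in nhds 0. z $ None = 0 \<longrightarrow> v j z = z $ j)"
    and h: "r > 0" "h holomorphic_on ball 0 r"
    and G: "\<forall>\<^sub>F z in nhds 0. G z = (\<Sum>j\<in>-{None}. (v j z)\<^sup>2) + h (z $ None)"
    by (rule Morse_with_parameter [OF hol slice'])
  have v: "holo_germ (v j) 0" "\<forall>\<^sub>F z in nhds 0. z $ None = 0 \<longrightarrow> v j z = z $ j" if "j \<noteq> None" for j
    using v' that by simp_all
  have v0: "v j 0 = 0" if "j \<noteq> None" for j
    using eventually_nhds_x_imp_x [OF v(2) [OF that]] by simp
  have h0: "h 0 = 0"
    using eventually_nhds_x_imp_x [OF G] eventually_nhds_x_imp_x [OF slice'] v0 by simp
  define P where "P z j = v (Some j) z" for z and j :: 'd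
  have P: "holo_germ (\<lambda>z. P z j) 0" "\<forall>\<^sub>F z in nhds 0. z $ None = 0 \<longrightarrow> P z j = z $ Some j" for j
    using v by (simp_all add: P_def)
  have GP: "\<forall>\<^sub>F z in nhds 0. G z = (\<Sum>j\<in>UNIV. (P z j)\<^sup>2) + h (z $ None)"
    using G by (simp add: sum_option P_def)
  have biholo: "\<exists>\<Psi>. biholo_germ (\<lambda>z. join (\<chi> j. P z j / s (z $ None)) (z $ None)) \<Psi> 0 0"
    if s: "s holomorphic_on ball 0 \<rho>" "\<rho> > 0" "s 0 \<noteq> 0" for s :: "complex \<Rightarrow> complex" and \<rho>
  proof -
    let ?\<Theta> = "\<lambda>z. join (\<chi> j. P z j / s (z $ None)) (z $ None)"
    have "holo_map_germ ?\<Theta> 0"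
    proof (rule holo_map_germ_join)
      have "holo_germ (\<lambda>z. P z j / s (z $ None)) 0" for j
        by (rule holo_germ_divide [OF P(1)]) (use s in \<open>auto intro!: holo_germ_coordinate_compose [OF s(1,2)]\<close>)
      then show "holo_map_germ (\<lambda>z. \<chi> j. P z j / s (z $ None)) 0" by (simp add: holo_map_germ_def)
    qed simp
    moreover have "\<forall>\<^sub>F z in nhds 0. \<forall>j. z $ None = 0 \<longrightarrow> P z j = z $ Some j"
      using P(2) by (rule eventually_all_finite)
    then have "\<forall>\<^sub>F z in nhds 0. z $ None = 0 \<longrightarrow> ?\<Theta> z = (1 / s 0) *s z"
      by (rule eventually_mono) (simp add: vec_option_eq_iff)
    moreover have "1 / s 0 \<noteq> 0" using s by simp
    ultimately show ?thesis using holo_slice_inverse [of ?\<Theta> None "1 / s 0"] by auto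
  qed
  show ?thesis
  proof (cases "\<exists>t\<in>ball 0 r. h t \<noteq> 0")
    case True
    then have "\<not> h constant_on ball 0 r" using h0 h(1) unfolding constant_on_def
      by (metis centre_in_ball)
    then obtain g \<rho> n where g: "0 < n" "0 < \<rho>" "ball (0::complex) \<rho> \<subseteq> ball 0 r" "g holomorphic_on ball 0 \<rho>"
      "\<And>t. t \<in> ball 0 \<rho> \<Longrightarrow> h t = (t - 0) ^ n * g t" "\<And>t. t \<in> ball 0 \<rho> \<Longrightarrow> g t \<noteq> 0"
      using holomorphic_factor_zero_nonconstant [OF h(2) open_ball connected_ball _ h0] h(1)
      by (metis centre_in_ball)
    have g0: "g 0 \<noteq> 0" using g by simp
    \<comment> \<open>At a simple zero \<open>h\<close> would have a nonzero derivative, and so would \<open>G\<close> in the direction of the parameter.\<close>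
    have "n \<noteq> 1"
    proof
      assume "n = 1"
      obtain H where H: "(h has_field_derivative H) (at 0)"
        using holomorphic_on_imp_differentiable_at [OF h(2) open_ball, of 0] h(1)
        unfolding field_differentiable_def by auto
      obtain K where K: "(g has_field_derivative K) (at 0)"
        using holomorphic_on_imp_differentiable_at [OF g(4) open_ball, of 0] g(2)
        unfolding field_differentiable_def by auto
      have "((\<lambda>z. h (z $ None)) has_derivative (\<lambda>x. H * (x $ None))) (at 0)"
        by (rule has_derivative_compose [OF has_derivative_vec_nth])
          (use H in \<open>simp add: has_field_derivative_def\<close>)
      then have "((\<lambda>z. (\<Sum>j\<in>UNIV. (P z j)\<^sup>2) + h (z $ None)) has_derivative (\<lambda>x. 0 + H * (x $ None))) (at 0)"
        by (intro has_derivative_add has_derivative_sum_squares holo_germ_cx_diff P(1))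
          (auto simp: P_def v0)
      moreover have "((\<lambda>z. (\<Sum>j\<in>UNIV. (P z j)\<^sup>2) + h (z $ None)) has_derivative (\<lambda>x. 0)) (at 0)"
        by (rule has_derivative_cong_nhds [OF sing GP])
      ultimately have "(\<lambda>x :: complex ^ 'd option. 0 + H * (x $ None)) = (\<lambda>x. 0)"
        by (rule has_derivative_unique)
      from fun_cong [OF this, of "axis None 1"] have "H = 0" by (simp add: axis_def)
      have der: "((\<lambda>t. t * g t) has_field_derivative g 0) (at 0)"
        using DERIV_mult [OF DERIV_ident K] by simp
      have ev: "\<forall>\<^sub>F t in nhds 0. t * g t = h t"
      proof (rule eventually_mono)
        show "\<forall>\<^sub>F t in nhds 0. t \<in> ball 0 \<rho>"
          by (rule eventually_nhds_in_open) (simp_all add: g(2))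
        show "t * g t = h t" if "t \<in> ball 0 \<rho>" for t using g(5) [OF that] \<open>n = 1\<close> by simp
      qed
      have "(h has_field_derivative g 0) (at 0)"
        by (rule iffD1 [OF DERIV_cong_ev [OF refl ev refl] der])
      with H have "H = g 0" by (rule DERIV_unique)
      then show False using \<open>H = 0\<close> g0 by simp
    qed
    define m where "m = n - 1"
    have m: "m \<ge> 1" "n = m + 1" using g(1) \<open>n \<noteq> 1\<close> by (auto simp: m_def)
    have hol_g: "(\<lambda>t. - g t) holomorphic_on ball 0 \<rho>" using g(4) by (rule holomorphic_on_minus)
    have "- g 0 \<noteq> 0" using g0 by simp
    with hol_g g(2) obtain s \<tau> where s: "\<tau> > 0" "ball (0::complex) \<tau> \<subseteq> ball 0 \<rho>" "s holomorphic_on ball 0 \<tau>"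
      "\<forall>t\<in>ball 0 \<tau>. (s t)\<^sup>2 = - g t" "s 0 \<noteq> 0"
      by (rule square_root_germ)
    obtain \<Psi> where \<Psi>: "biholo_germ (\<lambda>z. join (\<chi> j. P z j / s (z $ None)) (z $ None)) \<Psi> 0 0"
      using biholo [OF s(3,1,5)] by blast
    have "\<forall>\<^sub>F z :: complex ^ 'd option in nhds 0. z $ None \<in> ball 0 \<tau>"
      by (rule eventually_nth_in_ball [OF s(1)])
    with GP have "\<forall>\<^sub>F z in nhds 0. G z = - g (z $ None) *
        A_model m (join (\<chi> j. P z j / s (z $ None)) (z $ None))"
    proof eventually_elim
      case (elim z)
      let ?t = "z $ None"
      have t: "?t \<in> ball 0 \<rho>" using elim(2) s(2) by blast
      have sq: "(s ?t)\<^sup>2 = - g ?t" using elim(2) s(4) by blast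
      have "- g ?t * (\<Sum>j\<in>UNIV. (P z j / s ?t)\<^sup>2) = (\<Sum>j\<in>UNIV. (P z j)\<^sup>2)"
        using g(6) [OF t] unfolding power_divide sq sum_divide_distrib [symmetric] by simp
      then show ?case using elim(1) g(5) [OF t]
        by (simp add: A_model_def m(2) right_diff_distrib)
    qed
    moreover have "holo_germ (\<lambda>z. - g (z $ None)) (0 :: complex ^ 'd option)"
      by (rule holo_germ_coordinate_compose [of "\<lambda>t. - g t" \<rho>]) (simp_all add: hol_g g(2))
    ultimately have "\<exists>\<Theta> \<Psi> u. biholo_germ \<Theta> \<Psi> 0 0 \<and> holo_germ u 0 \<and> u 0 \<noteq> 0 \<and>
            (\<forall>\<^sub>F z in nhds 0. G z = u z * A_model m (\<Theta> z :: complex ^ 'd option))"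
      using \<Psi> g0
      by (intro exI [of _ "\<lambda>z. join (\<chi> j. P z j / s (z $ None)) (z $ None)"] exI [of _ \<Psi>]
            exI [of _ "\<lambda>z. - g (z $ None)"]) simp
    then show ?thesis using m(1) by blast
  next
    case False
    let ?\<Theta> = "\<lambda>z. join (\<chi> j. P z j / 1) (z $ None)"
    obtain \<Psi> where "biholo_germ ?\<Theta> \<Psi> 0 0"
      using biholo [of "\<lambda>_. 1" 1] by (auto simp: holomorphic_on_const)
    then have \<Psi>: "holo_map_germ \<Psi> 0" "\<Psi> 0 = 0" "\<forall>\<^sub>F w in nhds 0. ?\<Theta> (\<Psi> w) = w"
      unfolding biholo_germ_def by blast+
    \<comment> \<open>The curve on which the new space coordinates are zero and the parameter is \<open>t\<close>.\<close>
    define \<kappa> where "\<kappa> t = \<Psi> (with_coord None t 0)" for t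
    have cont: "isCont \<kappa> 0"
      unfolding \<kappa>_def by (rule isCont_o2 [OF isCont_with_coord]) (simp add: holo_map_germ_isCont \<Psi>)
    have \<kappa>0: "\<kappa> 0 = 0" by (simp add: \<kappa>_def \<Psi>)
    have "\<forall>\<^sub>F t in nhds 0. ?\<Theta> (\<Psi> (with_coord None t 0)) = with_coord None t 0"
      by (rule eventually_nhds_isCont [OF isCont_with_coord, where P = "\<lambda>w. ?\<Theta> (\<Psi> w) = w"])
        (use \<Psi>(3) in simp)
    then have \<Theta>: "\<forall>\<^sub>F t in nhds 0. ?\<Theta> (\<kappa> t) = with_coord None t 0" by (simp add: \<kappa>_def)
    have "\<forall>\<^sub>F z :: complex ^ 'd option in nhds 0. z $ None \<in> ball 0 r"
      by (rule eventually_nth_in_ball [OF h(1)])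
    with GP have "\<forall>\<^sub>F z in nhds 0. (\<Sum>j\<in>UNIV. (P z j)\<^sup>2) = G z"
      by eventually_elim (use False in auto)
    then have "\<forall>\<^sub>F z in nhds 0. \<forall>\<^sub>F w in nhds z. (\<Sum>j\<in>UNIV. (P w j)\<^sup>2) = G w"
      by (simp add: eventually_eventually)
    moreover have "\<forall>\<^sub>F z in nhds 0. \<forall>j. cx_diff (\<lambda>z. P z j) z"
      by (rule eventually_all_finite) (use P(1) in \<open>simp add: holo_germ_def\<close>)
    ultimately have "\<forall>\<^sub>F z in nhds 0. (\<forall>\<^sub>F w in nhds z. (\<Sum>j\<in>UNIV. (P w j)\<^sup>2) = G w) \<and>
        (\<forall>j. cx_diff (\<lambda>z. P z j) z)" by (rule eventually_conj)
    then have "\<forall>\<^sub>F t in nhds 0. (\<forall>\<^sub>F w in nhds (\<kappa> t). (\<Sum>j\<in>UNIV. (P w j)\<^sup>2) = G w) \<and>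
        (\<forall>j. cx_diff (\<lambda>z. P z j) (\<kappa> t))"
      using eventually_nhds_isCont [OF cont] \<kappa>0 by simp
    with \<Theta> have "\<forall>\<^sub>F t in nhds 0. \<kappa> t $ None = t \<and> G (\<kappa> t) = 0 \<and> (G has_derivative (\<lambda>v. 0)) (at (\<kappa> t))"
    proof eventually_elim
      case (elim t)
      have P0: "P (\<kappa> t) j = 0" for j
        using arg_cong [OF elim(1), of "\<lambda>w. w $ Some j"] by simp
      have "\<kappa> t $ None = t"
        using arg_cong [OF elim(1), of "\<lambda>w. w $ None"] by simp
      moreover have "G (\<kappa> t) = 0"
        using eventually_nhds_x_imp_x [OF conjunct1 [OF elim(2)]] P0 by simp
      moreover have "((\<lambda>z. \<Sum>j\<in>UNIV. (P z j)\<^sup>2) has_derivative (\<lambda>v. 0)) (at (\<kappa> t))"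
        by (rule has_derivative_sum_squares) (use elim(2) P0 in auto)
      then have "(G has_derivative (\<lambda>v. 0)) (at (\<kappa> t))"
        by (rule has_derivative_cong_nhds) (use elim(2) in blast)
      ultimately show ?case by blast
    qed
    then show ?thesis using cont \<kappa>0 by blast
  qed
qed


lemma has_derivative_space_part: "(space_part has_derivative space_part) (at z)"
  by (rule has_derivative_vec) (simp add: has_derivative_vec_nth)

lemma has_derivative_join_left: "((\<lambda>w. join w t) has_derivative (\<lambda>v. join v 0)) (at w)"
proof (rule has_derivative_vec)
  fix i show "((\<lambda>w. join w t $ i) has_derivative (\<lambda>v. join v 0 $ i)) (at w)"
    by (cases i) (simp_all add: has_derivative_vec_nth)
qed

lemma has_derivative_join_right: "((\<lambda>t. join w t) has_derivative (\<lambda>t. join 0 t)) (at t)"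
proof (rule has_derivative_vec)
  fix i show "((\<lambda>t. join w t $ i) has_derivative (\<lambda>t. join 0 t $ i)) (at t)"
    by (cases i) (auto simp: has_derivative_ident)
qed

text \<open>Vanishing of a differential can be tested along the fibre and along the parameter line separately.\<close>

lemma has_derivative_zero_join:
  fixes H :: "complex ^ 'd::finite option \<Rightarrow> complex"
  assumes "cx_diff H (join w t)"
    and left: "((\<lambda>w. H (join w t)) has_derivative (\<lambda>v. 0)) (at w)"
    and right: "((\<lambda>t. H (join w t)) has_derivative (\<lambda>v. 0)) (at t)"
  shows "(H has_derivative (\<lambda>v. 0)) (at (join w t))"
proof -
  obtain D where D: "(H has_derivative D) (at (join w t))" using assms(1) unfolding cx_diff_def by blast
  have "(\<lambda>v. D (join v 0)) = (\<lambda>v. 0)"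
    using has_derivative_unique [OF has_derivative_compose [OF has_derivative_join_left D] left] .
  moreover have "(\<lambda>v. D (join 0 v)) = (\<lambda>v. 0)"
    using has_derivative_unique [OF has_derivative_compose [OF has_derivative_join_right D] right] .
  moreover have "D v = D (join (space_part v) 0) + D (join 0 (v $ None))" for v
  proof -
    have "join (space_part v) 0 + join 0 (v $ None) = v" by (simp add: vec_option_eq_iff)
    with linear_add [OF has_derivative_linear [OF D], of "join (space_part v) 0" "join 0 (v $ None)"]
    show ?thesis by simp
  qed
  ultimately have "D v = 0" for v by (metis add_0)
  then have "D = (\<lambda>v. 0)" by (rule ext)
  then show ?thesis using D by simp
qed

text \<open>The coordinates that turn \<open>f\<close> into a unit multiple of the quadratic form extend to the family by leaving
  the parameter alone. Multiplied by a unit, \<open>F\<close> becomes in these coordinates exactly the quadratic form at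
  parameter \<open>0\<close>, and \<open>Morse_dichotomy\<close> applies. Both alternatives are insensitive to units and to
  coordinate changes that preserve the parameter.\<close>

lemma odp_family_dichotomy:
  fixes F :: "complex ^ 'd::finite option \<Rightarrow> complex" and f :: "complex ^ 'd \<Rightarrow> complex"
  assumes holF: "holo_germ F z0" and z0: "z0 $ None = 0"
    and sing: "(F has_derivative (\<lambda>v. 0)) (at z0)" and F0: "F z0 = 0"
    and f: "germ_iso f (space_part z0) odp_model (0 :: complex ^ 'd)"
    and restrict: "\<And>w. F (join w 0) = l * f w" and l: "l \<noteq> 0"
  shows "(\<exists>m\<ge>1. germ_iso F z0 (A_model m :: complex ^ 'd option \<Rightarrow> complex) 0) \<or>
         (\<exists>\<kappa>. isCont \<kappa> 0 \<and> \<kappa> 0 = z0 \<and>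
            (\<forall>\<^sub>F t in nhds 0. \<kappa> t $ None = t \<and> F (\<kappa> t) = 0 \<and> (F has_derivative (\<lambda>v. 0)) (at (\<kappa> t))))"
proof -
  let ?w0 = "space_part z0"
  have z0': "join ?w0 0 = z0" using join_space_part [of z0] z0 by simp
  have "holo_map_germ (\<lambda>w. join w 0) ?w0"
    using holo_map_germ_join [of "\<lambda>w. w" ?w0 "\<lambda>_. 0"] by (simp add: holo_map_germ_def)
  then have "holo_germ (\<lambda>w. F (join w 0)) ?w0"
    by (rule holo_germ_compose [rotated]) (simp only: z0' holF)
  then have "holo_germ (\<lambda>w. F (join w 0) / l) ?w0"
    using holo_germ_divide [where f = "\<lambda>w. F (join w 0)" and g = "\<lambda>_. l"] l by simp
  then have holf: "holo_germ f ?w0" unfolding restrict using l by simp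
  obtain \<xi> :: "complex ^ 'd \<Rightarrow> complex ^ 'd" and D a where \<xi>: "holo_map_germ \<xi> ?w0" "\<xi> ?w0 = 0"
    "(\<xi> has_derivative D) (at ?w0)" "\<And>v. D v = 0 \<Longrightarrow> v = 0" and a: "holo_germ a ?w0" "a ?w0 \<noteq> 0"
    and af: "\<forall>\<^sub>F w in nhds ?w0. odp_model (\<xi> w) = a w * f w"
    by (rule odp_normal_form [OF f holf]) (rule that, assumption, assumption, assumption, blast)
  define \<Xi> where "\<Xi> z = join (\<xi> (space_part z)) (z $ None)" for z
  have hol\<Xi>: "holo_map_germ \<Xi> z0"
    unfolding \<Xi>_def
    using holo_map_germ_join [of "\<lambda>z. \<xi> (space_part z)" z0 "\<lambda>z. z $ None"]
      holo_map_germ_compose [OF \<xi>(1) holo_map_germ_space_part] by simp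
  have \<Xi>0: "\<Xi> z0 = 0" by (simp add: \<Xi>_def \<xi>(2) z0 vec_option_eq_iff)
  have "((\<lambda>z. \<xi> (space_part z)) has_derivative (\<lambda>v. D (space_part v))) (at z0)"
    by (rule has_derivative_compose [OF has_derivative_space_part \<xi>(3)])
  then have \<xi>_nth: "((\<lambda>z. \<xi> (space_part z) $ j) has_derivative (\<lambda>v. D (space_part v) $ j)) (at z0)" for j
    by (rule bounded_linear.has_derivative [OF bounded_linear_vec_nth])
  have der\<Xi>: "(\<Xi> has_derivative (\<lambda>v. join (D (space_part v)) (v $ None))) (at z0)"
  proof (rule has_derivative_vec)
    fix i show "((\<lambda>z. \<Xi> z $ i) has_derivative (\<lambda>v. join (D (space_part v)) (v $ None) $ i)) (at z0)"
      unfolding \<Xi>_def by (cases i) (simp_all add: \<xi>_nth has_derivative_vec_nth)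
  qed
  have "v = 0" if "join (D (space_part v)) (v $ None) = 0" for v
  proof -
    have "v $ None = 0" "D (space_part v) = 0"
      using that by (simp_all add: vec_option_eq_iff [of _ 0] vec_eq_iff [of _ 0])
    then show ?thesis using \<xi>(4) [of "space_part v"] by (simp add: vec_option_eq_iff vec_eq_iff [of _ "0 :: complex ^ 'd"])
  qed
  from holo_inverse_function [OF hol\<Xi> der\<Xi> this] obtain \<Psi> where bi: "biholo_germ \<Xi> \<Psi> z0 0"
    unfolding \<Xi>0 by blast
  then have \<Psi>: "holo_map_germ \<Psi> 0" "\<Psi> 0 = z0"
    "\<forall>\<^sub>F z in nhds z0. \<Psi> (\<Xi> z) = z" "\<forall>\<^sub>F u in nhds 0. \<Xi> (\<Psi> u) = u"
    unfolding biholo_germ_def by blast+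
  define b where "b z = a (space_part z) / l" for z
  have holb: "holo_germ b z0" unfolding b_def
    using holo_germ_divide [where f = "\<lambda>z. a (space_part z)" and g = "\<lambda>_. l" and p = z0] l
      holo_germ_compose [OF a(1) holo_map_germ_space_part] by simp
  have b0: "b z0 \<noteq> 0" using a(2) l by (simp add: b_def)
  define G where "G u = b (\<Psi> u) * F (\<Psi> u)" for u
  have holG: "holo_germ G 0" unfolding G_def
    using holo_germ_compose [of b \<Psi> 0] holo_germ_compose [of F \<Psi> 0] holb holF \<Psi>(1,2)
    by (intro holo_germ_mult) simp_all
  have "holo_map_germ (\<lambda>u. space_part (\<Psi> u)) 0"
    using holo_map_germ_compose [of space_part \<Psi> 0] holo_map_germ_space_part \<Psi>(1) by blast
  then have "\<forall>\<^sub>F u in nhds 0. odp_model (\<xi> (space_part (\<Psi> u))) = a (space_part (\<Psi> u)) * f (space_part (\<Psi> u))"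
    by (rule eventually_nhds_holo_map_germ [OF _ _ af]) (simp add: \<Psi>(2))
  with \<Psi>(4) have slice: "\<forall>\<^sub>F u in nhds 0. u $ None = 0 \<longrightarrow> G u = odp_model (space_part u)"
  proof eventually_elim
    case (elim u)
    show ?case
    proof
      assume "u $ None = 0"
      then have "\<Psi> u $ None = 0" using arg_cong [OF elim(1), of "\<lambda>z. z $ None"] by (simp add: \<Xi>_def)
      then have "F (\<Psi> u) = l * f (space_part (\<Psi> u))"
        using restrict [of "space_part (\<Psi> u)"] join_space_part [of "\<Psi> u"] by simp
      then have "G u = odp_model (\<xi> (space_part (\<Psi> u)))" using elim(2) l by (simp add: G_def b_def)
      also have "\<xi> (space_part (\<Psi> u)) = space_part u"
        using arg_cong [OF elim(1), of space_part] by (simp add: \<Xi>_def)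
      finally show "G u = odp_model (space_part u)" .
    qed
  qed
  obtain D\<Psi> where D\<Psi>: "(\<Psi> has_derivative D\<Psi>) (at 0)"
    using cx_diff_vec [of \<Psi> 0] \<Psi>(1) holo_germ_cx_diff unfolding holo_map_germ_def by metis
  have singG: "(G has_derivative (\<lambda>v. 0)) (at 0)"
  proof -
    have "((\<lambda>u. F (\<Psi> u)) has_derivative (\<lambda>v. 0)) (at 0)"
      using has_derivative_compose [OF D\<Psi>, of F "\<lambda>v. 0"] sing \<Psi>(2) by simp
    moreover have "cx_diff (\<lambda>u. b (\<Psi> u)) 0"
      using holo_germ_cx_diff holo_germ_compose [of b \<Psi> 0] holb \<Psi>(1,2) by simp
    then obtain B where "((\<lambda>u. b (\<Psi> u)) has_derivative B) (at 0)" unfolding cx_diff_def by blast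
    ultimately show ?thesis unfolding G_def using has_derivative_zero_mult F0 \<Psi>(2) by metis
  qed
  have FG: "\<forall>\<^sub>F z in nhds z0. F z = 1 / b z * G (\<Xi> z)"
    using \<Psi>(3) holo_germ_nonzero [OF holb b0] by eventually_elim (simp add: G_def)
  have hol_unit: "holo_germ (\<lambda>z. 1 / b z) z0" 
    using holo_germ_divide [where f = "\<lambda>_. 1" and g = b] holb b0 by simp
  from Morse_dichotomy [OF holG slice singG] show ?thesis
  proof (elim disjE exE conjE)
    fix m \<Theta> \<Psi>' u
    assume m: "1 \<le> m" and \<Theta>: "biholo_germ \<Theta> \<Psi>' 0 0" and u: "holo_germ u 0" "u 0 \<noteq> 0"
      and G: "\<forall>\<^sub>F z in nhds 0. G z = u z * A_model m (\<Theta> z :: complex ^ 'd option)"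
    have "\<forall>\<^sub>F z in nhds z0. G (\<Xi> z) = u (\<Xi> z) * A_model m (\<Theta> (\<Xi> z))"
      by (rule eventually_nhds_holo_map_germ [OF hol\<Xi> \<Xi>0 G])
    with FG have "\<forall>\<^sub>F z in nhds z0. F z = 1 / b z * u (\<Xi> z) * A_model m (\<Theta> (\<Xi> z))"
      by eventually_elim simp
    moreover have "holo_germ (\<lambda>z. u (\<Xi> z)) z0"
      using holo_germ_compose [of u \<Xi> z0] u(1) hol\<Xi> \<Xi>0 by simp
    then have "holo_germ (\<lambda>z. 1 / b z * u (\<Xi> z)) z0" by (rule holo_germ_mult [OF hol_unit])
    moreover have "1 / b z0 * u (\<Xi> z0) \<noteq> 0" using b0 u(2) \<Xi>0 by simp
    ultimately have "germ_iso F z0 (A_model m :: complex ^ 'd option \<Rightarrow> complex) 0"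
      using germ_isoI [OF biholo_germ_compose [OF bi \<Theta>]] by blast
    then show ?thesis using m by blast
  next
    fix \<kappa>
    assume \<kappa>: "isCont \<kappa> 0" "\<kappa> 0 = 0" and
      ev: "\<forall>\<^sub>F t in nhds 0. \<kappa> t $ None = t \<and> G (\<kappa> t) = 0 \<and> (G has_derivative (\<lambda>v. 0)) (at (\<kappa> t))"
    have cont: "isCont (\<lambda>t. \<Psi> (\<kappa> t)) 0"
      by (rule isCont_o2 [OF \<kappa>(1)]) (simp add: \<kappa>(2) holo_map_germ_isCont [OF \<Psi>(1)])
    have ball: "\<forall>\<^sub>F z in nhds z0. (\<forall>\<^sub>F y in nhds z. F y = 1 / b y * G (\<Xi> y)) \<and> cx_diff (\<lambda>z. 1 / b z) z \<and>
        (\<forall>i. cx_diff (\<lambda>z. \<Xi> z $ i) z)"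
      by (intro eventually_conj eventually_all_finite)
        (use FG hol_unit hol\<Xi> in \<open>simp_all add: eventually_eventually holo_germ_def holo_map_germ_def\<close>)
    then have "\<forall>\<^sub>F t in nhds 0. (\<forall>\<^sub>F y in nhds (\<Psi> (\<kappa> t)). F y = 1 / b y * G (\<Xi> y)) \<and>
        cx_diff (\<lambda>z. 1 / b z) (\<Psi> (\<kappa> t)) \<and> (\<forall>i. cx_diff (\<lambda>z. \<Xi> z $ i) (\<Psi> (\<kappa> t)))"
      by (rule eventually_nhds_isCont [OF cont, unfolded \<kappa>(2) \<Psi>(2)])
    moreover have "\<forall>\<^sub>F t in nhds 0. \<Xi> (\<Psi> (\<kappa> t)) = \<kappa> t"
      by (rule eventually_nhds_isCont [OF \<kappa>(1), where P = "\<lambda>u. \<Xi> (\<Psi> u) = u"]) (simp add: \<kappa>(2) \<Psi>(4))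
    ultimately have "\<forall>\<^sub>F t in nhds 0. \<Psi> (\<kappa> t) $ None = t \<and> F (\<Psi> (\<kappa> t)) = 0 \<and>
        (F has_derivative (\<lambda>v. 0)) (at (\<Psi> (\<kappa> t)))"
      using ev
    proof eventually_elim
      case (elim t)
      let ?z = "\<Psi> (\<kappa> t)"
      have \<Xi>z: "\<Xi> ?z = \<kappa> t" by (rule elim(2))
      have \<kappa>t: "\<kappa> t $ None = t" "G (\<kappa> t) = 0" "(G has_derivative (\<lambda>v. 0)) (at (\<kappa> t))"
        using elim(3) by blast+
      have "?z $ None = t" using arg_cong [OF \<Xi>z, of "\<lambda>z. z $ None"] \<kappa>t(1) by (simp add: \<Xi>_def)
      moreover have "F ?z = 1 / b ?z * G (\<Xi> ?z)"
        by (rule eventually_nhds_x_imp_x [OF conjunct1 [OF elim(1)]])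
      then have "F ?z = 0" unfolding \<Xi>z \<kappa>t(2) by simp
      moreover have "(F has_derivative (\<lambda>v. 0)) (at ?z)"
      proof -
        have "cx_diff (\<lambda>z. \<Xi> z $ i) ?z" for i using elim(1) by blast
        then obtain D' where D': "(\<Xi> has_derivative D') (at ?z)" by (rule cx_diff_vec)
        have 1: "((\<lambda>z. G (\<Xi> z)) has_derivative (\<lambda>v. 0)) (at ?z)"
          by (rule has_derivative_compose [OF D', of G "\<lambda>v. 0"]) (simp only: \<Xi>z \<kappa>t(3))
        obtain B where 2: "((\<lambda>z. 1 / b z) has_derivative B) (at ?z)"
          using elim(1) unfolding cx_diff_def by blast
        have "((\<lambda>z. 1 / b z * G (\<Xi> z)) has_derivative (\<lambda>v. 0)) (at ?z)"
          by (rule has_derivative_zero_mult [OF 2 1]) (simp only: \<Xi>z \<kappa>t(2))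
        moreover have "\<forall>\<^sub>F y in nhds ?z. 1 / b y * G (\<Xi> y) = F y"
          using conjunct1 [OF elim(1)] by (rule eventually_mono) (rule sym)
        ultimately show ?thesis by (rule has_derivative_cong_nhds)
      qed
      ultimately show ?case by blast
    qed
    then show ?thesis using cont \<kappa>(2) \<Psi>(2)
      by (intro disjI2 exI [of _ "\<lambda>t. \<Psi> (\<kappa> t)"]) simp
  qed
qed


section \<open>Sections in charts\<close>

lemma homog_poly_smult:
  assumes "homog_poly d P" shows "P (\<lambda>j. c * z j) = c ^ d * P z"
  using assms by (induction) (auto simp: algebra_simps power_add)

lemma cx_diff_homog_poly:
  assumes "homog_poly d P" shows "cx_diff (\<lambda>v. P (($) v)) v"
  using assms by (induction) (auto intro: cx_diff_add cx_diff_mult)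

text \<open>The chosen homogeneous coordinates of \<open>hpt v\<close> differ from \<open>v\<close> by a scalar, which acts on forms of
  degree \<open>d\<close> by its \<open>d\<close>-th power. The scalar does not depend on the form, so it cancels in quotients of
  forms of the same degree.\<close>

lemma poly_at_hpt:
  fixes v :: "complex ^ 'm::finite"
  assumes "v \<noteq> 0"
  obtains c where "c \<noteq> 0" "\<And>d P. homog_poly d P \<Longrightarrow> poly_at P (hpt v) = c ^ d * P (($) v)"
proof -
  have "hpt (hcoord (hpt v)) = hpt v" by (rule hpt_hcoord)
  then obtain c where c: "c \<noteq> 0" "hcoord (hpt v) = c *s v"
    using hpt_eq_iff [OF hcoord_nonzero assms] by blast
  have "poly_at P (hpt v) = c ^ d * P (($) v)" if "homog_poly d P" for d P
  proof -
    have "($) (c *s v) = (\<lambda>j. c * v $ j)" by (simp add: fun_eq_iff)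
    then show ?thesis using homog_poly_smult [OF that, of c "($) v"] by (simp add: poly_at_def c(2))
  qed
  then show thesis using that c(1) by blast
qed

lemma chart_holo_map_germ: "chart X W \<phi> \<Longrightarrow> w \<in> W \<Longrightarrow> holo_map_germ \<phi> w"
  unfolding chart_def holo_map_germ_iff by blast

lemma holo_germ_homog_poly:
  assumes "homog_poly d P" "holo_map_germ \<phi> w" shows "holo_germ (\<lambda>w. P (($) (\<phi> w))) w"
  using holo_germ_compose [of "\<lambda>v. P (($) v)" \<phi> w] assms cx_diff_homog_poly [OF assms(1)]
  by (simp add: holo_germ_def)

lemma chart_eventually_domain:
  assumes "chart X W \<phi>" "w \<in> W" shows "\<forall>\<^sub>F w in nhds w. w \<in> W"
  using assms unfolding chart_def by (intro eventually_nhds_in_open) auto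

text \<open>Zariski open sets are open in the classical topology: a form that does not vanish at a point does not
  vanish nearby.\<close>

lemma chart_not_zariski_closed:
  assumes chart: "chart X W \<phi>" "w0 \<in> W" and Z: "zariski_closed Z" "hpt (\<phi> w0) \<notin> Z"
  shows "\<forall>\<^sub>F w in nhds w0. hpt (\<phi> w) \<notin> Z"
proof -
  obtain E where E: "\<forall>P\<in>E. \<exists>d. homog_poly d P" "Z = {p. \<forall>P\<in>E. poly_at P p = 0}"
    using Z(1) unfolding zariski_closed_def by blast
  then obtain P d where P: "P \<in> E" "homog_poly d P" "poly_at P (hpt (\<phi> w0)) \<noteq> 0"
    using Z(2) by blast
  have nz: "\<phi> w \<noteq> 0" if "w \<in> W" for w using chart(1) that unfolding chart_def by blast
  obtain c where "poly_at P (hpt (\<phi> w0)) = c ^ d * P (($) (\<phi> w0))"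
    using poly_at_hpt [OF nz [OF chart(2)]] P(2) by metis
  then have "P (($) (\<phi> w0)) \<noteq> 0" using P(3) by auto
  then have "\<forall>\<^sub>F w in nhds w0. P (($) (\<phi> w)) \<noteq> 0"
    by (rule holo_germ_nonzero [OF holo_germ_homog_poly [OF P(2) chart_holo_map_germ [OF chart]]])
  then show ?thesis using chart_eventually_domain [OF chart]
  proof eventually_elim
    case (elim w)
    obtain c where "c \<noteq> 0" "poly_at P (hpt (\<phi> w)) = c ^ d * P (($) (\<phi> w))"
      using poly_at_hpt [OF nz [OF elim(2)]] P(2) by metis
    then have "poly_at P (hpt (\<phi> w)) \<noteq> 0" using elim(1) by simp
    then show ?case using P(1) E(2) by blast
  qed
qed

lemma chart_in_variety: "chart X W \<phi> \<Longrightarrow> w \<in> W \<Longrightarrow> hpt (\<phi> w) \<in> X"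
  unfolding chart_def by (metis image_eqI openin_imp_subset subsetD)

lemma chart_regular_holo:
  assumes chart: "chart X W \<phi>" "w0 \<in> W" and reg: "regular_at X f (hpt (\<phi> w0))"
  shows "holo_germ (\<lambda>w. f (hpt (\<phi> w))) w0"
proof -
  obtain d P Q U where PQ: "homog_poly d P" "homog_poly d Q" and U: "zariski_open U" "hpt (\<phi> w0) \<in> U"
    and f: "\<forall>q\<in>X \<inter> U. poly_at Q q \<noteq> 0 \<and> f q = poly_at P q / poly_at Q q"
    using reg unfolding regular_at_def by blast
  have nz: "\<phi> w \<noteq> 0" if "w \<in> W" for w using chart(1) that unfolding chart_def by blast
  have quot: "Q (($) (\<phi> w)) \<noteq> 0 \<and> f (hpt (\<phi> w)) = P (($) (\<phi> w)) / Q (($) (\<phi> w))"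
    if w: "w \<in> W" "hpt (\<phi> w) \<in> U" for w
  proof -
    obtain c where c: "c \<noteq> 0" "\<And>d P. homog_poly d P \<Longrightarrow> poly_at P (hpt (\<phi> w)) = c ^ d * P (($) (\<phi> w))"
      using poly_at_hpt [OF nz [OF w(1)]] by blast
    have "poly_at Q (hpt (\<phi> w)) \<noteq> 0" "f (hpt (\<phi> w)) = poly_at P (hpt (\<phi> w)) / poly_at Q (hpt (\<phi> w))"
      using f chart_in_variety [OF chart(1) w(1)] w(2) by blast+
    then show ?thesis using c(1) by (simp add: c(2) [OF PQ(1)] c(2) [OF PQ(2)])
  qed
  have "\<forall>\<^sub>F w in nhds w0. hpt (\<phi> w) \<notin> - U"
    by (rule chart_not_zariski_closed [OF chart U(1)]) (use U(2) in simp)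
  with chart_eventually_domain [OF chart]
  have "\<forall>\<^sub>F w in nhds w0. f (hpt (\<phi> w)) = P (($) (\<phi> w)) / Q (($) (\<phi> w))"
    by eventually_elim (use quot in blast)
  moreover have "holo_germ (\<lambda>w. P (($) (\<phi> w)) / Q (($) (\<phi> w))) w0"
    using holo_germ_divide [OF holo_germ_homog_poly [OF PQ(1) chart_holo_map_germ [OF chart]]
      holo_germ_homog_poly [OF PQ(2) chart_holo_map_germ [OF chart]]] quot [OF chart(2) U(2)] by blast
  ultimately show ?thesis by (rule holo_germ_cong [rotated])
qed

lemma lb_power_simps [simp]:
  "lb_index (lb_power L k) = lb_index L" "lb_open (lb_power L k) = lb_open L"
  "lb_trans (lb_power L k) i j x = lb_trans L i j x ^ k"
  by (simp_all add: lb_power_def)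

lemma lin_comb_smult: "lin_comb \<sigma> (c *s a) i x = c * lin_comb \<sigma> a i x"
  by (simp add: lin_comb_def sum_distrib_left mult_ac)

text \<open>The factor does not depend on \<open>a\<close>, so at a fixed point of \<open>X\<close> the vanishing of a section of the family,
  and of its derivative with respect to the parameter, does not depend on the trivialisation.\<close>

lemma lin_comb_transition:
  assumes "\<And>r. \<sigma> r \<in> sections X M" "i \<in> lb_index M" "j \<in> lb_index M" "x \<in> lb_open M i" "x \<in> lb_open M j"
  shows "lin_comb \<sigma> a i x = lb_trans M i j x * lin_comb \<sigma> a j x"
proof -
  have "\<sigma> r i x = lb_trans M i j x * \<sigma> r j x" for r
    using assms unfolding sections_def by blast
  then show ?thesis by (simp add: lin_comb_def sum_distrib_left mult_ac)
qed

lemma chart_section_holo: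
  assumes "chart X W \<phi>" "w \<in> W" "s \<in> sections X M" "i \<in> lb_index M" "hpt (\<phi> w) \<in> lb_open M i"
  shows "holo_germ (\<lambda>w. s i (hpt (\<phi> w))) w"
proof (rule chart_regular_holo [OF assms(1,2)])
  have "hpt (\<phi> w) \<in> X" by (rule chart_in_variety [OF assms(1,2)])
  then show "regular_at X (s i) (hpt (\<phi> w))"
    using assms(3-5) unfolding sections_def regular_on_def by blast
qed

lemma family_holo:
  fixes \<eta> :: "complex \<Rightarrow> complex ^ 'r::finite"
  assumes \<sigma>: "\<And>r. \<sigma> r \<in> sections X M" and i: "i \<in> lb_index M"
    and chart: "chart X W \<phi>" "space_part z0 \<in> W" "hpt (\<phi> (space_part z0)) \<in> lb_open M i"
    and \<eta>: "holo_lift \<eta> \<gamma> (ball c \<rho>)" "z0 $ None \<in> ball c \<rho>"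
  shows "holo_germ (\<lambda>z. lin_comb \<sigma> (\<eta> (z $ None)) i (hpt (\<phi> (space_part z)))) z0"
  unfolding lin_comb_def
proof (rule holo_germ_sum [OF finite], rule holo_germ_mult)
  fix r :: 'r
  have "(\<lambda>t. \<eta> t $ r) holomorphic_on ball c \<rho>" using \<eta>(1) unfolding holo_lift_def by blast
  then show "holo_germ (\<lambda>z. \<eta> (z $ None) $ r) z0"
    by (rule holo_germ_holomorphic_compose [OF _ open_ball \<eta>(2) holo_germ_nth])
  show "holo_germ (\<lambda>z. \<sigma> r i (hpt (\<phi> (space_part z)))) z0"
    by (rule holo_germ_compose [OF chart_section_holo [OF chart(1,2) \<sigma> i chart(3)] holo_map_germ_space_part])
qed

text \<open>Fibre equations use the chosen homogeneous coordinates of a point of the linear system, total equations a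
  holomorphic lift; the two differ by a nonzero constant on each fibre.\<close>

lemma lift_eq_smult_hcoord:
  assumes "holo_lift \<eta> \<gamma> N" "t \<in> N"
  obtains l where "l \<noteq> 0" "\<eta> t = l *s hcoord (\<gamma> t)"
proof -
  have "\<eta> t \<noteq> 0" "hpt (\<eta> t) = hpt (hcoord (\<gamma> t))"
    using assms by (auto simp: holo_lift_def hpt_hcoord)
  then show thesis using hpt_eq_iff [OF _ hcoord_nonzero] that by blast
qed

text \<open>The equation of the fibre is, up to a nonzero constant, the restriction of the total equation to a
  hyperplane, so it inherits a vanishing differential.\<close>

lemma family_singular_imp_fibre_singular:
  fixes z :: "complex ^ 'd::finite option"
  assumes "i \<in> lb_index M" "chart X W \<phi>" "space_part z \<in> W" "hpt (\<phi> (space_part z)) \<in> lb_open M i"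
    and \<eta>: "holo_lift \<eta> \<gamma> N" "z $ None \<in> N"
    and H: "H = (\<lambda>z :: complex ^ 'd option. lin_comb \<sigma> (\<eta> (z $ None)) i (hpt (\<phi> (space_part z))))"
    and sing: "H z = 0" "(H has_derivative (\<lambda>v. 0)) (at z)"
  shows "hpt (\<phi> (space_part z)) \<in> fibre_singular_points TYPE('d) X M \<sigma> (\<gamma> (z $ None))"
proof -
  let ?t = "z $ None" and ?w = "space_part z"
  define f where "f w = lin_comb \<sigma> (hcoord (\<gamma> ?t)) i (hpt (\<phi> w))" for w
  obtain l where l: "l \<noteq> 0" "\<eta> ?t = l *s hcoord (\<gamma> ?t)" by (rule lift_eq_smult_hcoord [OF \<eta>])
  have f: "f w = 1 / l * H (join w ?t)" for w
    using l(1) by (simp add: f_def H l(2) lin_comb_smult)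
  have "((\<lambda>w. H (join w ?t)) has_derivative (\<lambda>v. 0)) (at ?w)"
    by (rule has_derivative_compose [OF has_derivative_join_left, of H "\<lambda>v. 0"]) (use sing(2) in simp)
  then have "((\<lambda>w. 1 / l * H (join w ?t)) has_derivative (\<lambda>v. 0)) (at ?w)"
    by (rule has_derivative_zero_mult [OF has_derivative_const]) (use sing(1) in simp)
  then have "(f has_derivative (\<lambda>v. 0)) (at ?w)" by (simp only: f [abs_def])
  moreover have "f ?w = 0" using sing(1) by (simp add: f)
  ultimately have "singular_germ f ?w" unfolding singular_germ_def by blast
  moreover have "fibre_equation X M \<sigma> (\<gamma> ?t) (hpt (\<phi> ?w)) f ?w"
    unfolding fibre_equation_def f_def using assms(1-4) by blast
  ultimately show ?thesis unfolding fibre_singular_points_def by blast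
qed

section \<open>Singularities of the total space\<close>

text \<open>The chart and the trivialisation in which the total space is seen to be singular need not be those in which
  the fibre is seen to have an ordinary double point. The equation \<open>H\<close> of the total space in the latter is
  again singular: along the fibre because a double point is a critical point, and in the direction of the
  parameter because the point of \<open>X\<close> is the same and only the trivialisation changes.\<close>

theorem proposition3:
  fixes X :: "'m::finite proj set"
    and L :: "('i, 'm) line_bundle"
    and n k :: nat
    and \<sigma> :: "'r::finite \<Rightarrow> ('i, 'm) lb_section"
    and s0 :: "'r proj"
    and \<Gamma> :: "'r proj set"
    and \<epsilon> :: real
    and \<gamma> :: "complex \<Rightarrow> 'r proj"
  assumes "smooth_projective_variety (2 * n) X"
    and "CARD('d::finite) = 2 * n"
    and "is_line_bundle X L"
    and "ample X L"
    and "k > 0"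
    and "very_ample X (lb_power L k)"
    and "section_basis X (lb_power L k) \<sigma>"
    and "at_general_point (discriminant TYPE('d) X (lb_power L k) \<sigma>)
           (nonzero_vanishing_cycle TYPE('d) X (lb_power L k) \<sigma>)"
    and "s0 \<in> discriminant TYPE('d) X (lb_power L k) \<sigma>"
    and "\<Gamma> \<inter> discriminant TYPE('d) X (lb_power L k) \<sigma> = {s0}"
    and "disc_normalization \<Gamma> s0 \<epsilon> \<gamma>"
    and "\<forall>x \<in> fibre_singular_points TYPE('d) X (lb_power L k) \<sigma> s0.
           ordinary_double_point TYPE('d) X (lb_power L k) \<sigma> s0 x"
  shows "\<forall>y \<in> total_singular_points TYPE('d) X (lb_power L k) \<sigma> \<gamma> \<epsilon>.
           \<exists>m\<ge>1. total_type_A TYPE('d) m X (lb_power L k) \<sigma> \<gamma> y"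
proof
  define M where "M = lb_power L k"
  fix y assume y: "y \<in> total_singular_points TYPE('d) X (lb_power L k) \<sigma> \<gamma> \<epsilon>"
  obtain x c where xc: "y = (x, c)" by (cases y)
  have \<sigma>: "\<sigma> r \<in> sections X M" for r
    using \<open>section_basis X (lb_power L k) \<sigma>\<close> unfolding section_basis_def M_def by blast
  have closed: "zariski_closed (X - lb_open M i)" if "i \<in> lb_index M" for i
    using \<open>is_line_bundle X L\<close> that unfolding is_line_bundle_def M_def lb_power_simps by blast
  \<comment> \<open>The parametrisation is injective, so the disc meets the discriminant over the origin only.\<close>
  have inj: "t = 0" if "t \<in> ball 0 \<epsilon>" "\<gamma> t \<in> discriminant TYPE('d) X M \<sigma>" for t
  proof -
    obtain \<gamma>' where hom: "homeomorphism (ball 0 \<epsilon>) \<Gamma> \<gamma> \<gamma>'" and \<epsilon>: "\<epsilon> > 0" "\<gamma> 0 = s0"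
      using \<open>disc_normalization \<Gamma> s0 \<epsilon> \<gamma>\<close> unfolding disc_normalization_def by blast
    have "\<gamma> t \<in> \<Gamma>" using hom that(1) unfolding homeomorphism_def by blast
    then have "\<gamma> t = \<gamma> 0" using that(2) \<open>\<Gamma> \<inter> discriminant TYPE('d) X (lb_power L k) \<sigma> = {s0}\<close> \<epsilon>(2)
      unfolding M_def by blast
    moreover have "\<gamma>' (\<gamma> t) = t" "\<gamma>' (\<gamma> 0) = 0" using hom that(1) \<epsilon>(1) unfolding homeomorphism_def by simp_all
    ultimately show ?thesis by simp
  qed
  obtain F :: "complex ^ 'd option \<Rightarrow> complex" and z0 where c: "c \<in> ball 0 \<epsilon>"
    and eq: "total_equation X M \<sigma> \<gamma> x c F z0" and sing: "singular_germ F z0"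
    using y unfolding xc total_singular_points_def M_def by blast
  obtain W \<phi> \<rho> \<eta> i where i: "i \<in> lb_index M" and chart: "chart X W \<phi>" "space_part z0 \<in> W"
    and z0: "z0 $ None = c" "hpt (\<phi> (space_part z0)) = x" "x \<in> lb_open M i"
    and \<rho>: "\<rho> > 0" and \<eta>: "holo_lift \<eta> \<gamma> (ball c \<rho>)"
    and F: "F = (\<lambda>z. lin_comb \<sigma> (\<eta> (z $ None)) i (hpt (\<phi> (space_part z))))"
    using eq unfolding total_equation_def by blast
  have singF: "F z0 = 0" "(F has_derivative (\<lambda>v. 0)) (at z0)"
    using sing unfolding singular_germ_def by blast+
  have cball: "z0 $ None \<in> ball c \<rho>" using z0(1) \<rho> by simp
  have fsing: "x \<in> fibre_singular_points TYPE('d) X M \<sigma> (\<gamma> c)"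
    using family_singular_imp_fibre_singular [OF i chart _ \<eta> cball F singF] z0 by simp
  then have "\<gamma> c \<in> discriminant TYPE('d) X M \<sigma>" unfolding discriminant_def by blast
  then have c0: "c = 0" using inj c by blast
  have \<gamma>0: "\<gamma> 0 = s0" using \<open>disc_normalization \<Gamma> s0 \<epsilon> \<gamma>\<close> unfolding disc_normalization_def by blast
  have \<epsilon>: "\<epsilon> > 0" using \<open>disc_normalization \<Gamma> s0 \<epsilon> \<gamma>\<close> unfolding disc_normalization_def by blast
  have "ordinary_double_point TYPE('d) X M \<sigma> s0 x"
    using assms(12) fsing unfolding c0 \<gamma>0 M_def by blast
  then obtain f :: "complex ^ 'd \<Rightarrow> complex" and w1 where "fibre_equation X M \<sigma> s0 x f w1"
    and iso: "germ_iso f w1 (odp_model :: complex ^ 'd \<Rightarrow> complex) 0"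
    unfolding ordinary_double_point_def by blast
  then obtain W1 \<phi>1 j where j: "j \<in> lb_index M" and chart1: "chart X W1 \<phi>1" "w1 \<in> W1"
    and x1: "hpt (\<phi>1 w1) = x" "x \<in> lb_open M j"
    and f: "f = (\<lambda>w. lin_comb \<sigma> (hcoord s0) j (hpt (\<phi>1 w)))"
    unfolding fibre_equation_def by blast
  have \<eta>0: "holo_lift \<eta> \<gamma> (ball 0 \<rho>)" using \<eta> c0 by simp
  define H where "H z = lin_comb \<sigma> (\<eta> (z $ None)) j (hpt (\<phi>1 (space_part z)))" for z :: "complex ^ 'd option"
  define z1 where "z1 = join w1 0"
  have z1: "space_part z1 = w1" "z1 $ None = 0" by (simp_all add: z1_def)
  have holH: "holo_germ H z1"
    unfolding H_def
    by (rule family_holo [OF \<sigma> j chart1(1) _ _ \<eta>0]) (simp_all add: z1 chart1 x1 \<rho>)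
  have "0 \<in> ball (0 :: complex) \<rho>" using \<rho> by simp
  then obtain l where l: "l \<noteq> 0" "\<eta> 0 = l *s hcoord s0"
    using lift_eq_smult_hcoord [OF \<eta>0] \<gamma>0 by metis
  have H0: "H (join w 0) = l * f w" for w by (simp add: H_def l(2) lin_comb_smult f)
  have holf: "holo_germ f w1"
  proof -
    have "holo_germ (\<lambda>w. lin_comb \<sigma> (hcoord s0) j (hpt (\<phi>1 w))) w1"
      unfolding lin_comb_def
      by (rule holo_germ_sum [OF finite], rule holo_germ_mult [OF holo_germ_const],
          rule chart_section_holo [OF chart1 \<sigma> j]) (simp add: x1)
    then show ?thesis by (simp add: f)
  qed
  have f0: "f w1 = 0" "(f has_derivative (\<lambda>v. 0)) (at w1)"
    by (rule odp_normal_form [OF iso holf], assumption)+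
  \<comment> \<open>Over the fixed point \<open>x\<close> of \<open>X\<close>, the two equations differ by the value of a transition function.\<close>
  have Ht: "H (join w1 t) = lb_trans M j i x * F (join (space_part z0) t)" for t
    using lin_comb_transition [OF \<sigma> j i] z0 x1 by (simp add: H_def F)
  have singH: "(H has_derivative (\<lambda>v. 0)) (at z1)"
    unfolding z1_def
  proof (rule has_derivative_zero_join)
    show "cx_diff H (join w1 0)" using holo_germ_cx_diff [OF holH] by (simp add: z1_def)
    show "((\<lambda>w. H (join w 0)) has_derivative (\<lambda>v. 0)) (at w1)"
      unfolding H0 by (rule has_derivative_zero_mult [OF has_derivative_const f0(2,1)])
    have z0': "join (space_part z0) 0 = z0" using join_space_part [of z0] z0(1) c0 by simp
    have "((\<lambda>t. F (join (space_part z0) t)) has_derivative (\<lambda>v. 0)) (at 0)"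
      by (rule has_derivative_compose [OF has_derivative_join_right, of F "\<lambda>v. 0"])
        (simp only: z0' singF(2))
    then show "((\<lambda>t. H (join w1 t)) has_derivative (\<lambda>v. 0)) (at 0)"
      unfolding Ht by (rule has_derivative_zero_mult [OF has_derivative_const]) (simp only: z0' singF(1))
  qed
  have H1: "H z1 = 0" using H0 [of w1] f0(1) by (simp add: z1_def)
  have totH: "total_equation X M \<sigma> \<gamma> x c H z1"
    unfolding total_equation_def H_def [abs_def] c0
    by (rule exI [of _ W1], rule exI [of _ \<phi>1], rule exI [of _ \<rho>], rule exI [of _ \<eta>], rule bexI [OF _ j])
      (simp add: chart1 z1 x1 \<rho> \<eta>0)
  have "germ_iso f (space_part z1) (odp_model :: complex ^ 'd \<Rightarrow> complex) 0" using iso z1 by simp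
  from odp_family_dichotomy [OF holH z1(2) singH H1 this H0 l(1)]
  show "\<exists>m\<ge>1. total_type_A TYPE('d) m X (lb_power L k) \<sigma> \<gamma> y"
  proof (elim disjE exE conjE)
    fix m assume m: "m \<ge> 1" "germ_iso H z1 (A_model m :: complex ^ 'd option \<Rightarrow> complex) 0"
    then have "total_type_A TYPE('d) m X (lb_power L k) \<sigma> \<gamma> y"
      unfolding total_type_A_def xc using totH unfolding M_def by blast
    then show ?thesis using m(1) by blast
  next
    fix \<kappa>
    assume \<kappa>: "isCont \<kappa> 0" "\<kappa> 0 = z1" and
      ev: "\<forall>\<^sub>F t in nhds 0. \<kappa> t $ None = t \<and> H (\<kappa> t) = 0 \<and> (H has_derivative (\<lambda>v. 0)) (at (\<kappa> t))"
    have "\<forall>\<^sub>F w in nhds w1. hpt (\<phi>1 w) \<notin> X - lb_open M j"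
      by (rule chart_not_zariski_closed [OF chart1 closed [OF j]]) (simp add: x1)
    with chart_eventually_domain [OF chart1]
    have "\<forall>\<^sub>F w in nhds w1. w \<in> W1 \<and> hpt (\<phi>1 w) \<in> lb_open M j"
      by eventually_elim (use chart_in_variety [OF chart1(1)] in blast)
    then have "\<forall>\<^sub>F z in nhds z1. space_part z \<in> W1 \<and> hpt (\<phi>1 (space_part z)) \<in> lb_open M j"
      by (rule eventually_nhds_holo_map_germ [OF holo_map_germ_space_part z1(1)])
    then have "\<forall>\<^sub>F t in nhds 0. space_part (\<kappa> t) \<in> W1 \<and> hpt (\<phi>1 (space_part (\<kappa> t))) \<in> lb_open M j"
      by (rule eventually_nhds_isCont [OF \<kappa>(1), unfolded \<kappa>(2)])
    moreover have "\<forall>\<^sub>F t in nhds 0. t \<in> ball (0 :: complex) \<epsilon>" "\<forall>\<^sub>F t in nhds 0. t \<in> ball (0 :: complex) \<rho>"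
      by (rule eventually_nhds_in_open; simp add: \<epsilon> \<rho>)+
    ultimately have "\<forall>\<^sub>F t in nhds 0. t = (0 :: complex)"
      using ev
    proof eventually_elim
      case (elim t)
      have t: "\<kappa> t $ None = t" using elim(4) by blast
      have "hpt (\<phi>1 (space_part (\<kappa> t))) \<in> fibre_singular_points TYPE('d) X M \<sigma> (\<gamma> (\<kappa> t $ None))"
        by (rule family_singular_imp_fibre_singular [OF j chart1(1) _ _ \<eta>0 _ ext [OF H_def]])
          (use elim t in simp_all)
      then have "\<gamma> t \<in> discriminant TYPE('d) X M \<sigma>" unfolding t discriminant_def by blast
      then show ?case using inj elim(2) by blast
    qed
    \<comment> \<open>The origin of the disc is not an isolated point.\<close>
    then have "\<forall>\<^sub>F t in at (0 :: complex). False"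
      unfolding eventually_at_filter by (rule eventually_mono) simp
    then show ?thesis by simp
  qed
qed

end
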